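(* Let $p\ge 1$ be an integer and let $\boldsymbol{\beta}=(\beta_0,\ldots,\beta_{p-1})$ be a $p$-tuple of real numbers greater than $1$. The measure $\mu_{\boldsymbol{\beta}}\circ\phi_{\boldsymbol{\beta}}^{-1}$ is the unique $L_{\boldsymbol{\beta}}$-invariant probability measure on $\mathcal{L}_{\boldsymbol{\beta}}$ that is absolutely continuous with respect to $\lambda_p\circ\phi_{\boldsymbol{\beta}}^{-1}$. Furthermore, $\mu_{\boldsymbol{\beta}}\circ\phi_{\boldsymbol{\beta}}^{-1}$ is equivalent to $\lambda_p\circ\phi_{\boldsymbol{\beta}}^{-1}$ on $\mathcal{L}_{\boldsymbol{\beta}}$ and the dynamical system $\big(\bigcup_{i=0}^{p-1}(\{i\}\times(0,x_{\boldsymbol{\beta}^{(i)}}]),\mathcal{L}_{\boldsymbol{\beta}},\mu_{\boldsymbol{\beta}}\circ\phi_{\boldsymbol{\beta}}^{-1},L_{\boldsymbol{\beta}}\big)$ is ergodic and has entropy $\frac1p\log(\beta_{p-1}\cdots\beta_0)$.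
   Context: Conventions: for $n\in\mathbb{Z}$, $\beta_n=\beta_{n\bmod p}$ and $\boldsymbol{\beta}^{(n)}=(\beta_n,\ldots,\beta_{n+p-1})$. Put $x_{\boldsymbol{\beta}}=\sum_{n=0}^\infty\frac{\lceil\beta_n\rceil-1}{\prod_{k=0}^n\beta_k}$, a real number with $1\le x_{\boldsymbol{\beta}}<\infty$; $x_{\boldsymbol{\beta}^{(n)}}$ is the same quantity for the base $\boldsymbol{\beta}^{(n)}$. Lazy $\boldsymbol{\beta}$-transformation $L_{\boldsymbol{\beta}}$ on $\bigcup_{i=0}^{p-1}(\{i\}\times(0,x_{\boldsymbol{\beta}^{(i)}}])$: $L_{\boldsymbol{\beta}}(i,x)=((i+1)\bmod p,\ \beta_ix)$ if $x\in(0,x_{\boldsymbol{\beta}^{(i)}}-1]$, and $L_{\boldsymbol{\beta}}(i,x)=((i+1)\bmod p,\ \beta_ix-\lceil\beta_ix-x_{\boldsymbol{\beta}^{(i+1)}}\rceil)$ if $x\in(x_{\boldsymbol{\beta}^{(i)}}-1,x_{\boldsymbol{\beta}^{(i)}}]$. $\mathcal{B}(A)$ is the Borel $\sigma$-algebra of $A$, $\lambda$ the Lebesgue measure. $\mathcal{T}_{\boldsymbol{\beta}}$ (resp. $\mathcal{L}_{\boldsymbol{\beta}}$) is the $\sigma$-algebra of all sets $\bigcup_{i=0}^{p-1}(\{i\}\times B_i)$ with $B_i\in\mathcal{B}([0,x_{\boldsymbol{\beta}^{(i)}}))$ (resp. $B_i\in\mathcal{B}((0,x_{\boldsymbol{\beta}^{(i)}}])$)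 for all $i$. The map $\phi_{\boldsymbol{\beta}}\colon\bigcup_{i=0}^{p-1}(\{i\}\times[0,x_{\boldsymbol{\beta}^{(i)}}))\to\bigcup_{i=0}^{p-1}(\{i\}\times(0,x_{\boldsymbol{\beta}^{(i)}}])$ is $(i,x)\mapsto(i,x_{\boldsymbol{\beta}^{(i)}}-x)$. For a real $\beta>1$ let $T_\beta\colon[0,1)\to[0,1)$, $x\mapsto\beta x-\lfloor\beta x\rfloor$. For $i\in\{0,\ldots,p-1\}$, $\mu_{\boldsymbol{\beta},i}$ is the unique absolutely continuous (w.r.t. $\lambda$) probability measure on $\mathcal{B}([0,1))$ invariant under $T_{\beta_{i-1}}\circ\cdots\circ T_{\beta_{i-p}}$ (existence and uniqueness hold). On $\mathcal{T}_{\boldsymbol{\beta}}$ the measures $\mu_{\boldsymbol{\beta}}$ and $\lambda_p$ are defined by $\mu_{\boldsymbol{\beta}}\big(\bigcup_{i}(\{i\}\times B_i)\big)=\frac1p\sum_{i=0}^{p-1}\mu_{\boldsymbol{\beta},i}(B_i\cap[0,1))$ and $\lambda_p\big(\bigcup_{i}(\{i\}\times B_i)\big)=\frac1p\sum_{i=0}^{p-1}\lambda(B_i\cap[0,1))$. Two measures are equivalent if each is absolutely continuous with respect to the other. Ergodic: $T^{-1}(B)=B$ implies $\mu(B)\in\{0,1\}$. Entropy is the measure-theoretic entropy. *)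

theory Defs
  imports "HOL-Probability.Probability"
begin

definition invariant_under :: "'a measure \<Rightarrow> ('a \<Rightarrow> 'a) \<Rightarrow> bool" where
  "invariant_under M T \<longleftrightarrow>
     T \<in> measurable M M \<and>
     (\<forall>B\<in>sets M. emeasure M (T -` B \<inter> space M) = emeasure M B)"

definition ergodic :: "'a measure \<Rightarrow> ('a \<Rightarrow> 'a) \<Rightarrow> bool" where
  "ergodic M T \<longleftrightarrow>
     (\<forall>B\<in>sets M. T -` B \<inter> space M = B \<longrightarrow> emeasure M B = 0 \<or> emeasure M B = 1)"

definition equivalent_measures :: "'a measure \<Rightarrow> 'a measure \<Rightarrow> bool" where
  "equivalent_measures M N \<longleftrightarrow>
     sets M = sets N \<and> absolutely_continuous M N \<and> absolutely_continuous N M"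

definition finite_partitions :: "'a measure \<Rightarrow> 'a set set set" where
  "finite_partitions M = {P. finite P \<and> P \<subseteq> sets M \<and> partition_on (space M) P}"

text \<open>The common refinement of the preimages of \<open>P\<close> under the first \<open>n\<close> iterates
  of \<open>T\<close>, starting with the zeroth. It may contain the empty set, which is harmless below
  because \<open>0 * ln 0 = 0\<close>.\<close>

definition iterated_join ::
    "'a measure \<Rightarrow> ('a \<Rightarrow> 'a) \<Rightarrow> 'a set set \<Rightarrow> nat \<Rightarrow> 'a set set" where
  "iterated_join M T P n =
     {{x \<in> space M. \<forall>k<n. (T ^^ k) x \<in> A k} | A. \<forall>k<n. A k \<in> P}"

definition partition_entropy :: "'a measure \<Rightarrow> 'a set set \<Rightarrow> real" where
  "partition_entropy M P = - (\<Sum>A\<in>P. measure M A * ln (measure M A))"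

text \<open>The limit exists whenever \<open>T\<close> preserves the probability measure \<open>M\<close>
  (subadditivity).\<close>

definition entropy_wrt_partition ::
    "'a measure \<Rightarrow> ('a \<Rightarrow> 'a) \<Rightarrow> 'a set set \<Rightarrow> real" where
  "entropy_wrt_partition M T P =
     lim (\<lambda>n. partition_entropy M (iterated_join M T P n) / real n)"

definition measure_theoretic_entropy :: "'a measure \<Rightarrow> ('a \<Rightarrow> 'a) \<Rightarrow> ereal" where
  "measure_theoretic_entropy M T =
     (SUP P\<in>finite_partitions M. ereal (entropy_wrt_partition M T P))"

text \<open>A base is the list of its entries; the length of the list is the period \<open>p\<close>.\<close>

definition base_at :: "real list \<Rightarrow> int \<Rightarrow> real" where
  "base_at \<beta> n = \<beta> ! nat (n mod int (length \<beta>))"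

definition base_shift :: "real list \<Rightarrow> int \<Rightarrow> real list" where
  "base_shift \<beta> n = map (\<lambda>j. base_at \<beta> (n + int j)) [0..<length \<beta>]"

definition x_base :: "real list \<Rightarrow> real" where
  "x_base \<beta> =
     (\<Sum>n. (of_int \<lceil>base_at \<beta> (int n)\<rceil> - 1) / (\<Prod>k\<le>n. base_at \<beta> (int k)))"

abbreviation x_shift :: "real list \<Rightarrow> nat \<Rightarrow> real" where
  "x_shift \<beta> i \<equiv> x_base (base_shift \<beta> (int i))"

definition fibred_space :: "nat \<Rightarrow> (nat \<Rightarrow> real set) \<Rightarrow> (nat \<times> real) set" where
  "fibred_space p A = (\<Union>i<p. {i} \<times> A i)"

definition fibred_sets :: "nat \<Rightarrow> (nat \<Rightarrow> real set) \<Rightarrow> (nat \<times> real) set set" where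
  "fibred_sets p A =
     {\<Union>i<p. {i} \<times> B i | B. \<forall>i<p. B i \<in> sets (restrict_space borel (A i))}"

definition greedy_space :: "real list \<Rightarrow> (nat \<times> real) set" where
  "greedy_space \<beta> = fibred_space (length \<beta>) (\<lambda>i. {0..<x_shift \<beta> i})"

definition greedy_sets :: "real list \<Rightarrow> (nat \<times> real) set set" where
  "greedy_sets \<beta> = fibred_sets (length \<beta>) (\<lambda>i. {0..<x_shift \<beta> i})"

definition lazy_space :: "real list \<Rightarrow> (nat \<times> real) set" where
  "lazy_space \<beta> = fibred_space (length \<beta>) (\<lambda>i. {0<..x_shift \<beta> i})"

definition lazy_sets :: "real list \<Rightarrow> (nat \<times> real) set set" where
  "lazy_sets \<beta> = fibred_sets (length \<beta>) (\<lambda>i. {0<..x_shift \<beta> i})"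

text \<open>Only the values on \<open>lazy_space \<beta>\<close>, which is mapped to itself, are relevant.\<close>

definition lazy_map :: "real list \<Rightarrow> nat \<times> real \<Rightarrow> nat \<times> real" where
  "lazy_map \<beta> = (\<lambda>(i, x).
     ((i + 1) mod length \<beta>,
      if x \<le> x_shift \<beta> i - 1 then base_at \<beta> (int i) * x
      else base_at \<beta> (int i) * x - of_int \<lceil>base_at \<beta> (int i) * x - x_shift \<beta> (i + 1)\<rceil>))"

definition phi_map :: "real list \<Rightarrow> nat \<times> real \<Rightarrow> nat \<times> real" where
  "phi_map \<beta> = (\<lambda>(i, x). (i, x_shift \<beta> i - x))"

definition T_map :: "real \<Rightarrow> real \<Rightarrow> real" where
  "T_map b x = b * x - of_int \<lfloor>b * x\<rfloor>"

text \<open>The composition \<open>T_map \<beta>\<^sub>i\<^sub>-\<^sub>1 \<circ> \<dots> \<circ> T_map \<beta>\<^sub>i\<^sub>-\<^sub>p\<close>,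
  in which the rightmost map is applied first.\<close>

definition T_return :: "real list \<Rightarrow> nat \<Rightarrow> real \<Rightarrow> real" where
  "T_return \<beta> i =
     foldr (\<lambda>k. T_map (base_at \<beta> (int i - int k))) [1..<length \<beta> + 1]"

definition mu_fibre :: "real list \<Rightarrow> nat \<Rightarrow> real measure" where
  "mu_fibre \<beta> i =
     (THE M. sets M = sets (restrict_space borel {0..<1}) \<and>
             prob_space M \<and>
             absolutely_continuous (restrict_space lborel {0..<1}) M \<and>
             invariant_under M (T_return \<beta> i))"

definition averaged_measure ::
    "real list \<Rightarrow> (nat \<Rightarrow> real measure) \<Rightarrow> (nat \<times> real) measure" where
  "averaged_measure \<beta> m =
     measure_of (greedy_space \<beta>) (greedy_sets \<beta>)
       (\<lambda>E. ennreal (1 / real (length \<beta>)) *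
            (\<Sum>i<length \<beta>. emeasure (m i) (Pair i -` E \<inter> {0..<1})))"

definition mu_greedy :: "real list \<Rightarrow> (nat \<times> real) measure" where
  "mu_greedy \<beta> = averaged_measure \<beta> (mu_fibre \<beta>)"

definition lambda_p :: "real list \<Rightarrow> (nat \<times> real) measure" where
  "lambda_p \<beta> = averaged_measure \<beta> (\<lambda>_. lborel)"

definition push_phi :: "real list \<Rightarrow> (nat \<times> real) measure \<Rightarrow> (nat \<times> real) measure" where
  "push_phi \<beta> M = distr M (sigma (lazy_space \<beta>) (lazy_sets \<beta>)) (phi_map \<beta>)"

definition lazy_acim :: "real list \<Rightarrow> (nat \<times> real) measure \<Rightarrow> bool" where
  "lazy_acim \<beta> M \<longleftrightarrow>
     sets M = lazy_sets \<beta> \<and>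
     prob_space M \<and>
     invariant_under M (lazy_map \<beta>) \<and>
     absolutely_continuous (push_phi \<beta> (lambda_p \<beta>)) M"

end

theory Submission
  imports Defs "HOL-Real_Asymp.Real_Asymp"
begin

text \<open>
  Put \<open>z = x\<^sub>i - x\<close> on the fibre \<open>i\<close>. For \<open>0 \<le> z < 1\<close> the lazy map becomes \<open>z \<mapsto> T_map \<beta>\<^sub>i z\<close>
  from the fibre \<open>i\<close> to the fibre \<open>i + 1\<close>, and all measures in question live on this part.

  Existence. Every branch of \<open>T_map \<beta>\<^sub>i\<close> maps its left endpoint to \<open>0\<close>, so the transfer
  operators act on the indicators of the intervals \<open>[0, c)\<close>. Starting on fibre \<open>j\<close> from
  \<open>[0, 1)\<close> one runs through the intervals \<open>[0, c\<^sub>n)\<close>, where \<open>c\<^sub>n\<close> is the orbit of \<open>1\<close>, and at step \<open>n\<close>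
  the digit \<open>d\<^sub>n\<close> of \<open>1\<close> counts the full branches that are split off. Hence the densities
  \<open>\<Sum> w\<^sub>j / (\<beta>\<^sub>j \<cdots> \<beta>\<^sub>j\<^sub>+\<^sub>n\<^sub>-\<^sub>1) 1\<^bsub>[0, c\<^sub>n)\<^esub>\<close>, summed over the \<open>j, n\<close> with \<open>j + n \<equiv> i\<close> modulo \<open>p\<close>, are
  invariant as soon as \<open>w\<close> is stationary for the Markov chain on the fibres that jumps from \<open>j\<close> to
  \<open>j + n + 1\<close> with probability \<open>d\<^sub>n / (\<beta>\<^sub>j \<cdots> \<beta>\<^sub>j\<^sub>+\<^sub>n)\<close>. They are bounded and bounded away from \<open>0\<close>.

  Ergodicity and uniqueness. An invariant set has density at most \<open>m\<close> in each cylinder,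
  where \<open>m\<close> is the largest Lebesgue measure of its fibres; approximating a fibre by cylinders gives
  \<open>m \<le> m\<^sup>2\<close>. Uniqueness follows by applying this to a limes superior of preimages of a Hahn set of
  the difference of two invariant measures.

  Entropy. The cylinders of length \<open>n\<close> have measure \<open>O(e\<^sup>-\<^sup>n\<^sup>h)\<close>, there are \<open>O(n e\<^sup>n\<^sup>h)\<close> of them, and
  they approximate every Borel set; so the digits generate with entropy \<open>h\<close>.
\<close>

section \<open>Entropy of a measure-preserving map with a generator\<close>

text \<open>The last branch of \<open>T_map\<close> is in general cut off, so a cylinder need not be
  mapped onto [0, 1). What persists is that an initial interval [0, c) yields full copies of [0, 1)
  and one more initial interval. Estimates are therefore stated for every c at once: the densities,
  the mass of an invariant set and the number of digit words all reproduce themselves under one step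
  in this form.

  \<open>mu_fibre\<close> is a definite description, so nothing is known about it before existence
  and uniqueness are settled for the return map of each fibre. The measures are built on all fibres
  together and transported by the one-step maps; a set invariant under a return map is spread over
  the fibres to reach the same ergodicity theorem.

  Ergodicity is proved for Lebesgue measure, because uniqueness compares two measures of which
  little more than absolute continuity is known. It speaks of strictly invariant sets, while a Hahn
  set is invariant only up to null sets; hence the limes superior. The lower bound of the densities,
  which gives equivalence, comes from irreducibility of the chain: the first digit of 1 is at least
  1, so each fibre leads to the next.\<close>

lemma fekete_subadditive:
  fixes a :: "nat \<Rightarrow> real"
  assumes nonneg: "\<And>n. 0 \<le> a n" and sub: "\<And>m n. a (m + n) \<le> a m + a n"
  shows "convergent (\<lambda>n. a n / real n)"
proof -
  define L where "L = (INF n\<in>{1..}. a n / real n)"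
  have bdd: "bdd_below ((\<lambda>n. a n / real n) ` {1..})"
    by (rule bdd_belowI[of _ 0]) (auto simp: nonneg)
  have low: "L \<le> a n / real n" if "n \<ge> 1" for n
    unfolding L_def by (rule cINF_lower[OF bdd]) (use that in auto)
  have lin: "a r \<le> a 0 + real r * a 1" for r
  proof (induction r)
    case (Suc r)
    then show ?case using sub[of r 1] by (simp add: algebra_simps)
  qed simp
  have mult: "a (q * m + r) \<le> real q * a m + a r" for q m r
  proof (induction q)
    case (Suc q)
    then show ?case using sub[of m "q * m + r"] by (simp add: algebra_simps)
  qed simp
  have "(\<lambda>n. a n / real n) \<longlonglongrightarrow> L"
  proof (rule LIMSEQ_I)
    fix e :: real assume e: "e > 0"
    have "\<exists>x\<in>(\<lambda>n. a n / real n) ` {1..}. x < L + e / 2"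
      unfolding L_def by (rule cInf_lessD) (use e in auto)
    then obtain m where m: "m \<ge> 1" "a m / real m < L + e / 2" by auto
    \<comment> \<open>\<open>K\<close> bounds \<open>a r\<close> for all remainders
      \<open>r < m\<close> at once, so its share \<open>K / n\<close> vanishes in the limit.\<close>
    define K where "K = a 0 + real m * a 1"
    have K0: "K \<ge> 0" unfolding K_def using nonneg[of 0] nonneg[of 1] by simp
    obtain N where N: "real N > 2 * K / e" using reals_Archimedean2 by blast
    show "\<exists>no. \<forall>n\<ge>no. norm (a n / real n - L) < e"
    proof (intro exI[of _ "max N 1"] allI impI)
      fix n assume n: "n \<ge> max N 1"
      define q r where "q = n div m" and "r = n mod m"
      have nq: "n = q * m + r" by (simp add: q_def r_def)
      have r: "r < m" using m by (simp add: r_def)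
      have "a r \<le> K"
        using lin[of r] r nonneg[of 1] mult_right_mono[of "real r" "real m" "a 1"]
        unfolding K_def by simp
      then have "a n \<le> real q * a m + K" using mult[of q m r] nq by simp
      moreover have "real q * a m \<le> real n * (a m / real m)"
      proof -
        have "real q * real m \<le> real n" using nq by (metis le_add1 of_nat_le_iff of_nat_mult)
        then have "real q * real m * (a m / real m) \<le> real n * (a m / real m)"
          by (intro mult_right_mono) (auto simp: nonneg)
        then show ?thesis using m by simp
      qed
      ultimately have "a n \<le> real n * (a m / real m) + K" by simp
      then have "a n / real n \<le> a m / real m + K / real n"
        using n by (simp add: field_simps)
      moreover have "K / real n < e / 2"
      proof -
        have "2 * K / e < real n" using N n by linarith
        then show ?thesis using n e by (simp add: field_simps)
      qed
      ultimately have "a n / real n < L + e" using m by linarith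
      moreover have "L \<le> a n / real n" using low n by simp
      ultimately show "norm (a n / real n - L) < e" by simp
    qed
  qed
  then show ?thesis by (auto simp: convergent_def)
qed

text \<open>Partitions are handled through the labelling functions whose level sets they are: a
  refinement becomes a list of labels, to which the Shannon entropy of random variables
  applies.\<close>

definition orbit_name :: "('a \<Rightarrow> 'a) \<Rightarrow> ('a \<Rightarrow> 'c) \<Rightarrow> nat \<Rightarrow> 'a \<Rightarrow> 'c list" where
  "orbit_name T D n x = map (\<lambda>k. D ((T ^^ k) x)) [0..<n]"

lemma orbit_name_add:
  "orbit_name T D (m + n) x = orbit_name T D m x @ orbit_name T D n ((T ^^ m) x)"
proof -
  have "[0..<m + n] = [0..<m] @ map (\<lambda>k. k + m) [0..<n]"
    by (simp add: map_add_upt upt_add_eq_append[of 0 m n] add.commute)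
  then show ?thesis unfolding orbit_name_def by (simp add: funpow_add)
qed

lemma length_orbit_name [simp]: "length (orbit_name T D n x) = n"
  by (simp add: orbit_name_def)

lemma orbit_name_nth: "k < n \<Longrightarrow> orbit_name T D n x ! k = D ((T ^^ k) x)"
  by (simp add: orbit_name_def)

lemma funpow_measurable:
  "T \<in> measurable M M \<Longrightarrow> T ^^ n \<in> measurable M M"
  by (induction n) (auto intro: measurable_comp)

lemma simple_function_orbit_name:
  assumes T: "T \<in> measurable M M" and D: "simple_function M D"
  shows "simple_function M (orbit_name T D n)"
proof (induction n)
  case 0
  have "orbit_name T D 0 = (\<lambda>x. [])" by (auto simp: orbit_name_def)
  then show ?case by simp
next
  case (Suc n)
  have "simple_function M (\<lambda>x. D ((T ^^ n) x))"
    by (rule simple_function_comp[OF funpow_measurable[OF T] D])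
  from simple_function_compose[OF simple_function_Pair[OF Suc this], of "\<lambda>(l, c). l @ [c]"]
  show ?case by (simp add: comp_def orbit_name_def)
qed

lemma invariant_underD:
  assumes "invariant_under M T"
  shows "T \<in> measurable M M" "B \<in> sets M \<Longrightarrow> measure M (T -` B \<inter> space M) = measure M B"
  using assms by (auto simp: invariant_under_def measure_def)

lemma invariant_under_funpow:
  assumes inv: "invariant_under M T"
  shows "invariant_under M (T ^^ n)"
proof (induction n)
  case 0
  then show ?case
    using sets.sets_into_space by (auto simp: invariant_under_def Int_absorb2)
next
  case (Suc n)
  note T = invariant_underD(1)[OF inv]
  note Tn = invariant_underD(1)[OF Suc]
  show ?case unfolding invariant_under_def
  proof (intro conjI ballI)
    show "T ^^ Suc n \<in> measurable M M" by (rule funpow_measurable[OF T])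
    fix B assume B: "B \<in> sets M"
    have "(T ^^ Suc n) -` B \<inter> space M = (T ^^ n) -` (T -` B \<inter> space M) \<inter> space M"
      using measurable_space[OF Tn] by auto
    moreover have "emeasure M ((T ^^ n) -` (T -` B \<inter> space M) \<inter> space M)
        = emeasure M (T -` B \<inter> space M)"
      using Suc measurable_sets[OF T B] by (simp only: invariant_under_def)
    moreover have "emeasure M (T -` B \<inter> space M) = emeasure M B"
      using inv B by (simp only: invariant_under_def)
    ultimately show "emeasure M ((T ^^ Suc n) -` B \<inter> space M) = emeasure M B" by metis
  qed
qed

section \<open>Shannon entropy of finitely valued random variables, in natural logarithms\<close>

context prob_space
begin

interpretation information_space M "exp 1"
  by standard simp

abbreviation shannon_entropy (\<open>\<H>'(_')\<close>) where
  "\<H>(X) \<equiv> entropy (exp 1) (count_space (X ` space M)) X"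

lemma entropy_simple_eq:
  assumes "simple_function M X"
  shows "\<H>(X) = - (\<Sum>c\<in>X ` space M. prob (X -` {c} \<inter> space M) * ln (prob (X -` {c} \<inter> space M)))"
  using entropy_simple_distributed[OF simple_distributedI[OF assms measure_nonneg refl]]
  by (simp add: log_ln[symmetric])

lemma sum_prob_simple:
  assumes X: "simple_function M X"
  shows "(\<Sum>c\<in>X ` space M. prob (X -` {c} \<inter> space M)) = 1"
proof -
  have "prob (\<Union>c\<in>X ` space M. X -` {c} \<inter> space M)
      = (\<Sum>c\<in>X ` space M. prob (X -` {c} \<inter> space M))"
    by (rule finite_measure_finite_Union)
      (use X in \<open>auto simp: disjoint_family_on_def simple_function_def\<close>)
  moreover have "(\<Union>c\<in>X ` space M. X -` {c} \<inter> space M) = space M" by auto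
  ultimately show ?thesis by (simp add: prob_space)
qed

lemma entropy_pair_le:
  assumes "simple_function M X" "simple_function M Y"
  shows "\<H>(\<lambda>x. (X x, Y x)) \<le> \<H>(X) + \<H>(Y)"
  using entropy_chain_rule[OF assms] conditional_entropy_less_eq_entropy[OF assms(2,1)] by simp

lemma entropy_determined_le:
  assumes X: "simple_function M X" and Y: "\<And>x. Y x = f (X x)"
  shows "\<H>(Y) \<le> \<H>(X)"
proof -
  have "Y = f \<circ> X" using Y by auto
  then show ?thesis using entropy_data_processing[OF X, of f] by simp
qed

lemma entropy_simple_nonneg:
  assumes "simple_function M X"
  shows "0 \<le> \<H>(X)"
proof -
  have "prob A * ln (prob A) \<le> 0" for A
    by (cases "prob A = 0") (auto simp: mult_le_0_iff measure_nonneg ln_le_zero_iff zero_less_measure_iff)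
  then show ?thesis unfolding entropy_simple_eq[OF assms] by (simp add: sum_nonpos)
qed

text \<open>Entropy is the mean of \<open>- ln p\<close>, and \<open>- ln p \<ge> a\<close> on every
  level set of positive mass.\<close>

lemma entropy_ge:
  assumes X: "simple_function M X"
    and le: "\<And>c. prob (X -` {c} \<inter> space M) \<le> exp (- a)"
  shows "a \<le> \<H>(X)"
proof -
  let ?p = "\<lambda>c. prob (X -` {c} \<inter> space M)"
  have "?p c * ln (?p c) \<le> ?p c * (- a)" for c
  proof (cases "?p c = 0")
    case False
    then have "?p c > 0" by (simp add: zero_less_measure_iff)
    then have "ln (?p c) \<le> - a" using le[of c] by (metis ln_exp ln_le_cancel_iff exp_gt_zero)
    then show ?thesis by (intro mult_left_mono) auto
  qed simp
  then have "(\<Sum>c\<in>X ` space M. ?p c * ln (?p c)) \<le> (\<Sum>c\<in>X ` space M. ?p c * (- a))"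
    by (intro sum_mono)
  also have "\<dots> = - a" by (simp add: sum_distrib_right[symmetric] sum_prob_simple[OF X] sum_negf)
  finally show ?thesis unfolding entropy_simple_eq[OF X] by simp
qed

text \<open>Only values of positive probability count, and all of these lie in \<open>W\<close>.
  Allowing an exceptional null set matters later, where only the names of points with z < 1 are
  counted.\<close>

lemma entropy_le_card_AE:
  assumes X: "simple_function M X" and W: "finite W" and AE: "AE x in M. X x \<in> W"
  shows "\<H>(X) \<le> ln (real (card W))"
proof -
  let ?f = "\<lambda>c. prob (X -` {c} \<inter> space M)"
  let ?S = "X ` space M \<inter> {c. ?f c \<noteq> 0}"
  have "\<H>(X) \<le> ln (real (card ?S))"
    using entropy_le_card_not_0[OF simple_distributedI[OF X measure_nonneg refl]]
    by (simp add: log_ln[symmetric])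
  also have "\<dots> \<le> ln (real (card W))"
  proof -
    have sub: "?S \<subseteq> W"
    proof
      fix c assume c: "c \<in> ?S"
      show "c \<in> W"
      proof (rule ccontr)
        assume "c \<notin> W"
        have "AE x in M. x \<notin> X -` {c} \<inter> space M"
          by (rule AE_mp[OF AE AE_I2]) (use \<open>c \<notin> W\<close> in auto)
        then have "?f c = 0"
          using prob_eq_0[OF simple_functionD(2)[OF X], of "{c}"] by blast
        then show False using c by simp
      qed
    qed
    have "?S \<noteq> {}"
    proof
      assume "?S = {}"
      then have "(\<Sum>c\<in>X ` space M. ?f c) = 0" by (intro sum.neutral) auto
      then show False using sum_prob_simple[OF X] by simp
    qed
    then have "card ?S > 0" using sub W by (meson card_gt_0_iff finite_subset)
    then show ?thesis using card_mono[OF W sub] by simp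
  qed
  finally show ?thesis .
qed

lemma entropy_comp_invariant:
  assumes X: "simple_function M X" and inv: "invariant_under M T"
  shows "\<H>(\<lambda>x. X (T x)) = \<H>(X)"
proof -
  note T = invariant_underD(1)[OF inv]
  have XT: "simple_function M (\<lambda>x. X (T x))" by (rule simple_function_comp[OF T X])
  have eq: "prob ((\<lambda>x. X (T x)) -` {c} \<inter> space M) = prob (X -` {c} \<inter> space M)" for c
  proof -
    have S: "X -` {c} \<inter> space M \<in> sets M" using X by (rule simple_functionD)
    have "(\<lambda>x. X (T x)) -` {c} \<inter> space M = T -` (X -` {c} \<inter> space M) \<inter> space M"
      using measurable_space[OF T] by auto
    then show ?thesis using invariant_underD(2)[OF inv S] by simp
  qed
  have "(\<Sum>c\<in>(\<lambda>x. X (T x)) ` space M. prob (X -` {c} \<inter> space M) * ln (prob (X -` {c} \<inter> space M)))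
    = (\<Sum>c\<in>X ` space M. prob (X -` {c} \<inter> space M) * ln (prob (X -` {c} \<inter> space M)))"
  \<comment> \<open>Composition with \<open>T\<close> may lose values of \<open>X\<close>; by
    invariance the lost values have probability 0.\<close>
  proof (rule sum.mono_neutral_left)
    show "finite (X ` space M)" using X by (rule simple_functionD)
    show "(\<lambda>x. X (T x)) ` space M \<subseteq> X ` space M" using measurable_space[OF T] by auto
    show "\<forall>c\<in>X ` space M - (\<lambda>x. X (T x)) ` space M.
        prob (X -` {c} \<inter> space M) * ln (prob (X -` {c} \<inter> space M)) = 0"
    proof
      fix c assume "c \<in> X ` space M - (\<lambda>x. X (T x)) ` space M"
      then have "(\<lambda>x. X (T x)) -` {c} \<inter> space M = {}" by blast
      then show "prob (X -` {c} \<inter> space M) * ln (prob (X -` {c} \<inter> space M)) = 0"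
        using eq[of c] by simp
    qed
  qed
  then show ?thesis unfolding entropy_simple_eq[OF X] entropy_simple_eq[OF XT] eq by simp
qed

text \<open>The function \<open>- (t * ln t)\<close> is small near 0 and near 1: the value
  \<open>c0\<close> has probability close to 1, every other value close to 0. The range
  \<open>C\<close> is fixed beforehand, so one \<open>\<epsilon>\<close> serves all
  \<open>X\<close>.\<close>

lemma entropy_small:
  fixes c0 :: 'c
  assumes C: "finite C" and d: "0 < \<delta>"
  obtains \<epsilon> where "\<epsilon> > 0"
    "\<And>X. simple_function M X \<Longrightarrow> X ` space M \<subseteq> C \<Longrightarrow>
        prob {x \<in> space M. X x \<noteq> c0} < \<epsilon> \<Longrightarrow> \<H>(X) < \<delta>"
proof -
  define \<eta> where "\<eta> t = - (t * ln t)" for t :: real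
  define \<delta>' where "\<delta>' = \<delta> / (real (card C) + 1)"
  have d': "\<delta>' > 0" using d by (simp add: \<delta>'_def)
  have "(\<eta> \<longlongrightarrow> 0) (at_right 0)" unfolding \<eta>_def by real_asymp
  then have "\<forall>\<^sub>F t in at_right 0. \<eta> t < \<delta>'" using d' by (rule order_tendstoD)
  then obtain e1 where e1: "e1 > 0" "\<And>t. 0 < t \<Longrightarrow> t < e1 \<Longrightarrow> \<eta> t < \<delta>'"
    unfolding eventually_at_right_field by auto
  have "(\<eta> \<longlongrightarrow> \<eta> 1) (at_left 1)"
    unfolding \<eta>_def by (intro tendsto_intros) auto
  then have "(\<eta> \<longlongrightarrow> 0) (at_left 1)" by (simp add: \<eta>_def)
  then have "\<forall>\<^sub>F t in at_left 1. \<eta> t < \<delta>'" using d' by (rule order_tendstoD)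
  then obtain e2 where e2: "e2 < 1" "\<And>t. e2 < t \<Longrightarrow> t < 1 \<Longrightarrow> \<eta> t < \<delta>'"
    unfolding eventually_at_left_field by auto
  define \<epsilon> where "\<epsilon> = min e1 (1 - e2)"
  have eta0: "\<eta> 0 = 0" "\<eta> 1 = 0" by (auto simp: \<eta>_def)
  show thesis
  proof (rule that[of \<epsilon>])
    show "\<epsilon> > 0" using e1 e2 by (simp add: \<epsilon>_def)
    fix X assume X: "simple_function M X" and XC: "X ` space M \<subseteq> C"
      and small: "prob {x \<in> space M. X x \<noteq> c0} < \<epsilon>"
    let ?p = "\<lambda>c. prob (X -` {c} \<inter> space M)"
    have ms: "X -` A \<inter> space M \<in> sets M" for A using X by (rule simple_functionD)
    have eq: "{x \<in> space M. X x \<noteq> c0} = X -` (- {c0}) \<inter> space M" by auto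
    have *: "\<eta> (?p c) < \<delta>'" for c
    proof -
      have p01: "0 \<le> ?p c" "?p c \<le> 1" by (rule measure_nonneg, rule prob_le_1)
      consider "?p c = 0" | "?p c = 1" | "0 < ?p c" "?p c < e1" | "e2 < ?p c" "?p c < 1"
      proof (cases "c = c0")
        case True
        have "{x \<in> space M. X x \<noteq> c0} = space M - (X -` {c0} \<inter> space M)" by auto
        then have "prob {x \<in> space M. X x \<noteq> c0} = 1 - prob (X -` {c0} \<inter> space M)"
          using prob_compl[OF ms[of "{c0}"]] by metis
        then have "?p c = 1 - prob {x \<in> space M. X x \<noteq> c0}"
          using True by simp
        then have "e2 < ?p c" using small min.cobounded2[of e1 "1 - e2"] unfolding \<epsilon>_def by linarith
        then show ?thesis using that(2,4) p01 by argo
      next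
        case False
        have "?p c \<le> prob {x \<in> space M. X x \<noteq> c0}"
          unfolding eq by (rule finite_measure_mono) (use False ms in auto)
        then have "?p c < e1" using small min.cobounded1[of e1 "1 - e2"] unfolding \<epsilon>_def by linarith
        then show ?thesis using that(1,3) p01 by argo
      qed
      then show ?thesis
      proof cases
        case 1
        then show ?thesis using eta0(1) d' by metis
      next
        case 2
        then show ?thesis using eta0(2) d' by metis
      qed (auto intro: e1(2) e2(2))
    qed
    have "\<H>(X) = (\<Sum>c\<in>X ` space M. \<eta> (?p c))"
      unfolding entropy_simple_eq[OF X] \<eta>_def by (simp add: sum_negf)
    also have "\<dots> \<le> (\<Sum>c\<in>X ` space M. \<delta>')" by (intro sum_mono less_imp_le *)
    also have "\<dots> = real (card (X ` space M)) * \<delta>'" by simp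
    also have "\<dots> \<le> real (card C) * \<delta>'"
      using d' card_mono[OF C XC] by (intro mult_right_mono) auto
    also have "\<dots> < (real (card C) + 1) * \<delta>'" using d' by (simp add: algebra_simps)
    also have "\<dots> = \<delta>" by (simp add: \<delta>'_def)
    finally show "\<H>(X) < \<delta>" .
  qed
qed

text \<open>\<open>entropy_wrt_partition\<close> is defined by \<open>lim\<close>, which carries
  information only together with convergence. Splitting a name into two pieces makes the entropies
  subadditive, the second piece being distributed like a name from time 0.\<close>

lemma entropy_orbit_name_convergent:
  assumes inv: "invariant_under M T" and D: "simple_function M D"
  shows "convergent (\<lambda>n. \<H>(orbit_name T D n) / real n)"
proof (rule fekete_subadditive)
  note T = invariant_underD(1)[OF inv]
  note sf = simple_function_orbit_name[OF T D]
  show "0 \<le> \<H>(orbit_name T D n)" for n by (rule entropy_simple_nonneg[OF sf])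
  fix m n
  have sf': "simple_function M (\<lambda>x. orbit_name T D n ((T ^^ m) x))"
    by (rule simple_function_comp[OF funpow_measurable[OF T] sf])
  have "\<H>(orbit_name T D (m + n))
      \<le> \<H>(\<lambda>x. (orbit_name T D m x, orbit_name T D n ((T ^^ m) x)))"
    by (rule entropy_determined_le[OF simple_function_Pair[OF sf sf'], of _ "\<lambda>(u, v). u @ v"])
      (simp add: orbit_name_add)
  also have "\<dots> \<le> \<H>(orbit_name T D m) + \<H>(\<lambda>x. orbit_name T D n ((T ^^ m) x))"
    by (rule entropy_pair_le[OF sf sf'])
  also have "\<H>(\<lambda>x. orbit_name T D n ((T ^^ m) x)) = \<H>(orbit_name T D n)"
    by (rule entropy_comp_invariant[OF sf invariant_under_funpow[OF inv]])
  finally show "\<H>(orbit_name T D (m + n)) \<le> \<H>(orbit_name T D m) + \<H>(orbit_name T D n)" .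
qed

text \<open>By invariance each of the n letters has the entropy of \<open>D\<close>. The intended
  \<open>D\<close> is the label that corrects a wrong guess, whose entropy is small.\<close>

lemma entropy_orbit_name_le:
  assumes inv: "invariant_under M T" and D: "simple_function M D"
  shows "\<H>(orbit_name T D n) \<le> real n * \<H>(D)"
proof (induction n)
  case 0
  have "orbit_name T D 0 = (\<lambda>x. [])" by (auto simp: orbit_name_def)
  then show ?case
    using entropy_le_card_AE[of "\<lambda>x. []" "{[]}"] by simp
next
  case (Suc n)
  note T = invariant_underD(1)[OF inv]
  note sf = simple_function_orbit_name[OF T D]
  have sf': "simple_function M (\<lambda>x. D ((T ^^ n) x))"
    by (rule simple_function_comp[OF funpow_measurable[OF T] D])
  have "\<H>(orbit_name T D (Suc n)) \<le> \<H>(\<lambda>x. (orbit_name T D n x, D ((T ^^ n) x)))"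
    by (rule entropy_determined_le[OF simple_function_Pair[OF sf sf'], of _ "\<lambda>(u, v). u @ [v]"])
      (simp add: orbit_name_def)
  also have "\<dots> \<le> \<H>(orbit_name T D n) + \<H>(\<lambda>x. D ((T ^^ n) x))"
    by (rule entropy_pair_le[OF sf sf'])
  also have "\<H>(\<lambda>x. D ((T ^^ n) x)) = \<H>(D)"
    by (rule entropy_comp_invariant[OF D invariant_under_funpow[OF inv]])
  finally show ?case using Suc by (simp add: algebra_simps)
qed

lemma partition_entropy_eq_entropy:
  assumes X: "simple_function M X"
    and P: "P - {{}} = (\<lambda>c. X -` {c} \<inter> space M) ` X ` space M"
  shows "partition_entropy M P = \<H>(X)"
proof -
  have fin: "finite (P - {{}})" unfolding P using X by (auto dest: simple_functionD)
  have "(\<Sum>A\<in>P. prob A * ln (prob A)) = (\<Sum>A\<in>P - {{}}. prob A * ln (prob A))"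
    by (rule sum.mono_neutral_right) (use fin in auto)
  also have "\<dots> = (\<Sum>c\<in>X ` space M. prob (X -` {c} \<inter> space M) * ln (prob (X -` {c} \<inter> space M)))"
    unfolding P by (subst sum.reindex) (auto simp: inj_on_def)
  finally show ?thesis unfolding partition_entropy_def entropy_simple_eq[OF X] by simp
qed

section \<open>Finite partitions as labelling functions\<close>

definition atom_of :: "'a set set \<Rightarrow> 'a \<Rightarrow> 'a set" where
  "atom_of P x = (THE A. A \<in> P \<and> x \<in> A)"

lemma atom_of_eq:
  assumes "P \<in> finite_partitions M" "A \<in> P" "x \<in> A"
  shows "atom_of P x = A"
proof -
  have "disjoint P" using assms(1) by (simp add: finite_partitions_def partition_on_def)
  then show ?thesis unfolding atom_of_def
    using assms by (intro the_equality) (auto simp: disjoint_def)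
qed

lemma atom_of_in:
  assumes P: "P \<in> finite_partitions M" and "x \<in> space M"
  shows "atom_of P x \<in> P" "x \<in> atom_of P x"
proof -
  obtain A where "A \<in> P" "x \<in> A"
    using assms by (auto simp: finite_partitions_def partition_on_def)
  then show "atom_of P x \<in> P" "x \<in> atom_of P x" using atom_of_eq[OF P] by auto
qed

lemma simple_function_atom_of:
  assumes P: "P \<in> finite_partitions M"
  shows "simple_function M (atom_of P)"
  unfolding simple_function_def
proof (intro conjI ballI)
  have sub: "atom_of P ` space M \<subseteq> P" using atom_of_in[OF P] by auto
  have fP: "finite P" and PM: "P \<subseteq> sets M" using P by (auto simp: finite_partitions_def)
  show "finite (atom_of P ` space M)" using sub fP by (rule finite_subset)
  fix A assume "A \<in> atom_of P ` space M"
  then have A: "A \<in> P" using sub by auto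
  have "A \<subseteq> space M" using A PM sets.sets_into_space by blast
  then have "atom_of P -` {A} \<inter> space M = A"
    using atom_of_eq[OF P A] atom_of_in(2)[OF P] by auto
  then show "atom_of P -` {A} \<inter> space M \<in> sets M" using A PM by auto
qed

text \<open>An atom of the join that contains a point y is the level set of the name of y; the join
  and the family of level sets differ at most by the empty set.\<close>

lemma partition_entropy_iterated_join:
  assumes inv: "invariant_under M T" and P: "P \<in> finite_partitions M"
  shows "partition_entropy M (iterated_join M T P n) = \<H>(orbit_name T (atom_of P) n)"
proof (rule partition_entropy_eq_entropy)
  note T = invariant_underD(1)[OF inv]
  note Tsp = measurable_space[OF funpow_measurable[OF T]]
  let ?X = "orbit_name T (atom_of P) n"
  show "simple_function M ?X"
    by (rule simple_function_orbit_name[OF T simple_function_atom_of[OF P]])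
  have eq: "{x \<in> space M. \<forall>k<n. (T ^^ k) x \<in> A k} = ?X -` {?X y} \<inter> space M"
    if A: "\<forall>k<n. A k \<in> P" and y: "y \<in> space M" "\<forall>k<n. (T ^^ k) y \<in> A k" for A y
  proof -
    have "?X x = ?X y \<longleftrightarrow> (\<forall>k<n. (T ^^ k) x \<in> A k)" if x: "x \<in> space M" for x
    proof -
      have "?X x = ?X y \<longleftrightarrow> (\<forall>k<n. atom_of P ((T ^^ k) x) = atom_of P ((T ^^ k) y))"
        unfolding list_eq_iff_nth_eq by (auto simp: orbit_name_nth)
      also have "\<dots> \<longleftrightarrow> (\<forall>k<n. (T ^^ k) x \<in> A k)"
        using A y atom_of_eq[OF P] atom_of_in[OF P Tsp[OF x]] by metis
      finally show ?thesis .
    qed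
    then show ?thesis by auto
  qed
  show "iterated_join M T P n - {{}} = (\<lambda>c. ?X -` {c} \<inter> space M) ` ?X ` space M"
  proof (intro equalityI subsetI)
    fix E assume E: "E \<in> iterated_join M T P n - {{}}"
    then obtain A where A: "\<forall>k<n. A k \<in> P" "E = {x \<in> space M. \<forall>k<n. (T ^^ k) x \<in> A k}"
      unfolding iterated_join_def by auto
    from E obtain y where "y \<in> E" by auto
    then have y: "y \<in> space M" "\<forall>k<n. (T ^^ k) y \<in> A k" using A(2) by auto
    have "E = ?X -` {?X y} \<inter> space M" unfolding A(2) by (rule eq[OF A(1) y])
    then show "E \<in> (\<lambda>c. ?X -` {c} \<inter> space M) ` ?X ` space M"
      by (rule image_eqI) (use y in simp)
  next
    fix E assume "E \<in> (\<lambda>c. ?X -` {c} \<inter> space M) ` ?X ` space M"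
    then obtain y where y: "y \<in> space M" "E = ?X -` {?X y} \<inter> space M" by auto
    define A where "A k = atom_of P ((T ^^ k) y)" for k
    have A: "\<forall>k<n. A k \<in> P" "\<forall>k<n. (T ^^ k) y \<in> A k"
      unfolding A_def using atom_of_in[OF P Tsp[OF y(1)]] by auto
    have "E = {x \<in> space M. \<forall>k<n. (T ^^ k) x \<in> A k}"
      unfolding y(2) by (rule eq[OF A(1) y(1) A(2), symmetric])
    then have "E \<in> iterated_join M T P n" unfolding iterated_join_def using A(1) by blast
    moreover have "y \<in> E" using y by simp
    ultimately show "E \<in> iterated_join M T P n - {{}}" by auto
  qed
qed

lemma entropy_wrt_partition_LIMSEQ:
  assumes inv: "invariant_under M T" and P: "P \<in> finite_partitions M"
  shows "(\<lambda>n. \<H>(orbit_name T (atom_of P) n) / real n) \<longlonglongrightarrow> entropy_wrt_partition M T P"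
  unfolding entropy_wrt_partition_def partition_entropy_iterated_join[OF inv P]
  by (rule convergent_LIMSEQ_iff[THEN iffD1,
      OF entropy_orbit_name_convergent[OF inv simple_function_atom_of[OF P]]])

text \<open>The upper bound compares an arbitrary partition \<open>P\<close> with a generator \<open>D\<close>: given a guess
  of the \<open>P\<close>-label from a \<open>D\<close>-name of length \<open>m\<close>, the first \<open>n\<close> \<open>P\<close>-labels are determined by
  the \<open>D\<close>-name of length \<open>n + m\<close> together with the \<open>n\<close> corrections of wrong guesses, and the
  entropy of one correction is small.\<close>

lemma entropy_orbit_name_correction:
  assumes inv: "invariant_under M T" and D: "simple_function M D" and Y: "simple_function M Y"
  shows "\<H>(orbit_name T Y n) \<le> \<H>(orbit_name T D (n + m))
    + real n * \<H>(\<lambda>x. if Y x = f (orbit_name T D m x) then None else Some (Y x))"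
    (is "_ \<le> _ + real n * \<H>(?e)")
proof -
  note T = invariant_underD(1)[OF inv]
  have sfD: "simple_function M (orbit_name T D k)" for k
    by (rule simple_function_orbit_name[OF T D])
  have sfe: "simple_function M ?e"
    using simple_function_compose[OF simple_function_Pair[OF sfD Y],
        of "\<lambda>(w, y). if y = f w then None else Some y" m]
    by (simp add: comp_def)
  have sfE: "simple_function M (orbit_name T ?e n)"
    by (rule simple_function_orbit_name[OF T sfe])
  define dec where "dec = (\<lambda>(w, es).
    map (\<lambda>k. case es ! k of None \<Rightarrow> f (take m (drop k w)) | Some y \<Rightarrow> y) [0..<n])"
  have take: "take m (drop k (orbit_name T D (n + m) x)) = orbit_name T D m ((T ^^ k) x)"
    if "k < n" for k x
  proof -
    have nm: "n + m = k + (m + (n - k))" using that by simp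
    show ?thesis unfolding nm orbit_name_add[of T D k] orbit_name_add[of T D m] by simp
  qed
  have "\<H>(orbit_name T Y n) \<le> \<H>(\<lambda>x. (orbit_name T D (n + m) x, orbit_name T ?e n x))"
    by (rule entropy_determined_le[OF simple_function_Pair[OF sfD sfE], of _ dec],
        rule nth_equalityI) (auto simp: dec_def orbit_name_nth take)
  also have "\<dots> \<le> \<H>(orbit_name T D (n + m)) + \<H>(orbit_name T ?e n)"
    by (rule entropy_pair_le[OF sfD sfE])
  also have "\<dots> \<le> \<H>(orbit_name T D (n + m)) + real n * \<H>(?e)"
    using entropy_orbit_name_le[OF inv sfe] by simp
  finally show ?thesis .
qed

text \<open>Each atom gets its own approximate test on names of length \<open>mm A\<close>. All
  tests are read off prefixes of one long name, and a guess can be wrong only at a point that some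
  test misjudges.\<close>

lemma guess_atom_from_name:
  assumes T: "T \<in> measurable M M" and D: "simple_function M D" and P: "P \<in> finite_partitions M"
    and approx: "\<And>A \<epsilon>. A \<in> sets M \<Longrightarrow> 0 < \<epsilon> \<Longrightarrow>
      \<exists>m S. prob {x \<in> space M. (x \<in> A) \<noteq> (orbit_name T D m x \<in> S)} < \<epsilon>"
    and e: "0 < \<epsilon>"
  shows "\<exists>m f. prob {x \<in> space M. atom_of P x \<noteq> f (orbit_name T D m x)} < \<epsilon>"
proof -
  have fP: "finite P" and PM: "P \<subseteq> sets M" using P by (auto simp: finite_partitions_def)
  define \<epsilon>' where "\<epsilon>' = \<epsilon> / (real (card P) + 1)"
  have e': "\<epsilon>' > 0" using e by (simp add: \<epsilon>'_def)
  have "\<forall>A\<in>P. \<exists>m S. prob {x \<in> space M. (x \<in> A) \<noteq> (orbit_name T D m x \<in> S)} < \<epsilon>'"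
    using approx[OF _ e'] PM by auto
  then obtain mm SS where mS: "\<And>A. A \<in> P \<Longrightarrow>
      prob {x \<in> space M. (x \<in> A) \<noteq> (orbit_name T D (mm A) x \<in> SS A)} < \<epsilon>'"
    by metis
  \<comment> \<open>The sum is a convenient common upper bound of the lengths.\<close>
  define m where "m = (\<Sum>A\<in>P. mm A)"
  have mle: "mm A \<le> m" if "A \<in> P" for A unfolding m_def using that fP by (simp add: member_le_sum)
  have take: "take (mm A) (orbit_name T D m x) = orbit_name T D (mm A) x" if "A \<in> P" for A x
    using orbit_name_add[of T D "mm A" "m - mm A" x] mle[OF that] by simp
  define f where "f w = (SOME A. A \<in> P \<and> take (mm A) w \<in> SS A)" for w
  define Bad where "Bad A = {x \<in> space M. (x \<in> A) \<noteq> (orbit_name T D (mm A) x \<in> SS A)}" for A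
  have BadM: "Bad A \<in> sets M" if "A \<in> P" for A
  proof -
    have "Bad A = (space M - A) \<inter> (orbit_name T D (mm A) -` SS A \<inter> space M)
        \<union> (A \<inter> (orbit_name T D (mm A) -` (- SS A) \<inter> space M))"
      using that PM sets.sets_into_space by (auto simp: Bad_def)
    then show ?thesis
      using simple_functionD(2)[OF simple_function_orbit_name[OF T D]] that PM by auto
  qed
  have "{x \<in> space M. atom_of P x \<noteq> f (orbit_name T D m x)} \<subseteq> (\<Union>A\<in>P. Bad A)"
  proof
    fix x assume "x \<in> {x \<in> space M. atom_of P x \<noteq> f (orbit_name T D m x)}"
    then have x: "x \<in> space M" and ne: "atom_of P x \<noteq> f (orbit_name T D m x)" by auto
    show "x \<in> (\<Union>A\<in>P. Bad A)"
    proof (rule ccontr)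
      assume "x \<notin> (\<Union>A\<in>P. Bad A)"
      then have *: "x \<in> A \<longleftrightarrow> take (mm A) (orbit_name T D m x) \<in> SS A" if "A \<in> P" for A
        using x that take[OF that] by (auto simp: Bad_def)
      \<comment> \<open>If no test misjudges x, its true atom passes and no other does, so
        \<open>SOME\<close> can pick nothing else.\<close>
      have "f (orbit_name T D m x) \<in> P \<and>
          take (mm (f (orbit_name T D m x))) (orbit_name T D m x) \<in> SS (f (orbit_name T D m x))"
        unfolding f_def by (rule someI[of _ "atom_of P x"]) (use * atom_of_in[OF P x] in auto)
      then show False using * ne atom_of_eq[OF P] by metis
    qed
  qed
  then have "prob {x \<in> space M. atom_of P x \<noteq> f (orbit_name T D m x)} \<le> prob (\<Union>A\<in>P. Bad A)"
    using BadM fP by (intro finite_measure_mono) auto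
  also have "\<dots> \<le> (\<Sum>A\<in>P. prob (Bad A))"
    by (rule finite_measure_subadditive_finite) (use fP BadM in auto)
  also have "\<dots> \<le> (\<Sum>A\<in>P. \<epsilon>')" unfolding Bad_def using mS by (intro sum_mono less_imp_le)
  also have "\<dots> = real (card P) * \<epsilon>'" by simp
  also have "\<dots> < (real (card P) + 1) * \<epsilon>'" using e' by (simp add: algebra_simps)
  also have "\<dots> = \<epsilon>" by (simp add: \<epsilon>'_def)
  finally show ?thesis by blast
qed

text \<open>Counting the names of length \<open>n + m\<close> bounds the first term of the
  correction estimate. After division by n the overhang m, the constant \<open>K\<close> and the
  linear factor disappear, and only the entropy \<open>\<delta>\<close> of a correction
  remains.\<close>

lemma entropy_wrt_partition_le:
  assumes inv: "invariant_under M T" and D: "simple_function M D" and P: "P \<in> finite_partitions M"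
    and W: "\<And>n. finite (W n)" "\<And>n. AE x in M. orbit_name T D n x \<in> W n"
    and cardW: "\<And>n. real (card (W n)) \<le> K * (real n + 1) * exp (real n * h)"
    and approx: "\<And>A \<epsilon>. A \<in> sets M \<Longrightarrow> 0 < \<epsilon> \<Longrightarrow>
      \<exists>m S. prob {x \<in> space M. (x \<in> A) \<noteq> (orbit_name T D m x \<in> S)} < \<epsilon>"
  shows "entropy_wrt_partition M T P \<le> h"
proof (rule field_le_epsilon)
  fix \<delta> :: real assume d: "0 < \<delta>"
  note T = invariant_underD(1)[OF inv]
  note Y = simple_function_atom_of[OF P]
  have fP: "finite P" using P by (auto simp: finite_partitions_def)
  obtain \<epsilon> where e: "\<epsilon> > 0" and small: "\<And>X :: 'a \<Rightarrow> 'a set option. simple_function M X \<Longrightarrow>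
      X ` space M \<subseteq> insert None (Some ` P) \<Longrightarrow> prob {x \<in> space M. X x \<noteq> None} < \<epsilon> \<Longrightarrow> \<H>(X) < \<delta>"
    by (rule entropy_small[of "insert None (Some ` P)" \<delta> None]) (use fP d in auto)
  obtain m f where mf: "prob {x \<in> space M. atom_of P x \<noteq> f (orbit_name T D m x)} < \<epsilon>"
    using guess_atom_from_name[OF T D P approx e] by auto
  let ?e = "\<lambda>x. if atom_of P x = f (orbit_name T D m x) then None else Some (atom_of P x)"
  have sfe: "simple_function M ?e"
    using simple_function_compose[OF simple_function_Pair[OF simple_function_orbit_name[OF T D] Y],
        of "\<lambda>(w, y). if y = f w then None else Some y" m]
    by (simp add: comp_def)
  have He: "\<H>(?e) < \<delta>"
  proof (rule small[OF sfe])
    show "?e ` space M \<subseteq> insert None (Some ` P)" using atom_of_in[OF P] by auto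
    have "{x \<in> space M. ?e x \<noteq> None} = {x \<in> space M. atom_of P x \<noteq> f (orbit_name T D m x)}" by auto
    then show "prob {x \<in> space M. ?e x \<noteq> None} < \<epsilon>" using mf by simp
  qed
  \<comment> \<open>Needed for the logarithm; it follows from the counting bound at n = 0, since
    \<open>W 0\<close> is nonempty.\<close>
  have K: "K > 0"
  proof -
    have "W 0 \<noteq> {}"
    proof
      assume "W 0 = {}"
      then have "AE x in M. False" using W(2)[of 0] by simp
      then show False by simp
    qed
    then have "card (W 0) > 0" using W(1) by (simp add: card_gt_0_iff)
    then show ?thesis using cardW[of 0] by simp
  qed
  have bound: "\<H>(orbit_name T (atom_of P) n) / real n
      \<le> ln (K * (real (n + m) + 1)) / real n + real (n + m) / real n * h + \<delta>" if n: "n \<ge> 1" for n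
  proof -
    have ne: "W (n + m) \<noteq> {}"
    proof
      assume "W (n + m) = {}"
      then have "AE x in M. False" using W(2)[of "n + m"] by simp
      then show False by simp
    qed
    then have c: "card (W (n + m)) > 0" using W(1) by (simp add: card_gt_0_iff)
    have "\<H>(orbit_name T D (n + m)) \<le> ln (real (card (W (n + m))))"
      by (rule entropy_le_card_AE[OF simple_function_orbit_name[OF T D] W])
    also have "\<dots> \<le> ln (K * (real (n + m) + 1) * exp (real (n + m) * h))"
      using cardW[of "n + m"] c by simp
    also have "\<dots> = ln (K * (real (n + m) + 1)) + real (n + m) * h"
      using K by (subst ln_mult) auto
    finally have "\<H>(orbit_name T D (n + m)) \<le> ln (K * (real (n + m) + 1)) + real (n + m) * h" .
    moreover have "real n * \<H>(?e) \<le> real n * \<delta>" using He by (intro mult_left_mono) linarith+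
    ultimately have "\<H>(orbit_name T (atom_of P) n)
        \<le> ln (K * (real (n + m) + 1)) + real (n + m) * h + real n * \<delta>"
      using entropy_orbit_name_correction[OF inv D Y, of n m f] by linarith
    from divide_right_mono[OF this, of "real n"]
    have "\<H>(orbit_name T (atom_of P) n) / real n
      \<le> (ln (K * (real (n + m) + 1)) + real (n + m) * h + real n * \<delta>) / real n" by simp
    also have "\<dots> = ln (K * (real (n + m) + 1)) / real n + real (n + m) / real n * h + \<delta>"
      using n by (simp add: field_simps)
    finally show ?thesis .
  qed
  have lim: "(\<lambda>n. ln (K * (real (n + m) + 1)) / real n + real (n + m) / real n * h + \<delta>)
      \<longlonglongrightarrow> 0 + 1 * h + \<delta>"
  proof (intro tendsto_intros)
    show "(\<lambda>n. ln (K * (real (n + m) + 1)) / real n) \<longlonglongrightarrow> 0" using K by real_asymp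
    show "(\<lambda>n. real (n + m) / real n) \<longlonglongrightarrow> 1" by real_asymp
  qed
  have "entropy_wrt_partition M T P \<le> 0 + 1 * h + \<delta>"
    by (rule LIMSEQ_le[OF entropy_wrt_partition_LIMSEQ[OF inv P] lim]) (use bound in auto)
  then show "entropy_wrt_partition M T P \<le> h + \<delta>" by simp
qed

text \<open>Level sets of names that are exponentially small force entropy at least
  \<open>n * h - ln K\<close>. The witness partition consists of the level sets of \<open>D\<close>,
  and \<open>g\<close> translates its atoms back into labels.\<close>

lemma entropy_wrt_partition_ge:
  assumes inv: "invariant_under M T" and D: "simple_function M D"
    and cyl: "\<And>n w. prob {x \<in> space M. orbit_name T D n x = w} \<le> K * exp (- real n * h)"
  defines "P \<equiv> (\<lambda>c. D -` {c} \<inter> space M) ` D ` space M"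
  shows "P \<in> finite_partitions M" "h \<le> entropy_wrt_partition M T P"
proof -
  note T = invariant_underD(1)[OF inv]
  note Tsp = measurable_space[OF funpow_measurable[OF T]]
  show P: "P \<in> finite_partitions M"
    unfolding finite_partitions_def partition_on_def disjoint_def P_def
    using simple_functionD[OF D] by auto
  define g where "g A = D (SOME x. x \<in> A)" for A
  have Dg: "D x = g (atom_of P x)" if x: "x \<in> space M" for x
  proof -
    have "D -` {D x} \<inter> space M \<in> P" unfolding P_def using x by auto
    then have "atom_of P x = D -` {D x} \<inter> space M" using atom_of_eq[OF P] x by blast
    moreover have "(SOME y. y \<in> D -` {D x} \<inter> space M) \<in> D -` {D x} \<inter> space M"
      by (rule someI[of _ x]) (use x in auto)
    ultimately show ?thesis by (simp add: g_def)
  qed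
  have K: "K > 0"
  proof (rule ccontr)
    assume "\<not> K > 0"
    have "{x \<in> space M. orbit_name T D 0 x = []} = space M" by (auto simp: orbit_name_def)
    then show False using cyl[of 0 "[]"] \<open>\<not> K > 0\<close> by (simp add: prob_space)
  qed
  have ge: "real n * h - ln K \<le> \<H>(orbit_name T (atom_of P) n)" for n
  proof (rule entropy_ge)
    note sf = simple_function_orbit_name[OF T simple_function_atom_of[OF P]]
    show "simple_function M (orbit_name T (atom_of P) n)" by (rule sf)
    fix c
    have sub: "orbit_name T (atom_of P) n -` {c} \<inter> space M
        \<subseteq> {x \<in> space M. orbit_name T D n x = map g c}"
      using Tsp by (auto simp: orbit_name_def Dg)
    have "{x \<in> space M. orbit_name T D n x = map g c} = orbit_name T D n -` {map g c} \<inter> space M"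
      by auto
    then have "{x \<in> space M. orbit_name T D n x = map g c} \<in> sets M"
      using simple_functionD(2)[OF simple_function_orbit_name[OF T D]] by metis
    then have "prob (orbit_name T (atom_of P) n -` {c} \<inter> space M)
        \<le> prob {x \<in> space M. orbit_name T D n x = map g c}"
      using sub by (intro finite_measure_mono)
    also have "\<dots> \<le> K * exp (- real n * h)" by (rule cyl)
    also have "\<dots> = exp (- (real n * h - ln K))" using K by (simp add: exp_diff exp_minus field_simps)
    finally show "prob (orbit_name T (atom_of P) n -` {c} \<inter> space M)
        \<le> exp (- (real n * h - ln K))" .
  qed
  have lim: "(\<lambda>n. h - ln K / real n) \<longlonglongrightarrow> h - 0" by (intro tendsto_intros lim_const_over_n)
  have "h - 0 \<le> entropy_wrt_partition M T P"
  proof (rule LIMSEQ_le[OF lim entropy_wrt_partition_LIMSEQ[OF inv P]], intro exI allI impI)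
    fix n :: nat assume "n \<ge> 1"
    then show "h - ln K / real n \<le> \<H>(orbit_name T (atom_of P) n) / real n"
      using divide_right_mono[OF ge[of n], of "real n"] by (simp add: diff_divide_distrib)
  qed
  then show "h \<le> entropy_wrt_partition M T P" by simp
qed

text \<open>A quantitative form of the Kolmogorov-Sinai theorem: \<open>approx\<close> says that
  names generate all measurable sets up to small errors, \<open>cardW\<close> gives the upper bound
  and \<open>cyl\<close> the matching lower bound with the same rate \<open>h\<close>.\<close>

theorem measure_theoretic_entropy_generator:
  assumes inv: "invariant_under M T" and D: "simple_function M D"
    and W: "\<And>n. finite (W n)" "\<And>n. AE x in M. orbit_name T D n x \<in> W n"
    and cardW: "\<And>n. real (card (W n)) \<le> K * (real n + 1) * exp (real n * h)"
    and cyl: "\<And>n w. prob {x \<in> space M. orbit_name T D n x = w} \<le> K' * exp (- real n * h)"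
    and approx: "\<And>A \<epsilon>. A \<in> sets M \<Longrightarrow> 0 < \<epsilon> \<Longrightarrow>
      \<exists>m S. prob {x \<in> space M. (x \<in> A) \<noteq> (orbit_name T D m x \<in> S)} < \<epsilon>"
  shows "measure_theoretic_entropy M T = ereal h"
  unfolding measure_theoretic_entropy_def
proof (rule antisym)
  show "(SUP P\<in>finite_partitions M. ereal (entropy_wrt_partition M T P)) \<le> ereal h"
    using entropy_wrt_partition_le[OF inv D _ W cardW approx] by (intro SUP_least) auto
  show "ereal h \<le> (SUP P\<in>finite_partitions M. ereal (entropy_wrt_partition M T P))"
    using entropy_wrt_partition_ge[OF inv D cyl] by (intro SUP_upper2) auto
qed

end

section \<open>Uniqueness of invariant measures\<close>

text \<open>Passing to complements reverses the inequality, since both total masses are 1.\<close>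

lemma prob_space_eqI_le:
  assumes M: "prob_space M" and N: "prob_space N" and sets: "sets M = sets N"
    and le: "\<And>A. A \<in> sets M \<Longrightarrow> measure M A \<le> measure N A"
  shows "M = N"
proof (rule measure_eqI)
  interpret M: prob_space M by fact
  interpret N: prob_space N by fact
  fix A assume A: "A \<in> sets M"
  have sp: "space M = space N" by (rule sets_eq_imp_space_eq[OF sets])
  have "measure M (space M - A) \<le> measure N (space N - A)"
    unfolding sp[symmetric] by (rule le) (use A in auto)
  then have "measure N A \<le> measure M A"
    using M.prob_compl[OF A] N.prob_compl[of A] A sets by simp
  then show "emeasure M A = emeasure N A"
    using le[OF A] by (simp add: M.emeasure_eq_measure N.emeasure_eq_measure)
qed (rule sets)

text \<open>Let \<open>Y\<close> be a Hahn set of the invariant signed measure \<open>M - N\<close>. Its preimages under the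
  iterates of \<open>T\<close> have the same maximal mass, hence so has their limes superior, which is strictly
  invariant and therefore carries either nothing or everything.\<close>

lemma invariant_prob_le:
  assumes M: "prob_space M" and N: "prob_space N" and sets: "sets M = sets N"
    and invM: "invariant_under M T" and invN: "invariant_under N T"
    and triv: "\<And>B. B \<in> sets M \<Longrightarrow> T -` B \<inter> space M = B \<Longrightarrow>
        (measure M B = 0 \<and> measure N B = 0) \<or> (measure M B = 1 \<and> measure N B = 1)"
    and A: "A \<in> sets M"
  shows "measure M A \<le> measure N A"
proof -
  interpret M: prob_space M by fact
  interpret N: prob_space N by fact
  have sp: "space M = space N" by (rule sets_eq_imp_space_eq[OF sets])
  have T: "T \<in> measurable M M" using invM by (simp add: invariant_under_def)
  define d where "d X = measure M X - measure N X" for X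
  obtain Y where Y: "Y \<in> sets M"
    and Ypos: "\<And>X. X \<in> sets M \<Longrightarrow> X \<subseteq> Y \<Longrightarrow> emeasure N X \<le> emeasure M X"
    and Yneg: "\<And>X. X \<in> sets M \<Longrightarrow> X \<inter> Y = {} \<Longrightarrow> emeasure M X \<le> emeasure N X"
    using finite_unsigned_Hahn_decomposition[OF M.finite_measure_axioms N.finite_measure_axioms sets[symmetric]]
    by auto
  have d_add: "d (X \<union> Z) = d X + d Z" if "X \<in> sets M" "Z \<in> sets M" "X \<inter> Z = {}" for X Z
    using that unfolding d_def
    by (simp add: M.finite_measure_Union N.finite_measure_Union sets[symmetric])
  have dmax: "d X \<le> d Y" if X: "X \<in> sets M" for X
  proof -
    have "d X = d (X \<inter> Y) + d (X - Y)"
      using d_add[of "X \<inter> Y" "X - Y"] X Y by (simp add: Int_Diff_Un Int_Diff_disjoint)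
    moreover have "d Y = d (X \<inter> Y) + d (Y - X)"
    proof -
      have "X \<inter> Y \<union> (Y - X) = Y" "X \<inter> Y \<inter> (Y - X) = {}" by auto
      then show ?thesis using d_add[of "X \<inter> Y" "Y - X"] X Y by simp
    qed
    moreover have "d (X - Y) \<le> 0"
      using Yneg[of "X - Y"] X Y by (auto simp: d_def M.emeasure_eq_measure N.emeasure_eq_measure)
    moreover have "0 \<le> d (Y - X)"
      using Ypos[of "Y - X"] X Y by (auto simp: d_def M.emeasure_eq_measure N.emeasure_eq_measure)
    ultimately show ?thesis by linarith
  qed
  have dT: "d (T -` X \<inter> space M) = d X" if "X \<in> sets M" for X
    using invM invN that unfolding d_def invariant_under_def sp sets by (simp add: measure_def)
  define F where "F n = (T ^^ n) -` Y \<inter> space M" for n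
  have Tsp: "T x \<in> space M" if "x \<in> space M" for x using measurable_space[OF T that] .
  have FSuc: "F (Suc n) = T -` F n \<inter> space M" for n
    using Tsp by (auto simp: F_def funpow_swap1)
  have F0: "F 0 = Y" using sets.sets_into_space[OF Y] by (auto simp: F_def)
  have FM: "F n \<in> sets M" for n
    by (induction n) (auto simp: F0 Y FSuc intro: measurable_sets[OF T])
  have dF: "d (F n) = d Y" for n
    by (induction n) (simp_all add: F0 FSuc dT FM)
  \<comment> \<open>Modularity: d of the union plus d of the intersection is \<open>2 * d Y\<close>,
    and neither of the two exceeds \<open>d Y\<close>.\<close>
  have dUn: "d (X \<union> Z) = d Y" if "X \<in> sets M" "Z \<in> sets M" "d X = d Y" "d Z = d Y" for X Z
  proof -
    have "X \<inter> (Z - X) = {}" "X \<union> (Z - X) = X \<union> Z" by auto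
    then have "d (X \<union> Z) = d X + d (Z - X)" using d_add[of X "Z - X"] that by simp
    moreover have "(X \<inter> Z) \<inter> (Z - X) = {}" "(X \<inter> Z) \<union> (Z - X) = Z" by auto
    then have "d Z = d (X \<inter> Z) + d (Z - X)" using d_add[of "X \<inter> Z" "Z - X"] that by simp
    ultimately show ?thesis
      using dmax[of "X \<union> Z"] dmax[of "X \<inter> Z"] that by simp
  qed
  \<comment> \<open>Finite unions \<open>G\<close>, countable unions \<open>U\<close> and the
    intersection \<open>Z\<close> all keep the maximal value, the last two by continuity of both
    measures along monotone sequences.\<close>
  define G where "G m k = (\<Union>j\<le>k. F (m + j))" for m k
  have GM: "G m k \<in> sets M" for m k unfolding G_def using FM by auto
  have dG: "d (G m k) = d Y" for m k
  proof (induction k)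
    case (Suc k)
    have "G m (Suc k) = G m k \<union> F (m + Suc k)" by (auto simp: G_def le_Suc_eq)
    then show ?case using dUn[OF GM FM Suc dF] by simp
  qed (simp add: G_def dF)
  define U where "U m = (\<Union>k. G m k)" for m
  have UM: "U m \<in> sets M" for m unfolding U_def using GM by auto
  have d_LIMSEQ_eq: "d Z = d Y"
    if "(\<lambda>n. measure M (E n)) \<longlonglongrightarrow> measure M Z" "(\<lambda>n. measure N (E n)) \<longlonglongrightarrow> measure N Z"
      "\<And>n. d (E n) = d Y" for E Z
  proof -
    have "(\<lambda>n. d (E n)) \<longlonglongrightarrow> d Z" unfolding d_def using that(1,2) by (rule tendsto_diff)
    then show ?thesis using that(3) by (simp add: LIMSEQ_const_iff)
  qed
  have incG: "incseq (G m)" for m by (rule incseq_SucI) (auto simp: G_def le_Suc_eq)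
  have dU: "d (U m) = d Y" for m
  proof (rule d_LIMSEQ_eq[of "G m"])
    have "range (G m) \<subseteq> sets M" using GM by blast
    then show "(\<lambda>k. measure M (G m k)) \<longlonglongrightarrow> measure M (U m)" "(\<lambda>k. measure N (G m k)) \<longlonglongrightarrow> measure N (U m)"
      unfolding U_def using M.finite_Lim_measure_incseq[OF _ incG] N.finite_Lim_measure_incseq[OF _ incG]
      by (simp_all add: sets)
  qed (rule dG)
  define Z where "Z = (\<Inter>m. U m)"
  have Ualt: "U m = (\<Union>j\<in>{m..}. F j)" for m
  proof -
    have "U m = (\<Union>j. F (m + j))" unfolding U_def G_def by auto
    also have "\<dots> = (\<Union>j\<in>range ((+) m). F j)" by simp
    also have "range ((+) m) = {m..}" by (auto simp: le_iff_add)
    finally show ?thesis .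
  qed
  have decU: "decseq U" unfolding Ualt by (rule decseq_SucI, rule UN_mono) auto
  have dZ: "d Z = d Y"
  proof (rule d_LIMSEQ_eq[of U])
    have "range U \<subseteq> sets M" using UM by blast
    then show "(\<lambda>k. measure M (U k)) \<longlonglongrightarrow> measure M Z" "(\<lambda>k. measure N (U k)) \<longlonglongrightarrow> measure N Z"
      unfolding Z_def using M.finite_Lim_measure_decseq[OF _ decU] N.finite_Lim_measure_decseq[OF _ decU]
      by (simp_all add: sets)
  qed (rule dU)
  have ZM: "Z \<in> sets M" unfolding Z_def using UM by auto
  \<comment> \<open>A preimage shifts the index by one, and a decreasing intersection does not
    depend on where it starts; this makes \<open>Z\<close> invariant in the strict sense.\<close>
  have TU: "T -` U m \<inter> space M = U (Suc m)" for m
  proof -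
    have "T -` U m \<inter> space M = (\<Union>j\<in>{m..}. F (Suc j))" unfolding Ualt FSuc by auto
    also have "\<dots> = (\<Union>j\<in>Suc ` {m..}. F j)" by simp
    also have "Suc ` {m..} = {Suc m..}"
    proof (intro equalityI subsetI)
      fix x assume "x \<in> {Suc m..}"
      then show "x \<in> Suc ` {m..}" by (cases x) auto
    qed auto
    finally show ?thesis unfolding Ualt .
  qed
  have "T -` Z \<inter> space M = (\<Inter>m. T -` U m \<inter> space M)" unfolding Z_def by auto
  also have "\<dots> = (\<Inter>m. U (Suc m))" unfolding TU ..
  also have "\<dots> = Z" unfolding Z_def using decU by (fastforce simp: decseq_Suc_iff)
  finally have "d Y = 0" using triv[OF ZM] dZ by (auto simp: d_def)
  then show ?thesis using dmax[OF A] by (simp add: d_def)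
qed

text \<open>\<open>R\<close> stands for Lebesgue measure: triviality of invariant sets is a
  statement about \<open>R\<close> alone, and absolute continuity carries it to both candidates.
  Applied to the return map of one fibre and to the lazy map on the whole space.\<close>

lemma trivial_invariant_sets_imp_unique:
  assumes M: "prob_space M" and N: "prob_space N" and sets: "sets M = sets N"
    and setsR: "sets R = sets M"
    and invM: "invariant_under M T" and invN: "invariant_under N T"
    and acM: "absolutely_continuous R M" and acN: "absolutely_continuous R N"
    and triv: "\<And>B. B \<in> sets R \<Longrightarrow> T -` B \<inter> space R = B \<Longrightarrow>
        emeasure R B = 0 \<or> emeasure R (space R - B) = 0"
  shows "M = N"
proof (rule prob_space_eqI_le[OF M N sets])
  interpret M: prob_space M by fact
  interpret N: prob_space N by fact
  have sp: "space R = space M" "space N = space M"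
    using sets_eq_imp_space_eq[OF setsR] sets_eq_imp_space_eq[OF sets] by auto
  have zero: "measure M B = 0 \<and> measure N B = 0" if "B \<in> sets M" "emeasure R B = 0" for B
  proof -
    have "B \<in> null_sets R" using that setsR by (intro null_setsI) simp_all
    then have "B \<in> null_sets M" "B \<in> null_sets N"
      using acM acN unfolding absolutely_continuous_def by blast+
    then show ?thesis by (simp add: measure_def null_setsD1)
  qed
  show "measure M A \<le> measure N A" if "A \<in> sets M" for A
  proof (rule invariant_prob_le[OF M N sets invM invN _ that])
    fix B assume B: "B \<in> sets M" "T -` B \<inter> space M = B"
    then consider "emeasure R B = 0" | "emeasure R (space M - B) = 0"
      using triv[of B] setsR sp by auto
    then show "(measure M B = 0 \<and> measure N B = 0) \<or> (measure M B = 1 \<and> measure N B = 1)"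
    proof cases
      case 1
      then show ?thesis using zero B by auto
    next
      case 2
      then have "measure M (space M - B) = 0 \<and> measure N (space M - B) = 0"
        using zero[of "space M - B"] B by auto
      then show ?thesis using M.prob_compl[OF B(1)] N.prob_compl[of B] B sets sp by auto
    qed
  qed
qed

section \<open>Greedy expansions with respect to a periodic base\<close>

lemma T_map_bounds: "0 \<le> T_map b x" "T_map b x < 1"
  unfolding T_map_def by linarith+

lemma measurable_T_map [measurable]: "T_map b \<in> borel_measurable borel"
  unfolding T_map_def[abs_def] by measurable

lemma emeasure_lborel_affine_vimage:
  fixes c t :: real
  assumes c: "c > 0" and A: "A \<in> sets borel"
  shows "emeasure lborel {z. c * z - t \<in> A} = ennreal (1 / c) * emeasure lborel A"
proof -
  have m: "{z. c * z - t \<in> A} \<in> sets borel"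
    using measurable_sets[of "\<lambda>z. c * z - t" borel borel A] A by (simp add: vimage_def)
  have "emeasure lborel A = ennreal \<bar>c\<bar> * (\<integral>\<^sup>+ x. indicator A (- t + c * x) \<partial>lborel)"
    using nn_integral_real_affine[of "indicator A" c "- t"] A c by simp
  also have "(\<lambda>x. indicator A (- t + c * x)) = (indicator {z. c * z - t \<in> A} :: real \<Rightarrow> ennreal)"
    by (auto simp: indicator_def fun_eq_iff)
  finally have "emeasure lborel A = ennreal c * emeasure lborel {z. c * z - t \<in> A}"
    using c m by simp
  then show ?thesis using c by (simp add: mult.assoc[symmetric] ennreal_mult[symmetric])
qed

text \<open>On the branch with digit d the map is affine, \<open>b * z - d\<close>, with image [0,
  1) cut at \<open>b * c - d\<close>. The minimum covers full, cut and empty branches alike.\<close>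

lemma emeasure_T_map_branch:
  assumes b: "b > 1" and A: "A \<in> sets borel" and d: "0 \<le> d"
  shows "emeasure lborel {z \<in> {0..<c}. \<lfloor>b * z\<rfloor> = d \<and> T_map b z \<in> A}
    = ennreal (1 / b) * emeasure lborel (A \<inter> {0..<min 1 (b * c - of_int d)})"
proof -
  have "{z \<in> {0..<c}. \<lfloor>b * z\<rfloor> = d \<and> T_map b z \<in> A}
      = {z. b * z - of_int d \<in> A \<inter> {0..<min 1 (b * c - of_int d)}}"
  proof (intro set_eqI iffI)
    fix z assume "z \<in> {z \<in> {0..<c}. \<lfloor>b * z\<rfloor> = d \<and> T_map b z \<in> A}"
    then show "z \<in> {z. b * z - of_int d \<in> A \<inter> {0..<min 1 (b * c - of_int d)}}"
      using b by (auto simp: T_map_def) linarith+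
  next
    fix z assume "z \<in> {z. b * z - of_int d \<in> A \<inter> {0..<min 1 (b * c - of_int d)}}"
    then have z: "b * z - of_int d \<in> A" "0 \<le> b * z - of_int d" "b * z - of_int d < 1" "b * z < b * c"
      by auto
    then have "\<lfloor>b * z\<rfloor> = d" by linarith
    moreover have "0 \<le> b * z" using z(2) d by (smt (verit) of_int_0_le_iff)
    then have "0 \<le> z" using b by (simp add: zero_le_mult_iff)
    moreover have "z < c" using z(4) b by simp
    ultimately show "z \<in> {z \<in> {0..<c}. \<lfloor>b * z\<rfloor> = d \<and> T_map b z \<in> A}"
      using z by (simp add: T_map_def)
  qed
  then show ?thesis using emeasure_lborel_affine_vimage[of b "A \<inter> {0..<min 1 (b * c - of_int d)}" "of_int d"] A b
    by simp
qed

text \<open>The transfer operator on the indicator of [0, c): each of the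
  \<open>\<lfloor>b * c\<rfloor>\<close> full branches covers [0, 1) once, and the last one stops at
  \<open>T_map b c\<close>. This formula underlies both the invariant densities and the ergodicity
  estimate.\<close>

lemma emeasure_T_map_vimage:
  assumes b: "b > 1" and A: "A \<in> sets borel" and c: "0 \<le> c"
  shows "emeasure lborel ({0..<c} \<inter> T_map b -` A) = ennreal (1 / b) *
    (of_nat (nat \<lfloor>b * c\<rfloor>) * emeasure lborel (A \<inter> {0..<1}) + emeasure lborel (A \<inter> {0..<T_map b c}))"
proof -
  define N where "N = nat \<lfloor>b * c\<rfloor>"
  have bc: "0 \<le> b * c" using b c by simp
  have N: "int N = \<lfloor>b * c\<rfloor>" using bc by (simp add: N_def)
  define E where "E d = {z \<in> {0..<c}. \<lfloor>b * z\<rfloor> = int d \<and> T_map b z \<in> A}" for d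
  have "{0..<c} \<inter> T_map b -` A = (\<Union>d\<le>N. E d)"
  proof (intro set_eqI iffI)
    fix z assume z: "z \<in> {0..<c} \<inter> T_map b -` A"
    then have "0 \<le> b * z" "b * z \<le> b * c" using b by auto
    then have "nat \<lfloor>b * z\<rfloor> \<le> N" unfolding N_def by (intro nat_mono floor_mono)
    then show "z \<in> (\<Union>d\<le>N. E d)" using z \<open>0 \<le> b * z\<close>
      by (auto simp: E_def intro!: bexI[of _ "nat \<lfloor>b * z\<rfloor>"])
  qed (auto simp: E_def)
  moreover have "emeasure lborel (\<Union>d\<le>N. E d) = (\<Sum>d\<le>N. emeasure lborel (E d))"
  proof (rule sum_emeasure[symmetric])
    have "E d \<in> sets borel" for d unfolding E_def using A by measurable
    then show "E ` {..N} \<subseteq> sets lborel" by auto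
    show "disjoint_family_on E {..N}" by (auto simp: disjoint_family_on_def E_def)
  qed simp
  moreover have "emeasure lborel (E d) = ennreal (1 / b) * emeasure lborel (A \<inter> {0..<1})" if "d < N" for d
  proof -
    have "int d + 1 \<le> \<lfloor>b * c\<rfloor>" using that N by simp
    then have "min 1 (b * c - of_int (int d)) = 1" by linarith
    then show ?thesis unfolding E_def by (subst emeasure_T_map_branch[OF b A]) simp_all
  qed
  moreover have "emeasure lborel (E N) = ennreal (1 / b) * emeasure lborel (A \<inter> {0..<T_map b c})"
  proof -
    have "min 1 (b * c - of_int (int N)) = T_map b c"
      unfolding N T_map_def by linarith
    then show ?thesis unfolding E_def by (subst emeasure_T_map_branch[OF b A]) simp_all
  qed
  ultimately show ?thesis
    unfolding N_def[symmetric] by (simp add: lessThan_Suc_atMost[symmetric] distrib_left mult_ac)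
qed

lemma measure_T_map_branch:
  assumes "b > 1" "A \<in> sets borel" "0 \<le> d"
  shows "measure lborel {z \<in> {0..<c}. \<lfloor>b * z\<rfloor> = d \<and> T_map b z \<in> A}
    = measure lborel (A \<inter> {0..<min 1 (b * c - of_int d)}) / b"
  unfolding measure_def emeasure_T_map_branch[OF assms] using assms by (simp add: enn2real_mult)

lemma fmeasurable_Int_Ico:
  fixes A :: "real set"
  shows "A \<in> sets borel \<Longrightarrow> A \<inter> {a..<b} \<in> fmeasurable lborel"
proof (rule fmeasurableI)
  show "emeasure lborel (A \<inter> {a..<b}) < \<infinity>"
    by (rule emeasure_bounded_finite) (simp add: bounded_Int)
qed simp

lemma emeasure_lborel_Int_Ico:
  fixes A :: "real set"
  assumes "A \<in> sets borel"
  shows "emeasure lborel (A \<inter> {a..<b}) = ennreal (measure lborel (A \<inter> {a..<b}))"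
  using fmeasurable_Int_Ico[OF assms, of a b] by (intro emeasure_eq_measure2) (auto simp: fmeasurable_def)

lemma measure_T_map_vimage:
  assumes b: "b > 1" and A: "A \<in> sets borel" and c: "0 \<le> c"
  shows "measure lborel ({0..<c} \<inter> T_map b -` A) =
    (of_int \<lfloor>b * c\<rfloor> * measure lborel (A \<inter> {0..<1}) + measure lborel (A \<inter> {0..<T_map b c})) / b"
proof -
  have "of_int \<lfloor>b * c\<rfloor> = real (nat \<lfloor>b * c\<rfloor>)" using b c by simp
  moreover have "emeasure lborel ({0..<c} \<inter> T_map b -` A)
    = ennreal (1 / b * (real (nat \<lfloor>b * c\<rfloor>) * measure lborel (A \<inter> {0..<1}) + measure lborel (A \<inter> {0..<T_map b c})))"
    (is "_ = ennreal (1 / b * ?r)")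
  proof -
    have eq: "of_nat (nat \<lfloor>b * c\<rfloor>) * emeasure lborel (A \<inter> {0..<1}) + emeasure lborel (A \<inter> {0..<T_map b c}) = ennreal ?r"
      unfolding emeasure_lborel_Int_Ico[OF A]
      by (simp add: ennreal_of_nat_eq_real_of_nat ennreal_mult)
    have "0 \<le> 1 / b" using b by simp
    from ennreal_mult'[OF this] show ?thesis unfolding emeasure_T_map_vimage[OF assms] eq by metis
  qed
  ultimately show ?thesis
    unfolding measure_def[of lborel "{0..<c} \<inter> T_map b -` A"] using b by simp
qed

section \<open>Orbits, digits and base products along the fibres\<close>

primrec beta_orbit :: "(nat \<Rightarrow> real) \<Rightarrow> nat \<Rightarrow> nat \<Rightarrow> real \<Rightarrow> real" where
  "beta_orbit b i 0 z = z"
| "beta_orbit b i (Suc n) z = T_map (b (i + n)) (beta_orbit b i n z)"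

primrec digits :: "(nat \<Rightarrow> real) \<Rightarrow> nat \<Rightarrow> nat \<Rightarrow> real \<Rightarrow> int list" where
  "digits b i 0 z = []"
| "digits b i (Suc n) z = \<lfloor>b i * z\<rfloor> # digits b (Suc i) n (T_map (b i) z)"

primrec base_prod :: "(nat \<Rightarrow> real) \<Rightarrow> nat \<Rightarrow> nat \<Rightarrow> real" where
  "base_prod b i 0 = 1"
| "base_prod b i (Suc n) = b i * base_prod b (Suc i) n"

text \<open>Orbits are defined by their last step, digits and base products by their first. This
  lemma and \<open>base_prod_Suc_right\<close> convert between the two directions.\<close>

lemma beta_orbit_Suc_shift:
  "beta_orbit b i (Suc n) z = beta_orbit b (Suc i) n (T_map (b i) z)"
  by (induction n) simp_all

lemma base_prod_Suc_right: "base_prod b i (Suc n) = base_prod b i n * b (i + n)"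
proof (induction n arbitrary: i)
  case (Suc n)
  then show ?case by (metis add_Suc_shift base_prod.simps(2) mult.assoc)
qed simp

lemma base_prod_add: "base_prod b i (m + n) = base_prod b i m * base_prod b (i + m) n"
  by (induction m arbitrary: i) simp_all

lemma beta_orbit_bounds:
  assumes "0 \<le> z" "z < 1"
  shows "0 \<le> beta_orbit b i n z" "beta_orbit b i n z < 1"
  using assms T_map_bounds by (cases n; simp)+

lemma digits_take: "m \<le> n \<Longrightarrow> digits b i m z = take m (digits b i n z)"
proof (induction m arbitrary: i n z)
  case (Suc m)
  then obtain k where "n = Suc k" by (metis Suc_le_D)
  then show ?case using Suc by simp
qed simp

lemma sets_digits_eq: "{z. digits b i n z = w} \<in> sets borel"
proof (induction n arbitrary: i w)
  case (Suc n)
  show ?case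
  proof (cases w)
    case (Cons d v)
    have "T_map (b i) -` {z. digits b (Suc i) n z = v} \<in> sets borel"
      using measurable_sets[OF measurable_T_map Suc] by simp
    moreover have "{z. \<lfloor>b i * z\<rfloor> = d} \<in> sets borel" by measurable
    moreover have "{z. digits b i (Suc n) z = w}
        = {z. \<lfloor>b i * z\<rfloor> = d} \<inter> T_map (b i) -` {z. digits b (Suc i) n z = v}"
      using Cons by auto
    ultimately show ?thesis by (metis sets.Int)
  qed simp
qed simp

lemma sets_digits: "{z. digits b i n z \<in> S} \<in> sets borel"
proof -
  have "{z. digits b i n z \<in> S} = (\<Union>w\<in>S. {z. digits b i n z = w})" by auto
  also have "\<dots> \<in> sets borel" by (rule sets.countable_UN') (auto intro: sets_digits_eq)
  finally show ?thesis .
qed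

text \<open>Fibres are indexed by all natural numbers with period p, so that a step always leads
  from i to \<open>Suc i\<close> without wrapping around.\<close>

locale beta_system =
  fixes b :: "nat \<Rightarrow> real" and p :: nat
  assumes p_pos: "p \<ge> 1" and period: "b (n + p) = b n" and gt1: "b n > 1"
begin

lemma gt0: "b n > 0"
  using gt1[of n] by simp

lemma b_mod: "b (n mod p) = b n"
proof -
  have "b (r + q * p) = b r" for r q
  proof (induction q)
    case (Suc q)
    have "r + Suc q * p = (r + q * p) + p" by simp
    then show ?case using Suc period by metis
  qed simp
  from this[of "n mod p" "n div p"] show ?thesis by (simp add: mult.commute)
qed

text \<open>One geometric rate for all fibres; it controls cylinder lengths, tails of series and the
  errors of iterated estimates.\<close>

definition ratio :: real where
  "ratio = Max ((\<lambda>i. 1 / b i) ` {..<p})"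

lemma ratio: "1 / b n \<le> ratio" "0 < ratio" "ratio < 1"
proof -
  have fin: "finite ((\<lambda>i. 1 / b i) ` {..<p})" and ne: "(\<lambda>i. 1 / b i) ` {..<p} \<noteq> {}"
    using p_pos by (auto simp: lessThan_empty_iff)
  have "1 / b (n mod p) \<le> ratio"
    unfolding ratio_def by (rule Max_ge[OF fin]) (use p_pos in auto)
  then show le: "1 / b n \<le> ratio" by (simp add: b_mod)
  then show "0 < ratio" using gt0[of n] by (meson divide_pos_pos less_le_trans zero_less_one)
  obtain i where "ratio = 1 / b i" using Max_in[OF fin ne] unfolding ratio_def[symmetric] by auto
  then show "ratio < 1" using gt1[of i] by simp
qed

lemma base_prod_pos: "base_prod b i n > 0"
  by (induction n arbitrary: i) (auto simp: gt0)

lemma base_prod_ge1: "base_prod b i n \<ge> 1"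
proof (induction n arbitrary: i)
  case (Suc n)
  have "1 * 1 \<le> b i * base_prod b (Suc i) n"
    by (rule mult_mono) (use Suc gt1[of i] in auto)
  then show ?case by simp
qed simp

lemma base_prod_inverse_le: "1 / base_prod b i n \<le> ratio ^ n"
proof (induction n arbitrary: i)
  case (Suc n)
  have "(1 / b i) * (1 / base_prod b (Suc i) n) \<le> ratio * ratio ^ n"
    by (rule mult_mono) (use Suc ratio(1) base_prod_pos[of "Suc i" n] less_imp_le[OF ratio(2)] in auto)
  then show ?case by simp
qed simp

text \<open>As long as the digits agree, each step stretches the distance exactly by
  \<open>b i\<close>, and after n steps the two points still lie in a unit interval.\<close>

lemma digits_eq_dist:
  assumes "digits b i n z = digits b i n y" "0 \<le> z" "z < 1" "0 \<le> y" "y < 1"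
  shows "\<bar>z - y\<bar> \<le> 1 / base_prod b i n"
  using assms
proof (induction n arbitrary: i z y)
  case (Suc n)
  have "\<bar>T_map (b i) z - T_map (b i) y\<bar> \<le> 1 / base_prod b (Suc i) n"
    using Suc.prems by (intro Suc.IH) (auto simp: T_map_bounds)
  moreover have "T_map (b i) z - T_map (b i) y = b i * (z - y)"
    using Suc.prems by (simp add: T_map_def algebra_simps)
  ultimately have "b i * \<bar>z - y\<bar> \<le> 1 / base_prod b (Suc i) n"
    using gt0[of i] by (simp add: abs_mult)
  then show ?case using gt0[of i] base_prod_pos[of "Suc i" n] by (simp add: field_simps)
qed simp

text \<open>The bound has to be proportional to c: N full branches and a last one over [0,
  \<open>T_map (b i) c\<close>) satisfy \<open>N + T_map (b i) c = b i * c\<close>, so the main term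
  reproduces itself. The N units added by the full branches are absorbed in raising the factor n by
  one.\<close>

lemma card_digits:
  assumes "0 \<le> c" "c \<le> 1"
  shows "finite (digits b i n ` {0..<c}) \<and>
    real (card (digits b i n ` {0..<c})) \<le> real n * c * base_prod b i n + 1"
  using assms
proof (induction n arbitrary: i c)
  case 0
  have "digits b i 0 ` {0..<c} \<subseteq> {[]}" by auto
  moreover from this have "card (digits b i 0 ` {0..<c}) \<le> card {[] :: int list}"
    by (intro card_mono) auto
  ultimately show ?case by (auto intro: finite_subset)
next
  case (Suc n)
  define N where "N = nat \<lfloor>b i * c\<rfloor>"
  have bc: "0 \<le> b i * c" using gt0[of i] Suc by simp
  have N: "int N = \<lfloor>b i * c\<rfloor>" using bc by (simp add: N_def)
  have N_le: "real N \<le> b i * c" using bc by (simp add: N_def)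
  have Tc: "0 \<le> T_map (b i) c" "T_map (b i) c \<le> 1" "T_map (b i) c = b i * c - real N"
    using T_map_bounds[of "b i" c] N[symmetric] by (auto simp: T_map_def)
  let ?P = "base_prod b (Suc i) n"
  let ?D1 = "digits b (Suc i) n ` {0..<1}" and ?D2 = "digits b (Suc i) n ` {0..<T_map (b i) c}"
  have D1: "finite ?D1" "real (card ?D1) \<le> real n * ?P + 1"
    using Suc.IH[of 1 "Suc i"] by auto
  have D2: "finite ?D2" "real (card ?D2) \<le> real n * T_map (b i) c * ?P + 1"
    using Suc.IH[OF Tc(1,2)] by auto
  let ?U = "(\<Union>d\<in>{..<N}. (#) (int d) ` ?D1) \<union> (#) (int N) ` ?D2"
  have sub: "digits b i (Suc n) ` {0..<c} \<subseteq> ?U"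
  proof
    fix w assume "w \<in> digits b i (Suc n) ` {0..<c}"
    then obtain z where z: "0 \<le> z" "z < c" and w: "w = digits b i (Suc n) z" by auto
    have bz: "0 \<le> b i * z" "b i * z < b i * c" using z gt0[of i] by auto
    define d where "d = nat \<lfloor>b i * z\<rfloor>"
    have d: "int d = \<lfloor>b i * z\<rfloor>" using bz by (simp add: d_def)
    have dN: "d \<le> N" unfolding d_def N_def using bz by (intro nat_mono floor_mono) simp
    have w': "w = int d # digits b (Suc i) n (T_map (b i) z)" using w d by simp
    show "w \<in> ?U"
    proof (cases "d = N")
      case True
      have "T_map (b i) z < T_map (b i) c"
        using bz d N True by (simp add: T_map_def)
      then show ?thesis using w' True T_map_bounds[of "b i" z] by auto
    next
      case False
      then have "d \<in> {..<N}" using dN by simp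
      moreover have "w \<in> (#) (int d) ` ?D1" using w' T_map_bounds[of "b i" z] by simp
      ultimately show ?thesis by blast
    qed
  qed
  have finU: "finite ?U" using D1 D2 by auto
  have "card (digits b i (Suc n) ` {0..<c}) \<le> card ?U" by (rule card_mono[OF finU sub])
  also have "\<dots> \<le> (\<Sum>d\<in>{..<N}. card ((#) (int d) ` ?D1)) + card ((#) (int N) ` ?D2)"
    by (rule order_trans[OF card_Un_le add_right_mono[OF card_UN_le]]) simp
  also have "\<dots> = N * card ?D1 + card ?D2" by (simp add: card_image)
  finally have "real (card (digits b i (Suc n) ` {0..<c})) \<le> real N * real (card ?D1) + real (card ?D2)"
    by (metis of_nat_le_iff of_nat_add of_nat_mult)
  also have "\<dots> \<le> real N * (real n * ?P + 1) + (real n * T_map (b i) c * ?P + 1)"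
    using D1 D2 by (intro add_mono mult_left_mono) auto
  also have "\<dots> = real n * c * (b i * ?P) + real N + 1" unfolding Tc(3) by (simp add: algebra_simps)
  also have "\<dots> \<le> real n * c * (b i * ?P) + c * (b i * ?P) + 1"
  proof -
    have "b i * c * 1 \<le> b i * c * ?P" using bc base_prod_ge1 by (intro mult_left_mono)
    then show ?thesis using N_le by (simp add: mult_ac)
  qed
  also have "\<dots> = real (Suc n) * c * base_prod b i (Suc n) + 1" by (simp add: algebra_simps)
  finally show ?case using finite_subset[OF sub finU] by blast
qed

definition cyl_approximable :: "nat \<Rightarrow> real set \<Rightarrow> bool" where
  "cyl_approximable i A \<longleftrightarrow>
    (\<forall>\<epsilon>>0. \<exists>m S. measure lborel {z \<in> {0..<1}. (z \<in> A) \<noteq> (digits b i m z \<in> S)} < \<epsilon>)"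

lemma mismatch_fmeasurable:
  assumes "A \<in> sets borel"
  shows "{z \<in> {0..<1}. (z \<in> A) \<noteq> (digits b i m z \<in> S)} \<in> fmeasurable lborel"
proof -
  have "{z \<in> {0..<1}. (z \<in> A) \<noteq> (digits b i m z \<in> S)}
    = ((A - {z. digits b i m z \<in> S}) \<union> ({z. digits b i m z \<in> S} - A)) \<inter> {0..<1}" by auto
  then show ?thesis using assms sets_digits[of b i m S] by (metis fmeasurable_Int_Ico sets.Diff sets.Un)
qed

text \<open>Take all cylinders that meet the half-line; the surplus lies to the right of a, within
  the length bound of one cylinder.\<close>

lemma cyl_approximable_lessThan: "cyl_approximable i {..<a}"
  unfolding cyl_approximable_def
proof (intro allI impI)
  fix \<epsilon> :: real assume "0 < \<epsilon>"
  obtain m where m: "ratio ^ m < \<epsilon>" using real_arch_pow_inv[OF \<open>0 < \<epsilon>\<close> ratio(3)] by auto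
  define S where "S = digits b i m ` ({0..<1} \<inter> {..<a})"
  let ?r = "1 / base_prod b i m"
  have r0: "?r \<ge> 0" using base_prod_pos[of i m] by simp
  have "{z \<in> {0..<1}. (z \<in> {..<a}) \<noteq> (digits b i m z \<in> S)} \<subseteq> {a..a + ?r}"
  proof
    fix z assume z: "z \<in> {z \<in> {0..<1}. (z \<in> {..<a}) \<noteq> (digits b i m z \<in> S)}"
    then have "a \<le> z" "digits b i m z \<in> S" by (auto simp: S_def)
    then obtain y where "digits b i m z = digits b i m y" "0 \<le> y" "y < 1" "y < a"
      by (auto simp: S_def)
    then show "z \<in> {a..a + ?r}" using digits_eq_dist[of i m z y] z \<open>a \<le> z\<close> by auto
  qed
  then have "measure lborel {z \<in> {0..<1}. (z \<in> {..<a}) \<noteq> (digits b i m z \<in> S)} \<le> measure lborel {a..a + ?r}"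
    by (intro measure_mono_fmeasurable fmeasurableD[OF mismatch_fmeasurable])
      (auto simp: fmeasurable_def emeasure_lborel_Icc_eq)
  also have "\<dots> = ?r" using r0 by simp
  also have "\<dots> < \<epsilon>" using base_prod_inverse_le[of i m] m by simp
  finally show "\<exists>m S. measure lborel {z \<in> {0..<1}. (z \<in> {..<a}) \<noteq> (digits b i m z \<in> S)} < \<epsilon>" by blast
qed

text \<open>What the first \<open>K\<close> sets leave of the union has measure below
  \<open>\<epsilon> / 2\<close>; those \<open>K\<close> sets are tested on prefixes of one common
  digit word, each with error below \<open>\<epsilon>'\<close>.\<close>

lemma cyl_approximable_UN:
  fixes A :: "nat \<Rightarrow> real set"
  assumes A: "\<And>k. A k \<in> sets borel" and appr: "\<And>k. cyl_approximable i (A k)"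
  shows "cyl_approximable i (\<Union>k. A k)"
  unfolding cyl_approximable_def
proof (intro allI impI)
  fix \<epsilon> :: real assume e: "0 < \<epsilon>"
  define R where "R K = {0..<1} \<inter> ((\<Union>k. A k) - (\<Union>k<K. A k))" for K
  have RM: "R K \<in> sets lborel" for K using A by (auto simp: R_def)
  have decR: "decseq R" by (rule decseq_SucI) (auto simp: R_def)
  have "(\<lambda>K. measure lborel (R K)) \<longlonglongrightarrow> measure lborel (\<Inter>K. R K)"
  proof (rule Lim_measure_decseq[OF _ decR])
    show "range R \<subseteq> sets lborel" using RM by auto
    fix K
    have "emeasure lborel (R K) \<le> emeasure lborel {0..<1::real}"
      by (rule emeasure_mono) (auto simp: R_def)
    then show "emeasure lborel (R K) \<noteq> \<infinity>" by (auto simp: top_unique)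
  qed
  moreover have "(\<Inter>K. R K) = {}" by (auto simp: R_def)
  ultimately have "(\<lambda>K. measure lborel (R K)) \<longlonglongrightarrow> 0" by simp
  then have "\<forall>\<^sub>F K in sequentially. measure lborel (R K) < \<epsilon> / 2"
    by (rule order_tendstoD) (use e in simp)
  then obtain K where K: "measure lborel (R K) < \<epsilon> / 2" by (auto simp: eventually_sequentially)
  define \<epsilon>' where "\<epsilon>' = \<epsilon> / (2 * (real K + 1))"
  have e': "\<epsilon>' > 0" using e by (simp add: \<epsilon>'_def)
  have "\<forall>k. \<exists>m S. measure lborel {z \<in> {0..<1}. (z \<in> A k) \<noteq> (digits b i m z \<in> S)} < \<epsilon>'"
    using appr e' unfolding cyl_approximable_def by blast
  then obtain mm SS where mS: "\<And>k. measure lborel {z \<in> {0..<1}. (z \<in> A k) \<noteq> (digits b i (mm k) z \<in> SS k)} < \<epsilon>'"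
    unfolding choice_iff by blast
  define m where "m = (\<Sum>k<K. mm k)"
  have mle: "mm k \<le> m" if "k < K" for k unfolding m_def using that by (simp add: member_le_sum)
  define S where "S = {w. \<exists>k<K. take (mm k) w \<in> SS k}"
  let ?E = "\<lambda>k. {z \<in> {0..<1}. (z \<in> A k) \<noteq> (digits b i (mm k) z \<in> SS k)}"
  have EM: "?E k \<in> fmeasurable lborel" for k using mismatch_fmeasurable[OF A] by blast
  have RF: "R K \<in> fmeasurable lborel"
    using fmeasurable_Int_Ico[of "(\<Union>k. A k) - (\<Union>k<K. A k)" 0 1] A by (simp add: R_def Int_commute)
  have "{z \<in> {0..<1}. (z \<in> (\<Union>k. A k)) \<noteq> (digits b i m z \<in> S)} \<subseteq> R K \<union> (\<Union>k<K. ?E k)"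
  proof
    fix z assume z: "z \<in> {z \<in> {0..<1}. (z \<in> (\<Union>k. A k)) \<noteq> (digits b i m z \<in> S)}"
    show "z \<in> R K \<union> (\<Union>k<K. ?E k)"
    proof (rule ccontr)
      assume n: "z \<notin> R K \<union> (\<Union>k<K. ?E k)"
      then have *: "z \<in> A k \<longleftrightarrow> take (mm k) (digits b i m z) \<in> SS k" if "k < K" for k
        using z that digits_take[OF mle[OF that], of b i z] by auto
      have "z \<in> (\<Union>k. A k) \<longleftrightarrow> z \<in> (\<Union>k<K. A k)" using n z by (auto simp: R_def)
      then show False using * z by (auto simp: S_def)
    qed
  qed
  moreover have UF: "(\<Union>k<K. ?E k) \<in> fmeasurable lborel" by (rule fmeasurable.finite_UN) (use EM in auto)
  ultimately have "measure lborel {z \<in> {0..<1}. (z \<in> (\<Union>k. A k)) \<noteq> (digits b i m z \<in> S)}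
      \<le> measure lborel (R K \<union> (\<Union>k<K. ?E k))"
    using RF A by (intro measure_mono_fmeasurable fmeasurableD[OF mismatch_fmeasurable]) auto
  also have "\<dots> \<le> measure lborel (R K) + measure lborel (\<Union>k<K. ?E k)"
    by (rule measure_Un_le[OF fmeasurableD[OF RF] fmeasurableD[OF UF]])
  also have "measure lborel (\<Union>k<K. ?E k) \<le> (\<Sum>k<K. measure lborel (?E k))"
    by (rule measure_UNION_le, simp, rule fmeasurableD[OF EM])
  also have "\<dots> \<le> (\<Sum>k<K. \<epsilon>')" using mS by (intro sum_mono less_imp_le)
  also have "\<dots> = real K * \<epsilon>'" by simp
  also have "\<dots> \<le> (real K + 1) * \<epsilon>'" using e' by simp
  also have "\<dots> = \<epsilon> / 2" unfolding \<epsilon>'_def by (simp add: field_simps)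
  finally have "measure lborel {z \<in> {0..<1}. (z \<in> (\<Union>k. A k)) \<noteq> (digits b i m z \<in> S)} < \<epsilon>"
    using K by simp
  then show "\<exists>m S. measure lborel {z \<in> {0..<1}. (z \<in> (\<Union>k. A k)) \<noteq> (digits b i m z \<in> S)} < \<epsilon>" by blast
qed

text \<open>Half-lines are approximable, and complements and countable unions preserve the
  property.\<close>

lemma cyl_approximable_borel:
  assumes "A \<in> sets borel"
  shows "cyl_approximable i A"
proof -
  have bs: "sets (borel :: real measure) = sigma_sets UNIV (range lessThan)"
    by (subst borel_Iio) simp
  from assms have "A \<in> sigma_sets UNIV (range lessThan)" unfolding bs .
  then show ?thesis
  proof (induction rule: sigma_sets.induct)
    case Empty
    have "{z \<in> {0..<1}. (z \<in> {}) \<noteq> (digits b i 0 z \<in> {})} = {}" by auto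
    then show ?case unfolding cyl_approximable_def by (metis measure_empty)
  next
    case (Basic a)
    then show ?case by (auto intro: cyl_approximable_lessThan)
  next
    case (Compl a)
    show ?case unfolding cyl_approximable_def
    proof (intro allI impI)
      fix \<epsilon> :: real assume "0 < \<epsilon>"
      then obtain m S where "measure lborel {z \<in> {0..<1}. (z \<in> a) \<noteq> (digits b i m z \<in> S)} < \<epsilon>"
        using Compl.IH unfolding cyl_approximable_def by blast
      moreover have "{z \<in> {0..<1}. (z \<in> UNIV - a) \<noteq> (digits b i m z \<in> - S)}
        = {z \<in> {0..<1}. (z \<in> a) \<noteq> (digits b i m z \<in> S)}" by auto
      ultimately show "\<exists>m S. measure lborel {z \<in> {0..<1}. (z \<in> UNIV - a) \<noteq> (digits b i m z \<in> S)} < \<epsilon>"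
        by (intro exI[of _ m] exI[of _ "- S"]) (simp only:)
    qed
  next
    case (Union A)
    then show ?case by (intro cyl_approximable_UN) (simp_all add: bs)
  qed
qed

end

section \<open>Ergodicity with respect to Lebesgue measure\<close>

context beta_system
begin

text \<open>The fibres of a strictly invariant set of the fibred map, unrolled over all natural
  indices; periodicity in i is a separate hypothesis where it is used.\<close>

definition fibre_invariant :: "(nat \<Rightarrow> real set) \<Rightarrow> bool" where
  "fibre_invariant E \<longleftrightarrow>
    (\<forall>i. E i \<in> sets borel \<and> E i = {z \<in> {0..<1}. T_map (b i) z \<in> E (Suc i)})"

lemma fibre_invariantD:
  assumes "fibre_invariant E"
  shows "E i \<in> sets borel" "E i = {z \<in> {0..<1}. T_map (b i) z \<in> E (Suc i)}" "E i \<inter> {0..<1} = E i"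
  using assms unfolding fibre_invariant_def by blast+

lemma fibre_invariant_Ico:
  assumes E: "fibre_invariant E" and c: "0 \<le> c" "c \<le> 1"
  shows "measure lborel (E i \<inter> {0..<c}) =
    (of_int \<lfloor>b i * c\<rfloor> * measure lborel (E (Suc i)) + measure lborel (E (Suc i) \<inter> {0..<T_map (b i) c})) / b i"
proof -
  have "E i \<inter> {0..<c} = {0..<c} \<inter> T_map (b i) -` E (Suc i)"
    using c by (subst fibre_invariantD(2)[OF E, of i]) auto
  then show ?thesis
    using measure_T_map_vimage[OF gt1 fibre_invariantD(1)[OF E] c(1), of i "Suc i"]
    by (simp add: fibre_invariantD(3)[OF E])
qed

text \<open>Full branches respect the bound m, so an excess can come only from the cut branch, where
  it gets divided by \<open>b i\<close>. Iteration shrinks the initial error 1 to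
  \<open>ratio ^ n\<close>.\<close>

lemma fibre_invariant_Ico_le:
  assumes E: "fibre_invariant E" and m: "\<And>i. measure lborel (E i) \<le> m" "0 \<le> m"
    and c: "0 \<le> c" "c \<le> 1"
  shows "measure lborel (E i \<inter> {0..<c}) \<le> m * c"
proof -
  have step: "measure lborel (E i \<inter> {0..<c}) \<le> m * c + ratio ^ n" if "0 \<le> c" "c \<le> 1" for n i c
    using that
  proof (induction n arbitrary: i c)
    case 0
    have "measure lborel (E i \<inter> {0..<c}) \<le> measure lborel {0..<c}"
      by (rule measure_mono_fmeasurable)
        (use fibre_invariantD(1)[OF E] fmeasurable_Int_Ico[of UNIV 0 c] in auto)
    then show ?case using 0 m(2) by (simp add: add_increasing)
  next
    case (Suc n)
    let ?T = "T_map (b i) c"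
    have fl: "0 \<le> real_of_int \<lfloor>b i * c\<rfloor>" using gt0[of i] Suc.prems by simp
    have "measure lborel (E i \<inter> {0..<c}) = (of_int \<lfloor>b i * c\<rfloor> * measure lborel (E (Suc i))
        + measure lborel (E (Suc i) \<inter> {0..<?T})) / b i"
      by (rule fibre_invariant_Ico[OF E Suc.prems])
    also have "\<dots> \<le> (of_int \<lfloor>b i * c\<rfloor> * m + (m * ?T + ratio ^ n)) / b i"
      using Suc.IH[of ?T "Suc i"] T_map_bounds[of "b i" c] gt0[of i] fl m(1)
      by (intro divide_right_mono add_mono mult_left_mono) auto
    also have "\<dots> = m * c + 1 / b i * ratio ^ n"
      using gt0[of i] by (simp add: T_map_def field_simps)
    also have "\<dots> \<le> m * c + ratio ^ Suc n"
      using mult_right_mono[OF ratio(1), of "ratio ^ n" i] less_imp_le[OF ratio(2)] by simp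
    finally show ?case .
  qed
  show ?thesis
  proof (rule field_le_epsilon)
    fix e :: real assume "0 < e"
    then obtain n where "ratio ^ n < e" using real_arch_pow_inv[OF _ ratio(3)] by blast
    then show "measure lborel (E i \<inter> {0..<c}) \<le> m * c + e" using step[OF c, of i n] by simp
  qed
qed

text \<open>A branch carries the cylinder and its part in the invariant set affinely to the next
  fibre, so the ratio of their measures is preserved. The cut c varies in the induction because the
  image of a branch of [0, c) is again an initial interval.\<close>

lemma fibre_invariant_cylinder_le:
  assumes E: "fibre_invariant E" and m: "\<And>i. measure lborel (E i) \<le> m" "0 \<le> m"
    and c: "0 \<le> c" "c \<le> 1"
  shows "measure lborel (E i \<inter> {z \<in> {0..<c}. digits b i n z = w})
    \<le> m * measure lborel {z \<in> {0..<c}. digits b i n z = w}"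
  using c
proof (induction n arbitrary: i c w)
  case 0
  show ?case
  proof (cases "w = []")
    case True
    then have "{z \<in> {0..<c}. digits b i 0 z = w} = {0..<c}" by auto
    then show ?thesis using fibre_invariant_Ico_le[OF E m 0, of i] 0 by simp
  qed simp
next
  case (Suc n)
  show ?case
  \<comment> \<open>In the negative case the word is empty or starts with a negative digit, and its
    cylinder is empty.\<close>
  proof (cases "\<exists>d v. w = d # v \<and> 0 \<le> d")
    case False
    have "{z \<in> {0..<c}. digits b i (Suc n) z = w} = {}"
    proof -
      have "0 \<le> \<lfloor>b i * z\<rfloor>" if "0 \<le> z" for z using that gt0[of i] by simp
      then show ?thesis using False by auto
    qed
    then show ?thesis by (simp only: Int_empty_right) simp
  next
    case True
    then obtain d v where w: "w = d # v" and d: "0 \<le> d" by blast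
    define C where "C = {z. digits b (Suc i) n z = v}"
    define c' where "c' = min 1 (b i * c - of_int d)"
    have CM: "C \<in> sets borel" unfolding C_def by (rule sets_digits_eq)
    note EM = fibre_invariantD(1)[OF E, of "Suc i"]
    have "{z \<in> {0..<c}. digits b i (Suc n) z = w} = {z \<in> {0..<c}. \<lfloor>b i * z\<rfloor> = d \<and> T_map (b i) z \<in> C}"
      by (auto simp: w C_def)
    then have 1: "measure lborel {z \<in> {0..<c}. digits b i (Suc n) z = w} = measure lborel (C \<inter> {0..<c'}) / b i"
      using measure_T_map_branch[OF gt1[of i] CM d, of c] by (simp add: c'_def)
    have "E i \<inter> {z \<in> {0..<c}. digits b i (Suc n) z = w}
        = {z \<in> {0..<c}. \<lfloor>b i * z\<rfloor> = d \<and> T_map (b i) z \<in> E (Suc i) \<inter> C}"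
      using Suc.prems by (subst fibre_invariantD(2)[OF E, of i]) (auto simp: w C_def)
    then have 2: "measure lborel (E i \<inter> {z \<in> {0..<c}. digits b i (Suc n) z = w})
        = measure lborel (E (Suc i) \<inter> C \<inter> {0..<c'}) / b i"
      using measure_T_map_branch[OF gt1[of i] sets.Int[OF EM CM] d, of c] by (simp add: c'_def)
    have eq: "C \<inter> {0..<c'} = {z \<in> {0..<c'}. digits b (Suc i) n z = v}" by (auto simp: C_def)
    have "measure lborel (E (Suc i) \<inter> (C \<inter> {0..<c'})) \<le> m * measure lborel (C \<inter> {0..<c'})"
    proof (cases "0 \<le> c'")
      case True
      show ?thesis unfolding eq by (rule Suc.IH) (use True in \<open>auto simp: c'_def\<close>)
    qed simp
    then show ?thesis unfolding 1 2 using gt0[of i] by (simp add: Int_assoc divide_right_mono)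
  qed
qed

lemma fibre_invariant_cylinders_le:
  assumes E: "fibre_invariant E" and m: "\<And>i. measure lborel (E i) \<le> m" "0 \<le> m"
  shows "measure lborel (E i \<inter> {z \<in> {0..<1}. digits b i n z \<in> S})
    \<le> m * measure lborel {z \<in> {0..<1}. digits b i n z \<in> S}"
proof -
  define W where "W = S \<inter> digits b i n ` {0..<1}"
  define C where "C w = {z \<in> {0..<1}. digits b i n z = w}" for w
  have finW: "finite W" unfolding W_def using card_digits[of 1 i n] by simp
  have Ceq: "C w = {z. digits b i n z = w} \<inter> {0..<1}" for w by (auto simp: C_def)
  have CF: "C w \<in> fmeasurable lborel" for w
    unfolding Ceq by (rule fmeasurable_Int_Ico[OF sets_digits_eq])
  have ECF: "E i \<inter> C w \<in> fmeasurable lborel" for w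
    using fmeasurable_Int_fmeasurable[OF CF, of "E i"] fibre_invariantD(1)[OF E] by (simp add: Int_commute)
  have un: "{z \<in> {0..<1}. digits b i n z \<in> S} = (\<Union>w\<in>W. C w)" by (auto simp: C_def W_def)
  have D: "measure lborel (\<Union>w\<in>W. C w) = (\<Sum>w\<in>W. measure lborel (C w))"
    by (rule measure_finite_Union[OF finW])
      (use CF in \<open>auto simp: disjoint_family_on_def C_def fmeasurable_def less_top\<close>)
  have ED: "measure lborel (\<Union>w\<in>W. E i \<inter> C w) = (\<Sum>w\<in>W. measure lborel (E i \<inter> C w))"
    by (rule measure_finite_Union[OF finW])
      (use ECF in \<open>auto simp: disjoint_family_on_def C_def fmeasurable_def less_top\<close>)
  have "measure lborel (E i \<inter> (\<Union>w\<in>W. C w)) = measure lborel (\<Union>w\<in>W. E i \<inter> C w)"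
    by (rule arg_cong[where f = "measure lborel"]) auto
  also have "\<dots> \<le> (\<Sum>w\<in>W. m * measure lborel (C w))"
    unfolding ED
  proof (rule sum_mono)
    fix w
    show "measure lborel (E i \<inter> C w) \<le> m * measure lborel (C w)"
      unfolding C_def by (rule fibre_invariant_cylinder_le[OF E m]) simp_all
  qed
  also have "\<dots> = m * measure lborel (\<Union>w\<in>W. C w)" unfolding D by (simp add: sum_distrib_left)
  finally show ?thesis unfolding un .
qed

lemma fibre_invariant_measure_idem:
  assumes E: "fibre_invariant E" and m: "\<And>i. measure lborel (E i) \<le> m" "m \<le> 1"
    and i: "measure lborel (E i) = m"
  shows "m = 0 \<or> m = 1"
proof -
  have m0: "0 \<le> m" using i measure_nonneg[of lborel "E i"] by simp
  have EF: "E i \<in> fmeasurable lborel"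
    using fmeasurable_Int_Ico[OF fibre_invariantD(1)[OF E], of i 0 1] by (simp add: fibre_invariantD(3)[OF E])
  have "m \<le> m * m"
  proof (rule field_le_epsilon)
    fix e :: real assume e: "0 < e"
    have "cyl_approximable i (E i)" by (rule cyl_approximable_borel[OF fibre_invariantD(1)[OF E]])
    then obtain n S where nS: "measure lborel {z \<in> {0..<1}. (z \<in> E i) \<noteq> (digits b i n z \<in> S)} < e / 2"
      unfolding cyl_approximable_def using half_gt_zero[OF e] by blast
    \<comment> \<open>The mismatch \<open>R\<close> is paid for twice, in passing from
      \<open>E i\<close> to \<open>D\<close> and from the measure of \<open>D\<close> back to m;
      hence \<open>e / 2\<close>.\<close>
    define R where "R = {z \<in> {0..<1}. (z \<in> E i) \<noteq> (digits b i n z \<in> S)}"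
    define D where "D = {z \<in> {0..<1}. digits b i n z \<in> S}"
    have RF: "R \<in> fmeasurable lborel"
      unfolding R_def by (rule mismatch_fmeasurable[OF fibre_invariantD(1)[OF E]])
    have "D = {z. digits b i n z \<in> S} \<inter> {0..<1}" by (auto simp: D_def)
    then have DF: "D \<in> fmeasurable lborel" using fmeasurable_Int_Ico[OF sets_digits, of b i n S 0 1] by simp
    have EDF: "E i \<inter> D \<in> fmeasurable lborel" using EF DF by (rule fmeasurable.Int)
    have "m \<le> measure lborel (E i \<inter> D \<union> R)"
      unfolding i[symmetric]
    proof (rule measure_mono_fmeasurable)
      show "E i \<subseteq> E i \<inter> D \<union> R"
        using fibre_invariantD(3)[OF E, of i] by (auto simp: D_def R_def)
    qed (use EF EDF RF in auto)
    also have "\<dots> \<le> measure lborel (E i \<inter> D) + measure lborel R"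
      by (rule measure_Un_le[OF fmeasurableD[OF EDF] fmeasurableD[OF RF]])
    also have "measure lborel (E i \<inter> D) \<le> m * measure lborel D"
      unfolding D_def by (rule fibre_invariant_cylinders_le[OF E m(1) m0])
    also have "measure lborel D \<le> measure lborel (E i \<union> R)"
      by (rule measure_mono_fmeasurable) (use DF EF RF in \<open>auto simp: D_def R_def\<close>)
    also have "\<dots> \<le> m + measure lborel R"
      using measure_Un_le[OF fmeasurableD[OF EF] fmeasurableD[OF RF]] i by simp
    finally have "m \<le> m * (m + measure lborel R) + measure lborel R"
      using m0 by (simp add: mult_left_mono)
    also have "\<dots> \<le> m * m + 1 * measure lborel R + measure lborel R"
      using mult_right_mono[OF m(2), of "measure lborel R"] by (simp add: algebra_simps)
    also have "\<dots> \<le> m * m + e" using nS by (simp add: R_def)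
    finally show "m \<le> m * m + e" .
  qed
  then have "m * (1 - m) \<le> 0" by (simp add: algebra_simps)
  then show ?thesis using m0 m(2) by (auto simp: mult_le_0_iff)
qed

text \<open>The fibre of largest measure \<open>m\<close> has density at most \<open>m\<close> in every cylinder, hence at most
  \<open>m\<close> in itself; so \<open>m\<close> is \<open>0\<close> or \<open>1\<close>, and full measure is passed on from a fibre to the next.\<close>

theorem fibre_invariant_trivial:
  assumes E: "fibre_invariant E" and per: "\<And>i. E (i + p) = E i"
  shows "(\<forall>i. measure lborel (E i) = 0) \<or> (\<forall>i. measure lborel (E i) = 1)"
proof -
  have perq: "E (i + q * p) = E i" for i q
  proof (induction q)
    case (Suc q)
    have "i + Suc q * p = (i + q * p) + p" by simp
    then show ?case using Suc per by metis
  qed simp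
  have Emod: "E (i mod p) = E i" for i using perq[of "i mod p" "i div p"] by (simp add: mult.commute)
  have le1: "measure lborel (E i) \<le> 1" for i
  proof -
    have "E i \<subseteq> {0..<1}" using fibre_invariantD(3)[OF E, of i] by blast
    then have "measure lborel (E i) \<le> measure lborel {0..<1::real}"
      by (rule measure_mono_fmeasurable)
        (use fibre_invariantD(1)[OF E] fmeasurable_Int_Ico[of UNIV 0 1] in auto)
    then show ?thesis by simp
  qed
  define m where "m = Max ((\<lambda>i. measure lborel (E i)) ` {..<p})"
  have fin: "finite ((\<lambda>i. measure lborel (E i)) ` {..<p})" and ne: "(\<lambda>i. measure lborel (E i)) ` {..<p} \<noteq> {}"
    using p_pos by (auto simp: lessThan_empty_iff)
  have m: "measure lborel (E i) \<le> m" for i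
  proof -
    have "measure lborel (E (i mod p)) \<le> m"
      unfolding m_def by (rule Max_ge[OF fin]) (use p_pos in auto)
    then show ?thesis by (simp add: Emod)
  qed
  obtain i0 where i0: "measure lborel (E i0) = m"
    using Max_in[OF fin ne] unfolding m_def[symmetric] by auto
  have "m = 0 \<or> m = 1"
    using fibre_invariant_measure_idem[OF E m _ i0] le1[of i0] i0 by simp
  then show ?thesis
  proof
    assume "m = 0"
    then have "measure lborel (E i) = 0" for i using m[of i] by (simp add: order_antisym)
    then show ?thesis by blast
  next
    assume m1: "m = 1"
    have up: "measure lborel (E (i0 + k)) = 1" for k
    proof (induction k)
      case 0
      then show ?case using i0 m1 by simp
    next
      case (Suc k)
      let ?i = "i0 + k"
      let ?T = "T_map (b ?i) 1"
      have "measure lborel (E ?i) = (of_int \<lfloor>b ?i\<rfloor> * measure lborel (E (Suc ?i))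
          + measure lborel (E (Suc ?i) \<inter> {0..<?T})) / b ?i"
        using fibre_invariant_Ico[OF E, of 1 ?i] fibre_invariantD(3)[OF E, of ?i] by simp
      \<comment> \<open>Since \<open>b ?i = \<lfloor>b ?i\<rfloor> + ?T\<close> and the cut branch
        contributes at most \<open>?T\<close>, the full branches must be filled completely; there is
        at least one because \<open>b ?i > 1\<close>.\<close>
      then have eq: "b ?i = of_int \<lfloor>b ?i\<rfloor> * measure lborel (E (Suc ?i))
          + measure lborel (E (Suc ?i) \<inter> {0..<?T})"
        using Suc gt0[of ?i] by (simp add: field_simps)
      have "measure lborel (E (Suc ?i) \<inter> {0..<?T}) \<le> measure lborel {0..<?T}"
        by (rule measure_mono_fmeasurable)
          (use fibre_invariantD(1)[OF E] fmeasurable_Int_Ico[of UNIV 0 ?T] in auto)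
      also have "\<dots> = ?T" using T_map_bounds by simp
      also have "?T = b ?i - of_int \<lfloor>b ?i\<rfloor>" by (simp add: T_map_def)
      finally have "of_int \<lfloor>b ?i\<rfloor> * 1 \<le> of_int \<lfloor>b ?i\<rfloor> * measure lborel (E (Suc ?i))"
        using eq by simp
      moreover have "0 < real_of_int \<lfloor>b ?i\<rfloor>" using gt1[of ?i] by simp
      ultimately have "1 \<le> measure lborel (E (Suc ?i))" by (simp only: mult_le_cancel_left_pos)
      then show ?case using le1[of "Suc ?i"] by simp
    qed
    have "measure lborel (E i) = 1" for i
    proof -
      \<comment> \<open>Adding \<open>i0\<close> periods moves any index i past \<open>i0\<close>
        without changing its fibre.\<close>
      have "i0 \<le> i + i0 * p" using p_pos by (simp add: trans_le_add2)
      then obtain k where "i + i0 * p = i0 + k" using le_Suc_ex by blast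
      then show ?thesis using up[of k] perq[of i i0] by simp
    qed
    then show ?thesis by blast
  qed
qed

end

section \<open>Existence of the invariant densities\<close>

text \<open>Induction on the number of states: the last state \<open>p\<close> is eliminated by passing to the chain
  observed only when it is outside of \<open>p\<close>.\<close>

lemma stochastic_matrix_stationary:
  fixes Q :: "nat \<Rightarrow> nat \<Rightarrow> real"
  assumes "p \<ge> 1" "\<And>j k. j < p \<Longrightarrow> k < p \<Longrightarrow> 0 \<le> Q j k" "\<And>j. j < p \<Longrightarrow> (\<Sum>k<p. Q j k) = 1"
  shows "\<exists>w. (\<forall>k<p. 0 \<le> w k) \<and> (\<Sum>k<p. w k) > 0 \<and> (\<forall>k<p. (\<Sum>j<p. w j * Q j k) = w k)"
  using assms
proof (induction p arbitrary: Q rule: nat_induct_at_least)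
  case base
  then show ?case by (intro exI[of _ "\<lambda>_. 1"]) auto
next
  case (Suc p)
  have nn: "0 \<le> Q j k" if "j \<le> p" "k \<le> p" for j k using Suc.prems(1) that by simp
  have row: "(\<Sum>k<p. Q j k) + Q j p = 1" if "j \<le> p" for j using Suc.prems(2)[of j] that by simp
  show ?case
  proof (cases "Q p p = 1")
    \<comment> \<open>The last state is absorbing and can carry all the mass.\<close>
    case True
    then have "(\<Sum>k<p. Q p k) = 0" using row[of p] by simp
    then have "Q p k = 0" if "k < p" for k
      using that nn[of p] by (subst (asm) sum_nonneg_eq_0_iff) auto
    then have "(\<Sum>j<Suc p. (if j = p then 1 else 0) * Q j k) = (if k = p then 1 else 0)" if "k < Suc p" for k
      using that True by (auto simp: less_Suc_eq)
    then show ?thesis by (intro exI[of _ "\<lambda>k. if k = p then 1 else 0"]) auto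
  next
    case False
    define q where "q = 1 - Q p p"
    have q: "q > 0" using row[of p] sum_nonneg[of "{..<p}" "Q p"] nn[of p] False
      unfolding q_def by (smt (verit) lessThan_iff order_le_less)
    \<comment> \<open>A jump from j to k is either direct or passes through p; \<open>1 / q\<close>
      is the geometric series over the time spent in p.\<close>
    define Q' where "Q' j k = Q j k + Q j p * Q p k / q" for j k
    have row': "(\<Sum>k<p. Q' j k) = 1" if "j < p" for j
    proof -
      have "(\<Sum>k<p. Q' j k) = (\<Sum>k<p. Q j k) + Q j p * (\<Sum>k<p. Q p k) / q"
        unfolding Q'_def by (simp add: sum.distrib sum_distrib_left sum_divide_distrib)
      also have "(\<Sum>k<p. Q p k) = q" using row[of p] by (simp add: q_def)
      finally show ?thesis using row[of j] that q by simp
    qed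
    have "\<exists>w. (\<forall>k<p. 0 \<le> w k) \<and> (\<Sum>k<p. w k) > 0 \<and> (\<forall>k<p. (\<Sum>j<p. w j * Q' j k) = w k)"
      by (rule Suc.IH) (use nn q row' in \<open>auto simp: Q'_def intro!: add_nonneg_nonneg divide_nonneg_pos mult_nonneg_nonneg\<close>)
    then obtain w where w: "\<And>k. k < p \<Longrightarrow> 0 \<le> w k" "(\<Sum>k<p. w k) > 0"
      "\<And>k. k < p \<Longrightarrow> (\<Sum>j<p. w j * Q' j k) = w k" by blast
    \<comment> \<open>The mass of p is dictated by stationarity there: outflow \<open>s * q\<close>
      equals inflow.\<close>
    define s where "s = (\<Sum>j<p. w j * Q j p) / q"
    have s: "s \<ge> 0" unfolding s_def using w(1) nn q by (intro divide_nonneg_pos sum_nonneg mult_nonneg_nonneg) auto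
    define v where "v k = (if k = p then s else w k)" for k
    have sum: "(\<Sum>j<Suc p. v j * Q j k) = (\<Sum>j<p. w j * Q j k) + s * Q p k" for k
      by (simp add: v_def)
    have "(\<Sum>j<Suc p. v j * Q j k) = v k" if "k < Suc p" for k
    proof (cases "k = p")
      case True
      have "(\<Sum>j<p. w j * Q j p) = s * q" using q by (simp add: s_def)
      then show ?thesis unfolding sum True by (simp add: v_def q_def algebra_simps)
    next
      case False
      then have k: "k < p" using that by simp
      have "(\<Sum>j<p. w j * Q' j k) = (\<Sum>j<p. w j * Q j k) + s * Q p k"
        unfolding s_def sum_divide_distrib sum_distrib_right sum.distrib[symmetric]
        by (intro sum.cong refl) (simp add: Q'_def field_simps)
      then show ?thesis unfolding sum using w(3)[OF k] k by (simp add: v_def)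
    qed
    moreover have "(\<Sum>k<Suc p. v k) > 0" using w(2) s by (simp add: v_def)
    moreover have "\<forall>k<Suc p. 0 \<le> v k" using w(1) s by (simp add: v_def less_Suc_eq)
    ultimately show ?thesis by blast
  qed
qed

lemma mod_Suc_cancel: "(Suc a mod p = Suc b mod p) = (a mod p = b mod p)" if "p \<ge> 1" for p :: nat
proof -
  have "a mod p < p" "b mod p < p" using that by simp_all
  then show ?thesis by (auto simp: mod_Suc)
qed

context beta_system
begin

section \<open>The expansion of 1 and the jump chain on the fibres\<close>

definition orbit1 :: "nat \<Rightarrow> nat \<Rightarrow> real" where
  "orbit1 j n = beta_orbit b j n 1"

definition digit1 :: "nat \<Rightarrow> nat \<Rightarrow> nat" where
  "digit1 j n = nat \<lfloor>b (j + n) * orbit1 j n\<rfloor>"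

lemma orbit1_bounds: "0 \<le> orbit1 j n" "orbit1 j n \<le> 1"
  unfolding orbit1_def using T_map_bounds by (cases n; simp add: less_imp_le)+

lemma orbit1_0 [simp]: "orbit1 j 0 = 1"
  by (simp add: orbit1_def)

lemma orbit1_Suc: "orbit1 j (Suc n) = T_map (b (j + n)) (orbit1 j n)"
  by (simp add: orbit1_def)

lemma orbit1_step: "b (j + n) * orbit1 j n = real (digit1 j n) + orbit1 j (Suc n)"
proof -
  have "0 \<le> b (j + n) * orbit1 j n" using gt0[of "j + n"] orbit1_bounds[of j n] by simp
  then show ?thesis by (simp add: orbit1_Suc digit1_def T_map_def)
qed

lemma digit1_0: "digit1 j 0 \<ge> 1"
  using gt1[of j] by (simp add: digit1_def le_nat_iff le_floor_iff)

text \<open>The remainder after N digits is \<open>orbit1 j N / base_prod b j N\<close>, which tends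
  to 0. For the chain this says that the jump probabilities from j add up to 1.\<close>

lemma expansion_of_1: "(\<lambda>n. real (digit1 j n) / base_prod b j (Suc n)) sums 1"
proof -
  have part: "(\<Sum>n<N. real (digit1 j n) / base_prod b j (Suc n)) = 1 - orbit1 j N / base_prod b j N" for N
  proof (induction N)
    case (Suc N)
    have P: "base_prod b j (Suc N) = base_prod b j N * b (j + N)" by (rule base_prod_Suc_right)
    have "real (digit1 j N) = b (j + N) * orbit1 j N - orbit1 j (Suc N)" using orbit1_step[of j N] by simp
    then have "real (digit1 j N) / base_prod b j (Suc N)
        = orbit1 j N / base_prod b j N - orbit1 j (Suc N) / base_prod b j (Suc N)"
      unfolding P using gt0[of "j + N"] base_prod_pos[of j N] by (simp add: field_simps)
    then show ?case using Suc by (simp del: base_prod.simps)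
  qed simp
  have "(\<lambda>N. orbit1 j N / base_prod b j N) \<longlonglongrightarrow> 0"
  proof (rule tendsto_sandwich[of "\<lambda>_. 0" _ _ "\<lambda>N. ratio ^ N"])
    show "(\<lambda>N. ratio ^ N) \<longlonglongrightarrow> 0" using ratio(2,3) by (intro LIMSEQ_power_zero) simp
    show "\<forall>\<^sub>F N in sequentially. orbit1 j N / base_prod b j N \<le> ratio ^ N"
    proof (intro always_eventually allI)
      fix N
      have "orbit1 j N / base_prod b j N \<le> 1 / base_prod b j N"
        using orbit1_bounds[of j N] base_prod_pos[of j N] by (intro divide_right_mono) auto
      then show "orbit1 j N / base_prod b j N \<le> ratio ^ N" using base_prod_inverse_le[of j N] by simp
    qed
    show "\<forall>\<^sub>F N in sequentially. 0 \<le> orbit1 j N / base_prod b j N"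
      using orbit1_bounds base_prod_pos by (intro always_eventually allI divide_nonneg_pos)
  qed simp
  then have "(\<lambda>N. 1 - orbit1 j N / base_prod b j N) \<longlonglongrightarrow> 1 - 0" by (intro tendsto_intros)
  then show ?thesis unfolding sums_def part by simp
qed

text \<open>The contribution of jumps of length n + 1 only; the transition probability from j to k
  is the sum over n.\<close>

definition trans_prob :: "nat \<Rightarrow> nat \<Rightarrow> nat \<Rightarrow> real" where
  "trans_prob j k n = (if Suc (j + n) mod p = k then real (digit1 j n) / base_prod b j (Suc n) else 0)"

lemma trans_prob_nonneg: "0 \<le> trans_prob j k n"
  unfolding trans_prob_def using base_prod_pos[of j "Suc n"] by (simp del: base_prod.simps)

lemma summable_trans_prob: "summable (trans_prob j k)"
proof (rule summable_comparison_test'[OF sums_summable[OF expansion_of_1[of j]], of 0])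
  show "norm (trans_prob j k n) \<le> real (digit1 j n) / base_prod b j (Suc n)" for n
    unfolding trans_prob_def using base_prod_pos[of j "Suc n"] by (simp del: base_prod.simps)
qed

lemma sum_trans_prob: "(\<Sum>k<p. \<Sum>n. trans_prob j k n) = 1"
proof -
  have "(\<Sum>k<p. \<Sum>n. trans_prob j k n) = (\<Sum>n. \<Sum>k<p. trans_prob j k n)"
    by (rule suminf_sum[symmetric]) (rule summable_trans_prob)
  also have "(\<lambda>n. \<Sum>k<p. trans_prob j k n) = (\<lambda>n. real (digit1 j n) / base_prod b j (Suc n))"
    unfolding trans_prob_def using p_pos by (simp add: sum.delta del: base_prod.simps)
  finally show ?thesis using expansion_of_1[of j] by (simp only: sums_iff)
qed

definition stationary :: "(nat \<Rightarrow> real) \<Rightarrow> bool" where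
  "stationary w \<longleftrightarrow> (\<forall>k<p. 0 < w k) \<and> (\<forall>k<p. (\<Sum>j<p. w j * (\<Sum>n. trans_prob j k n)) = w k)"

text \<open>Because the first digit of 1 is positive, the chain moves from each fibre to the next
  with positive probability, and positivity of one weight spreads around the cycle.\<close>

lemma ex_stationary: "\<exists>w. stationary w"
proof -
  have "\<exists>w. (\<forall>k<p. 0 \<le> w k) \<and> (\<Sum>k<p. w k) > 0 \<and> (\<forall>k<p. (\<Sum>j<p. w j * (\<Sum>n. trans_prob j k n)) = w k)"
    using p_pos suminf_nonneg[OF summable_trans_prob trans_prob_nonneg] sum_trans_prob
    by (intro stochastic_matrix_stationary) auto
  then obtain w where w: "\<And>k. k < p \<Longrightarrow> 0 \<le> w k" "(\<Sum>k<p. w k) > 0"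
    "\<And>k. k < p \<Longrightarrow> (\<Sum>j<p. w j * (\<Sum>n. trans_prob j k n)) = w k" by blast
  have "\<exists>k<p. 0 < w k"
  proof (rule ccontr)
    assume "\<not> ?thesis"
    then have "(\<Sum>k<p. w k) \<le> 0" by (intro sum_nonpos) (meson lessThan_iff not_less)
    then show False using w(2) by simp
  qed
  then obtain k0 where k0: "k0 < p" "0 < w k0" by blast
  have up: "0 < w ((k0 + m) mod p)" for m
  proof (induction m)
    case (Suc m)
    let ?k = "(k0 + m) mod p" and ?l = "(k0 + Suc m) mod p"
    have lt: "?k < p" "?l < p" using p_pos by simp_all
    have "Suc (?k + 0) mod p = ?l" by (simp add: mod_Suc_eq)
    then have "0 < trans_prob ?k ?l 0" using digit1_0[of ?k] gt0[of ?k] by (simp add: trans_prob_def)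
    also have "\<dots> \<le> (\<Sum>n. trans_prob ?k ?l n)"
      using sum_le_suminf[OF summable_trans_prob, of "{0}" ?k ?l] trans_prob_nonneg by simp
    finally have "0 < w ?k * (\<Sum>n. trans_prob ?k ?l n)" using Suc by simp
    also have "\<dots> \<le> (\<Sum>j<p. w j * (\<Sum>n. trans_prob j ?l n))"
      using w(1) suminf_nonneg[OF summable_trans_prob trans_prob_nonneg] lt
      by (intro member_le_sum[of _ _ "\<lambda>j. w j * (\<Sum>n. trans_prob j ?l n)"]) auto
    finally show ?case using w(3)[OF lt(2)] by simp
  qed (use k0 in simp)
  have "0 < w k" if "k < p" for k
  proof -
    \<comment> \<open>One period is added because \<open>k0\<close> may exceed k.\<close>
    have "(k0 + (k + p - k0)) mod p = k" using that k0 by simp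
    then show ?thesis using up[of "k + p - k0"] by simp
  qed
  then show ?thesis using w(3) unfolding stationary_def by blast
qed

section \<open>The densities and their transport from fibre to fibre\<close>

definition weight :: "(nat \<Rightarrow> real) \<Rightarrow> nat \<Rightarrow> nat \<Rightarrow> nat \<Rightarrow> real" where
  "weight w i j n = (if (j + n) mod p = i mod p then w j / base_prod b j n else 0)"

text \<open>For p = 1 this is, up to a constant factor, the Parry density of a beta-transformation.
  Values in \<open>ennreal\<close> postpone convergence to the upper bound
  \<open>inv_measure_le\<close>.\<close>

definition inv_density :: "(nat \<Rightarrow> real) \<Rightarrow> nat \<Rightarrow> real \<Rightarrow> ennreal" where
  "inv_density w i x = (\<Sum>j<p. \<Sum>n. ennreal (weight w i j n) * indicator {0..<orbit1 j n} x)"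

lemma measurable_inv_density [measurable]: "inv_density w i \<in> borel_measurable borel"
  unfolding inv_density_def[abs_def] by measurable

definition inv_measure :: "(nat \<Rightarrow> real) \<Rightarrow> nat \<Rightarrow> real measure" where
  "inv_measure w i = density lborel (inv_density w i)"

lemma sets_inv_measure [simp]: "sets (inv_measure w i) = sets borel"
  by (simp add: inv_measure_def)

lemma emeasure_inv_measure:
  assumes A: "A \<in> sets borel"
  shows "emeasure (inv_measure w i) A
    = (\<Sum>j<p. \<Sum>n. ennreal (weight w i j n) * emeasure lborel (A \<inter> {0..<orbit1 j n}))"
proof -
  have "emeasure (inv_measure w i) A = (\<integral>\<^sup>+x. inv_density w i x * indicator A x \<partial>lborel)"
    unfolding inv_measure_def by (rule emeasure_density) (use A in auto)
  also have "\<dots> = (\<integral>\<^sup>+x. (\<Sum>j<p. \<Sum>n. ennreal (weight w i j n) * indicator (A \<inter> {0..<orbit1 j n}) x) \<partial>lborel)"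
    unfolding inv_density_def
  proof (intro nn_integral_cong)
    fix x
    show "(\<Sum>j<p. \<Sum>n. ennreal (weight w i j n) * indicator {0..<orbit1 j n} x) * indicator A x
        = (\<Sum>j<p. \<Sum>n. ennreal (weight w i j n) * indicator (A \<inter> {0..<orbit1 j n}) x)"
      unfolding sum_distrib_right ennreal_suminf_multc[symmetric]
      by (intro sum.cong suminf_cong refl) (auto simp: indicator_def)
  qed
  also have "\<dots> = (\<Sum>j<p. \<integral>\<^sup>+x. (\<Sum>n. ennreal (weight w i j n) * indicator (A \<inter> {0..<orbit1 j n}) x) \<partial>lborel)"
    by (rule nn_integral_sum) (use A in measurable)
  also have "\<dots> = (\<Sum>j<p. \<Sum>n. \<integral>\<^sup>+x. ennreal (weight w i j n) * indicator (A \<inter> {0..<orbit1 j n}) x \<partial>lborel)"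
    by (intro sum.cong refl nn_integral_suminf) (use A in measurable)
  also have "\<dots> = (\<Sum>j<p. \<Sum>n. ennreal (weight w i j n) * emeasure lborel (A \<inter> {0..<orbit1 j n}))"
    using A by (intro sum.cong refl suminf_cong nn_integral_cmult_indicator) auto
  finally show ?thesis .
qed

lemma inv_measure_mod: "inv_measure w (i mod p) = inv_measure w i"
  by (simp add: inv_measure_def inv_density_def[abs_def] weight_def)

text \<open>Term n on fibre i becomes term n + 1 on the next fibre plus copies of [0, 1), one for
  each full branch. By stationarity these copies have total weight \<open>w ?k\<close>, and this is
  precisely the missing term n = 0 on the next fibre.\<close>

lemma inv_measure_invariant:
  assumes w: "stationary w" and A: "A \<in> sets borel"
  shows "emeasure (inv_measure w i) (T_map (b i) -` A) = emeasure (inv_measure w (Suc i)) A"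
proof -
  let ?k = "Suc i mod p"
  let ?l1 = "emeasure lborel (A \<inter> {0..<1})"
  have k: "?k < p" using p_pos by simp
  have w0: "0 < w j" if "j < p" for j using w that by (simp add: stationary_def)
  have TA: "T_map (b i) -` A \<in> sets borel"
    using measurable_sets[OF measurable_T_map A] by simp
  have summand: "ennreal (weight w i j n) * emeasure lborel (T_map (b i) -` A \<inter> {0..<orbit1 j n})
    = ennreal (w j * trans_prob j ?k n) * ?l1
      + ennreal (weight w (Suc i) j (Suc n)) * emeasure lborel (A \<inter> {0..<orbit1 j (Suc n)})"
    if j: "j < p" for j n
  proof (cases "(j + n) mod p = i mod p")
    case False
    then show ?thesis using mod_Suc_cancel[OF p_pos, of "j + n" i]
      by (simp add: weight_def trans_prob_def)
  next
    case True
    have bi: "b i = b (j + n)" using True b_mod by metis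
    have eq: "Suc (j + n) mod p = ?k" using mod_Suc_cancel[OF p_pos, of "j + n" i] True by simp
    have P: "base_prod b j (Suc n) = base_prod b j n * b (j + n)" by (rule base_prod_Suc_right)
    have pos: "0 < base_prod b j n" "0 < b (j + n)" "0 < w j"
      using base_prod_pos gt0 w0[OF j] by auto
    have "emeasure lborel (T_map (b i) -` A \<inter> {0..<orbit1 j n}) = ennreal (1 / b (j + n)) *
      (ennreal (real (digit1 j n)) * ?l1 + emeasure lborel (A \<inter> {0..<orbit1 j (Suc n)}))"
      using emeasure_T_map_vimage[OF gt1[of "j + n"] A orbit1_bounds(1)[of j n]]
      by (simp add: bi Int_commute digit1_def orbit1_Suc ennreal_of_nat_eq_real_of_nat)
    then have "ennreal (weight w i j n) * emeasure lborel (T_map (b i) -` A \<inter> {0..<orbit1 j n})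
      = ennreal (w j / base_prod b j n) * ennreal (1 / b (j + n)) * ennreal (real (digit1 j n)) * ?l1
        + ennreal (w j / base_prod b j n) * ennreal (1 / b (j + n)) * emeasure lborel (A \<inter> {0..<orbit1 j (Suc n)})"
      using True by (simp add: weight_def distrib_left mult.assoc)
    also have "ennreal (w j / base_prod b j n) * ennreal (1 / b (j + n)) = ennreal (w j / base_prod b j (Suc n))"
      unfolding P using pos by (simp add: ennreal_mult[symmetric])
    also have "\<dots> * ennreal (real (digit1 j n)) = ennreal (w j * trans_prob j ?k n)"
      unfolding trans_prob_def using pos base_prod_pos[of j "Suc n"] eq
      by (simp add: ennreal_mult[symmetric] del: base_prod.simps)
    finally show ?thesis using eq by (simp add: weight_def)
  qed
  have sumtrans: "(\<Sum>j<p. \<Sum>n. ennreal (w j * trans_prob j ?k n)) = ennreal (w ?k)"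
  proof -
    have "(\<Sum>n. ennreal (w j * trans_prob j ?k n)) = ennreal (w j * (\<Sum>n. trans_prob j ?k n))" if "j < p" for j
      using w0[OF that] trans_prob_nonneg summable_trans_prob[of j ?k]
      by (subst suminf_ennreal2) (auto intro!: mult_nonneg_nonneg summable_mult simp: suminf_mult)
    then have "(\<Sum>j<p. \<Sum>n. ennreal (w j * trans_prob j ?k n)) = (\<Sum>j<p. ennreal (w j * (\<Sum>n. trans_prob j ?k n)))"
      by (intro sum.cong) auto
    also have "\<dots> = ennreal (\<Sum>j<p. w j * (\<Sum>n. trans_prob j ?k n))"
      using w0 suminf_nonneg[OF summable_trans_prob trans_prob_nonneg]
      by (intro sum_ennreal mult_nonneg_nonneg) (auto intro: less_imp_le)
    also have "\<dots> = ennreal (w ?k)" using w k unfolding stationary_def by simp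
    finally show ?thesis .
  qed
  have head: "(\<Sum>j<p. ennreal (weight w (Suc i) j 0) * emeasure lborel (A \<inter> {0..<orbit1 j 0})) = ennreal (w ?k) * ?l1"
  proof -
    have "(\<Sum>j<p. ennreal (weight w (Suc i) j 0) * emeasure lborel (A \<inter> {0..<orbit1 j 0}))
        = (\<Sum>j<p. if j = ?k then ennreal (w j) * ?l1 else 0)"
      by (intro sum.cong) (auto simp: weight_def)
    then show ?thesis using k by (simp add: sum.delta)
  qed
  have "emeasure (inv_measure w i) (T_map (b i) -` A)
    = (\<Sum>j<p. \<Sum>n. ennreal (w j * trans_prob j ?k n) * ?l1
      + ennreal (weight w (Suc i) j (Suc n)) * emeasure lborel (A \<inter> {0..<orbit1 j (Suc n)}))"
    unfolding emeasure_inv_measure[OF TA] by (intro sum.cong refl suminf_cong summand) auto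
  also have "\<dots> = (\<Sum>j<p. (\<Sum>n. ennreal (w j * trans_prob j ?k n)) * ?l1
      + (\<Sum>n. ennreal (weight w (Suc i) j (Suc n)) * emeasure lborel (A \<inter> {0..<orbit1 j (Suc n)})))"
    by (intro sum.cong refl) (simp add: suminf_add[symmetric])
  also have "\<dots> = ennreal (w ?k) * ?l1
      + (\<Sum>j<p. \<Sum>n. ennreal (weight w (Suc i) j (Suc n)) * emeasure lborel (A \<inter> {0..<orbit1 j (Suc n)}))"
    by (simp add: sum.distrib sum_distrib_right[symmetric] sumtrans)
  also have "\<dots> = (\<Sum>j<p. ennreal (weight w (Suc i) j 0) * emeasure lborel (A \<inter> {0..<orbit1 j 0})
      + (\<Sum>n. ennreal (weight w (Suc i) j (Suc n)) * emeasure lborel (A \<inter> {0..<orbit1 j (Suc n)})))"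
    unfolding head[symmetric] by (rule sum.distrib[symmetric])
  also have "\<dots> = emeasure (inv_measure w (Suc i)) A"
    unfolding emeasure_inv_measure[OF A]
    by (intro sum.cong refl) (subst suminf_offset[OF summableI, of _ 1], simp add: add.commute)
  finally show ?thesis .
qed

text \<open>The term n = 0 that starts on the fibre itself is already \<open>w\<close> times the
  indicator of [0, 1).\<close>

lemma inv_measure_ge:
  assumes A: "A \<in> sets borel" and a: "\<And>j. j < p \<Longrightarrow> a \<le> w j"
  shows "ennreal a * emeasure lborel (A \<inter> {0..<1}) \<le> emeasure (inv_measure w i) A"
proof -
  let ?k = "i mod p"
  have k: "?k < p" using p_pos by simp
  let ?t = "\<lambda>j n. ennreal (weight w i j n) * emeasure lborel (A \<inter> {0..<orbit1 j n})"
  have "ennreal a * emeasure lborel (A \<inter> {0..<1}) \<le> ?t ?k 0"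
    using a[OF k] by (simp add: weight_def mult_right_mono ennreal_leI)
  also have "\<dots> \<le> (\<Sum>n. ?t ?k n)"
    using sum_le_suminf[OF summableI, of "{0}" "?t ?k"] by simp
  also have "\<dots> \<le> (\<Sum>j<p. \<Sum>n. ?t j n)"
    by (rule member_le_sum[of ?k "{..<p}" "\<lambda>j. \<Sum>n. ?t j n"]) (use k in auto)
  finally show ?thesis unfolding emeasure_inv_measure[OF A] .
qed

lemma inv_measure_le:
  assumes w: "stationary w"
  shows "\<exists>C\<ge>0. \<forall>i. \<forall>A\<in>sets borel. emeasure (inv_measure w i) A \<le> ennreal C * emeasure lborel (A \<inter> {0..<1})"
proof -
  \<comment> \<open>\<open>1 / (1 - ratio)\<close> sums the geometric bound on the inverse base
    products.\<close>
  define C where "C = (\<Sum>j<p. w j * (1 / (1 - ratio)))"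
  have w0: "0 < w j" if "j < p" for j using w that by (simp add: stationary_def)
  have r: "0 < 1 - ratio" using ratio by simp
  have C0: "C \<ge> 0" unfolding C_def using w0 r by (intro sum_nonneg mult_nonneg_nonneg) (auto intro: less_imp_le)
  have "emeasure (inv_measure w i) A \<le> ennreal C * emeasure lborel (A \<inter> {0..<1})"
    if A: "A \<in> sets borel" for i A
  proof -
    let ?l1 = "emeasure lborel (A \<inter> {0..<1})"
    have "emeasure (inv_measure w i) A \<le> (\<Sum>j<p. \<Sum>n. ennreal (w j * ratio ^ n) * ?l1)"
      unfolding emeasure_inv_measure[OF A]
    proof (intro sum_mono suminf_le summableI mult_mono ennreal_leI)
      fix j n assume "j \<in> {..<p}"
      then have "w j * (1 / base_prod b j n) \<le> w j * ratio ^ n"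
        using w0[of j] base_prod_inverse_le[of j n] by (intro mult_left_mono) auto
      then show "weight w i j n \<le> w j * ratio ^ n"
        using w0[of j] \<open>j \<in> {..<p}\<close> ratio(2) by (auto simp: weight_def)
      show "emeasure lborel (A \<inter> {0..<orbit1 j n}) \<le> ?l1"
        using A orbit1_bounds[of j n] by (intro emeasure_mono) auto
    qed auto
    also have "\<dots> = (\<Sum>j<p. ennreal (w j * (1 / (1 - ratio)))) * ?l1"
    proof -
      have "(\<Sum>n. ennreal (w j * ratio ^ n)) = ennreal (w j * (1 / (1 - ratio)))" if "j < p" for j
      proof (rule suminf_ennreal_eq)
        show "0 \<le> w j * ratio ^ n" for n using w0[OF that] ratio(2) by simp
        show "(\<lambda>n. w j * ratio ^ n) sums (w j * (1 / (1 - ratio)))"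
          using ratio by (intro sums_mult geometric_sums) simp
      qed
      then show ?thesis unfolding sum_distrib_right by (intro sum.cong) auto
    qed
    also have "(\<Sum>j<p. ennreal (w j * (1 / (1 - ratio)))) = ennreal C"
      unfolding C_def using w0 r by (intro sum_ennreal) (auto intro!: mult_nonneg_nonneg less_imp_le)
    finally show ?thesis .
  qed
  then show ?thesis using C0 by blast
qed

text \<open>Everything that is used of the densities from here on. The measures live on all of
  \<open>real\<close>; that they charge only [0, 1) is contained in the upper bound.\<close>

definition invariant_fibre_family :: "(nat \<Rightarrow> real measure) \<Rightarrow> real \<Rightarrow> real \<Rightarrow> bool" where
  "invariant_fibre_family \<nu> a C \<longleftrightarrow> 0 < a \<and> 0 \<le> C \<and>
    (\<forall>i. sets (\<nu> i) = sets borel \<and> emeasure (\<nu> i) UNIV = 1 \<and> \<nu> (i mod p) = \<nu> i \<and>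
      (\<forall>A\<in>sets borel.
        ennreal a * emeasure lborel (A \<inter> {0..<1}) \<le> emeasure (\<nu> i) A \<and>
        emeasure (\<nu> i) A \<le> ennreal C * emeasure lborel (A \<inter> {0..<1}) \<and>
        emeasure (\<nu> i) (T_map (b i) -` A) = emeasure (\<nu> (Suc i)) A))"

theorem ex_invariant_fibre_family: "\<exists>\<nu> a C. invariant_fibre_family \<nu> a C"
proof -
  obtain w where w: "stationary w" using ex_stationary by blast
  obtain C where C: "C \<ge> 0" "\<And>i A. A \<in> sets borel \<Longrightarrow>
      emeasure (inv_measure w i) A \<le> ennreal C * emeasure lborel (A \<inter> {0..<1})"
    using inv_measure_le[OF w] by blast
  define a where "a = Min (w ` {..<p})"
  have ne: "w ` {..<p} \<noteq> {}" using p_pos by (auto simp: lessThan_empty_iff)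
  have a: "a \<le> w j" if "j < p" for j unfolding a_def by (rule Min_le) (use that in auto)
  have "a \<in> w ` {..<p}" unfolding a_def by (rule Min_in[OF _ ne]) simp
  then have a0: "a > 0" using w by (auto simp: stationary_def)
  define t where "t = emeasure (inv_measure w 0) UNIV"
  \<comment> \<open>All fibres have the same total mass, so a single factor normalises them without
    disturbing the transport between them.\<close>
  have tot: "emeasure (inv_measure w i) UNIV = t" for i
  proof (induction i)
    case (Suc i)
    then show ?case using inv_measure_invariant[OF w, of UNIV i] by simp
  qed (simp add: t_def)
  have t_le: "t \<le> ennreal C" using C(2)[of UNIV 0] by (simp add: t_def)
  have t_ge: "ennreal a \<le> t" using inv_measure_ge[OF _ a, where A = UNIV and i = 0] by (simp add: t_def)
  have "t \<noteq> \<top>" using t_le by (metis ennreal_neq_top top.extremum_unique)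
  then obtain r where r: "t = ennreal r" "0 \<le> r" by (cases t) auto
  have r0: "0 < r" using t_ge a0 r by (simp add: ennreal_le_iff)
  define \<nu> where "\<nu> i = scale_measure (ennreal (1 / r)) (inv_measure w i)" for i
  have em: "emeasure (\<nu> i) A = ennreal (1 / r) * emeasure (inv_measure w i) A" for i A
    by (simp add: \<nu>_def)
  have "invariant_fibre_family \<nu> (a / r) (C / r)"
    unfolding invariant_fibre_family_def
  proof (intro conjI allI ballI)
    show "0 < a / r" "0 \<le> C / r" using a0 r0 C by auto
    fix i
    show "sets (\<nu> i) = sets borel" by (simp add: \<nu>_def)
    show "emeasure (\<nu> i) UNIV = 1" unfolding em tot r(1) using r0 by (simp add: ennreal_mult[symmetric])
    show "\<nu> (i mod p) = \<nu> i" by (simp add: \<nu>_def inv_measure_mod)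
    fix A :: "real set" assume A: "A \<in> sets borel"
    have "ennreal (1 / r) * (ennreal a * emeasure lborel (A \<inter> {0..<1})) \<le> emeasure (\<nu> i) A"
      unfolding em by (intro mult_left_mono inv_measure_ge[OF A a]) auto
    moreover have "ennreal (1 / r) * (ennreal a * emeasure lborel (A \<inter> {0..<1})) = ennreal (a / r) * emeasure lborel (A \<inter> {0..<1})"
      using r0 a0 by (simp add: mult.assoc[symmetric] ennreal_mult[symmetric])
    ultimately show "ennreal (a / r) * emeasure lborel (A \<inter> {0..<1}) \<le> emeasure (\<nu> i) A" by metis
    have "emeasure (\<nu> i) A \<le> ennreal (1 / r) * (ennreal C * emeasure lborel (A \<inter> {0..<1}))"
      unfolding em by (intro mult_left_mono C(2)[OF A]) auto
    moreover have "ennreal (1 / r) * (ennreal C * emeasure lborel (A \<inter> {0..<1})) = ennreal (C / r) * emeasure lborel (A \<inter> {0..<1})"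
      using r0 C by (simp add: mult.assoc[symmetric] ennreal_mult[symmetric])
    ultimately show "emeasure (\<nu> i) A \<le> ennreal (C / r) * emeasure lborel (A \<inter> {0..<1})" by metis
    show "emeasure (\<nu> i) (T_map (b i) -` A) = emeasure (\<nu> (Suc i)) A"
      unfolding em by (simp add: inv_measure_invariant[OF w A])
  qed
  then show ?thesis by blast
qed

end

section \<open>Return maps, growth of products and the numbers \<open>x\<^sub>i\<close>\<close>

context beta_system
begin

lemma b_cong: "j mod p = i mod p \<Longrightarrow> b (j + n) = b (i + n)"
  by (metis b_mod mod_add_left_eq)

lemma beta_orbit_cong:
  assumes "j mod p = i mod p"
  shows "beta_orbit b j n z = beta_orbit b i n z"
  by (induction n) (simp_all add: b_cong[OF assms])

lemma beta_orbit_add: "beta_orbit b k (m + n) z = beta_orbit b (k + m) n (beta_orbit b k m z)"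
  by (induction n) (simp_all add: add.assoc)

lemma measurable_beta_orbit [measurable]: "beta_orbit b k n \<in> borel_measurable borel"
proof (induction n)
  case (Suc n)
  have "beta_orbit b k (Suc n) = T_map (b (k + n)) \<circ> beta_orbit b k n" by auto
  then show ?case using measurable_comp[OF Suc measurable_T_map] by metis
qed (simp add: measurable_ident[unfolded id_def] beta_orbit.simps(1)[abs_def])

lemma digits_nth: "k < n \<Longrightarrow> digits b i n z ! k = \<lfloor>b (i + k) * beta_orbit b i k z\<rfloor>"
proof (induction n arbitrary: i k z)
  case (Suc n)
  show ?case
  proof (cases k)
    case (Suc l)
    then have "digits b i (Suc n) z ! k = \<lfloor>b (Suc i + l) * beta_orbit b (Suc i) l (T_map (b i) z)\<rfloor>"
      using Suc.IH[of l "Suc i"] Suc.prems by simp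
    then show ?thesis using Suc by (simp add: beta_orbit_Suc_shift[symmetric] del: beta_orbit.simps)
  qed simp
qed simp

lemma length_digits [simp]: "length (digits b i n z) = n"
  by (induction n arbitrary: i z) simp_all

text \<open>The set is spread over all fibres: a point of fibre k belongs to \<open>E k\<close> if
  its orbit lies in \<open>B\<close> on arrival at a fibre congruent to i. By invariance all such
  arrival times give the same answer (\<open>same\<close>), so \<open>E\<close> is strictly
  invariant under the one-step maps and ergodicity of the whole system applies.\<close>

lemma return_invariant_trivial:
  assumes B: "B \<in> sets borel" "B \<subseteq> {0..<1}"
    and inv: "{z \<in> {0..<1}. beta_orbit b i p z \<in> B} = B"
  shows "measure lborel B = 0 \<or> measure lborel B = 1"
proof -
  have ret: "beta_orbit b i p y \<in> B \<longleftrightarrow> y \<in> B" if "0 \<le> y" "y < 1" for y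
    using inv that by (metis (mono_tags, lifting) atLeastLessThan_iff mem_Collect_eq)
  have add: "beta_orbit b k (n + q * p) z \<in> B \<longleftrightarrow> beta_orbit b k n z \<in> B"
    if z: "0 \<le> z" "z < 1" and kn: "(k + n) mod p = i mod p" for k n q z
  proof (induction q)
    case (Suc q)
    let ?y = "beta_orbit b k (n + q * p) z"
    have "beta_orbit b k (n + Suc q * p) z = beta_orbit b (k + (n + q * p)) p ?y"
      by (simp add: beta_orbit_add[symmetric] add_ac)
    also have "\<dots> = beta_orbit b i p ?y"
      by (rule beta_orbit_cong) (metis add.assoc kn mod_mult_self1)
    finally show ?case using ret[OF beta_orbit_bounds[OF z, of b k "n + q * p"]] Suc by simp
  qed simp
  have same: "beta_orbit b k n z \<in> B \<longleftrightarrow> beta_orbit b k n' z \<in> B"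
    if z: "0 \<le> z" "z < 1" and kn: "(k + n) mod p = i mod p" "(k + n') mod p = i mod p" for k n n' z
  proof -
    have *: "beta_orbit b k m z \<in> B \<longleftrightarrow> beta_orbit b k m' z \<in> B"
      if le: "m \<le> m'" and m: "(k + m) mod p = i mod p" "(k + m') mod p = i mod p" for m m'
    proof -
      have "(k + m') mod p = (k + m) mod p" using m by simp
      then have "p dvd (k + m') - (k + m)"
        by (rule iffD1[OF mod_eq_dvd_iff_nat, rotated]) (use le in simp)
      then obtain q where "m' - m = p * q" by (auto simp: dvd_def)
      then have "m' = m + q * p" using le by (simp add: mult.commute)
      then show ?thesis using add[OF z m(1), of q] by simp
    qed
    show ?thesis
    proof (cases "n \<le> n'")
      case True
      then show ?thesis by (rule *[OF _ kn])
    next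
      case False
      then have "n' \<le> n" by simp
      then show ?thesis using *[OF _ kn(2,1)] by blast
    qed
  qed
  \<comment> \<open>\<open>i + k * (p - 1)\<close> steps lead from k to \<open>i + k * p\<close>, a
    fibre congruent to i; this choice avoids subtracting k from i.\<close>
  define E where "E k = {z \<in> {0..<1}. beta_orbit b k (i + k * (p - 1)) z \<in> B}" for k
  have idx: "(k + (i + k * (p - 1))) mod p = i mod p" for k
  proof -
    have "k + (i + k * (p - 1)) = i + k * p" using p_pos by (cases p) (auto simp: algebra_simps)
    then show ?thesis by (simp only: mod_mult_self1)
  qed
  have E: "fibre_invariant E" unfolding fibre_invariant_def
  proof (intro conjI allI)
    fix k
    have "E k = (beta_orbit b k (i + k * (p - 1)) -` B) \<inter> {0..<1}" by (auto simp: E_def)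
    then show "E k \<in> sets borel"
      using measurable_sets[OF measurable_beta_orbit B(1)] by simp
    have "(k + Suc (i + Suc k * (p - 1))) mod p = i mod p" using idx[of "Suc k"] by simp
    then have "beta_orbit b k (Suc (i + Suc k * (p - 1))) z \<in> B \<longleftrightarrow> beta_orbit b k (i + k * (p - 1)) z \<in> B"
      if "0 \<le> z" "z < 1" for z by (rule same[OF that _ idx])
    then show "E k = {z \<in> {0..<1}. T_map (b k) z \<in> E (Suc k)}"
      unfolding E_def by (auto simp: beta_orbit_Suc_shift T_map_bounds simp del: beta_orbit.simps)
  qed
  have per: "E (k + p) = E k" for k
  proof -
    have "beta_orbit b (k + p) n z = beta_orbit b k n z" for n z by (rule beta_orbit_cong) simp
    moreover have "(k + (i + (k + p) * (p - 1))) mod p = i mod p"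
    proof -
      have "k + (i + (k + p) * (p - 1)) + p = (k + p) + (i + (k + p) * (p - 1))" by simp
      then show ?thesis using idx[of "k + p"] by (metis mod_add_self2)
    qed
    then have "beta_orbit b k (i + (k + p) * (p - 1)) z \<in> B \<longleftrightarrow> beta_orbit b k (i + k * (p - 1)) z \<in> B"
      if "0 \<le> z" "z < 1" for z by (rule same[OF that _ idx])
    ultimately show ?thesis unfolding E_def by auto
  qed
  have "E i = B"
  proof -
    have "beta_orbit b i (i + i * (p - 1)) z \<in> B \<longleftrightarrow> z \<in> B" if "0 \<le> z" "z < 1" for z
      using same[OF that idx, of i 0] by simp
    then show ?thesis unfolding E_def using B(2) by auto
  qed
  then show ?thesis using fibre_invariant_trivial[OF E per] by metis
qed

lemma base_prod_period: "base_prod b i p = base_prod b 0 p"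
proof (induction i)
  case (Suc i)
  have "b i * base_prod b (Suc i) p = base_prod b i p * b (i + p)"
    by (metis base_prod.simps(2) base_prod_Suc_right)
  then show ?case using Suc period[of i] gt0[of i] by simp
qed simp

lemma base_prod_eq_prod: "base_prod b i n = (\<Prod>k<n. b (i + k))"
  by (induction n) (simp_all add: base_prod_Suc_right del: base_prod.simps(2))

definition base_rate :: real where
  "base_rate = 1 / real p * ln (base_prod b 0 p)"

text \<open>Both quantities agree at multiples of p and grow by the factor
  \<open>base_prod b 0 p\<close> from one multiple to the next, which is therefore the constant of
  comparison in between.\<close>

lemma base_prod_growth:
  "base_prod b i n \<le> base_prod b 0 p * exp (real n * base_rate)"
  "exp (real n * base_rate) \<le> base_prod b 0 p * base_prod b i n"
proof -
  let ?P = "base_prod b 0 p"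
  define q r where "q = n div p" and "r = n mod p"
  have nq: "n = q * p + r" by (simp add: q_def r_def)
  have rp: "r < p" using p_pos by (simp add: r_def)
  have P: "?P \<ge> 1" by (rule base_prod_ge1)
  have pow: "base_prod b j (k * p) = ?P ^ k" for j k
  proof (induction k arbitrary: j)
    case (Suc k)
    have "base_prod b j (Suc k * p) = base_prod b j p * base_prod b (j + p) (k * p)"
      using base_prod_add[of b j p "k * p"] by simp
    then show ?case using Suc base_prod_period[of j] by simp
  qed simp
  have lo: "?P ^ q \<le> base_prod b i n"
    unfolding nq base_prod_add pow using base_prod_ge1[of "i + q * p" r] P by (simp add: mult_le_cancel_left1)
  have hi: "base_prod b i n \<le> ?P * ?P ^ q"
  proof -
    have "base_prod b (i + q * p) p = base_prod b (i + q * p) r * base_prod b (i + q * p + r) (p - r)"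
      using base_prod_add[of b "i + q * p" r "p - r"] rp by simp
    then have "base_prod b (i + q * p) r \<le> ?P"
      using base_prod_ge1[of "i + q * p + r" "p - r"] base_prod_pos[of "i + q * p" r]
        base_prod_period[of "i + q * p"] by (simp add: mult_le_cancel_left1)
    then show ?thesis unfolding nq base_prod_add pow using P by (simp add: mult.commute mult_right_mono)
  qed
  have e: "exp (real m * base_rate) = ?P ^ k" if "m = k * p" for m k
  proof -
    have "real m * base_rate = real k * ln ?P" using that p_pos by (simp add: base_rate_def)
    then show ?thesis using P by (simp add: exp_of_nat_mult)
  qed
  have rate: "base_rate \<ge> 0" unfolding base_rate_def using P by simp
  have "q * p \<le> n" using nq by simp
  then have "real (q * p) \<le> real n" by (rule of_nat_mono)
  then have "exp (real (q * p) * base_rate) \<le> exp (real n * base_rate)"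
    using rate by (intro iffD2[OF exp_le_cancel_iff] mult_right_mono)
  then have elo: "?P ^ q \<le> exp (real n * base_rate)" unfolding e[OF refl] .
  have "exp (real n * base_rate) \<le> exp (real (Suc q * p) * base_rate)"
  proof -
    have "n \<le> Suc q * p" using nq rp by simp
    then have "real n \<le> real (Suc q * p)" by (rule of_nat_mono)
    then show ?thesis using rate by (intro iffD2[OF exp_le_cancel_iff] mult_right_mono)
  qed
  then have ehi: "exp (real n * base_rate) \<le> ?P * ?P ^ q" unfolding e[OF refl] by simp
  show "base_prod b i n \<le> ?P * exp (real n * base_rate)"
    using hi elo P by (smt (verit) mult_left_mono)
  show "exp (real n * base_rate) \<le> ?P * base_prod b i n"
    using ehi lo P by (smt (verit) mult_left_mono)
qed

section \<open>The numbers x_i and the reflected lazy map\<close>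

definition xval :: "nat \<Rightarrow> real" where
  "xval i = (\<Sum>n. (of_int \<lceil>b (i + n)\<rceil> - 1) / base_prod b i (Suc n))"

lemma summable_xval: "summable (\<lambda>n. (of_int \<lceil>b (i + n)\<rceil> - 1) / base_prod b i (Suc n))"
proof (rule summable_comparison_test')
  show "summable (\<lambda>n. ratio ^ n)" using ratio(2,3) by (intro summable_geometric) simp
  fix n
  have P: "base_prod b i (Suc n) = base_prod b i n * b (i + n)" by (rule base_prod_Suc_right)
  have "0 \<le> of_int \<lceil>b (i + n)\<rceil> - (1::real)" "of_int \<lceil>b (i + n)\<rceil> - 1 \<le> b (i + n)"
    using gt1[of "i + n"] by linarith+
  then have "norm ((of_int \<lceil>b (i + n)\<rceil> - 1) / base_prod b i (Suc n)) \<le> b (i + n) / base_prod b i (Suc n)"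
    using base_prod_pos[of i "Suc n"] by (simp add: divide_right_mono del: base_prod.simps)
  also have "\<dots> = 1 / base_prod b i n"
    unfolding P using gt0[of "i + n"] by simp
  finally show "norm ((of_int \<lceil>b (i + n)\<rceil> - 1) / base_prod b i (Suc n)) \<le> ratio ^ n"
    using base_prod_inverse_le[of i n] by linarith
qed

text \<open>Splitting off the first term of the series links consecutive fibres; the conjugation of
  lazy and greedy map rests on this identity.\<close>

lemma xval_rec: "b i * xval i = of_int \<lceil>b i\<rceil> - 1 + xval (Suc i)"
proof -
  let ?f = "\<lambda>i n. (of_int \<lceil>b (i + n)\<rceil> - 1) / base_prod b i (Suc n)"
  have "xval i = ?f i 0 + (\<Sum>n. ?f i (Suc n))"
    unfolding xval_def using suminf_split_head[OF summable_xval[of i]] by simp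
  also have "(\<lambda>n. ?f i (Suc n)) = (\<lambda>n. ?f (Suc i) n / b i)"
    by (simp add: fun_eq_iff mult.commute)
  also have "(\<Sum>n. ?f (Suc i) n / b i) = xval (Suc i) / b i"
    unfolding xval_def by (rule suminf_divide[OF summable_xval])
  finally show ?thesis using gt0[of i] by (simp add: field_simps)
qed

text \<open>Replacing each digit \<open>\<lceil>b (i + n)\<rceil> - 1\<close> by the smaller
  \<open>b (i + n) - 1\<close> gives a telescoping series with sum 1.\<close>

lemma xval_ge1: "xval i \<ge> 1"
proof -
  have "(\<lambda>n. 1 / base_prod b i n) \<longlonglongrightarrow> 0"
  proof (rule tendsto_sandwich[of "\<lambda>_. 0" _ _ "\<lambda>n. ratio ^ n"])
    show "(\<lambda>n. ratio ^ n) \<longlonglongrightarrow> 0" using ratio(2,3) by (intro LIMSEQ_power_zero) simp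
  qed (use base_prod_inverse_le base_prod_pos in \<open>auto intro!: always_eventually less_imp_le\<close>)
  then have s: "(\<lambda>n. 1 / base_prod b i n - 1 / base_prod b i (Suc n)) sums (1 / base_prod b i 0 - 0)"
    by (rule telescope_sums')
  have "1 / base_prod b i n - 1 / base_prod b i (Suc n) \<le> (of_int \<lceil>b (i + n)\<rceil> - 1) / base_prod b i (Suc n)" for n
  proof -
    have P: "base_prod b i (Suc n) = base_prod b i n * b (i + n)" by (rule base_prod_Suc_right)
    have "1 / base_prod b i n - 1 / base_prod b i (Suc n) = (b (i + n) - 1) / base_prod b i (Suc n)"
      unfolding P using gt0[of "i + n"] base_prod_pos[of i n] by (simp add: field_simps)
    also have "\<dots> \<le> (of_int \<lceil>b (i + n)\<rceil> - 1) / base_prod b i (Suc n)"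
      using base_prod_pos[of i "Suc n"] by (intro divide_right_mono) auto
    finally show ?thesis .
  qed
  then have "1 / base_prod b i 0 - 0 \<le> xval i"
    unfolding xval_def by (rule sums_le[OF _ s summable_sums[OF summable_xval]])
  then show ?thesis by simp
qed

lemma base_prod_cong:
  assumes "j mod p = i mod p"
  shows "base_prod b j n = base_prod b i n"
  unfolding base_prod_eq_prod by (simp only: b_cong[OF assms])

lemma xval_mod: "xval (i mod p) = xval i"
  unfolding xval_def using b_cong[of "i mod p" i] base_prod_cong[of "i mod p" i]
  by (simp del: base_prod.simps)

text \<open>By \<open>xval_rec\<close> the argument of the ceiling is an integer minus
  \<open>b i * z\<close>, so reflection turns the ceiling into the floor of the greedy map.\<close>

lemma xval_lazy_step:
  assumes "0 \<le> z" "z < 1"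
  shows "b i * (xval i - z) - of_int \<lceil>b i * (xval i - z) - xval (Suc i)\<rceil> = xval (Suc i) - T_map (b i) z"
proof -
  have "b i * (xval i - z) - xval (Suc i) = of_int (\<lceil>b i\<rceil> - 1) + (- (b i * z))"
    using xval_rec[of i] by (simp add: algebra_simps)
  then have c: "\<lceil>b i * (xval i - z) - xval (Suc i)\<rceil> = \<lceil>b i\<rceil> - 1 - \<lfloor>b i * z\<rfloor>"
    by (simp only: ceiling_add_of_int[symmetric] ceiling_minus) linarith
  show ?thesis unfolding c using xval_rec[of i] by (simp add: T_map_def algebra_simps)
qed

text \<open>The first branch stays in range because \<open>\<lceil>b i\<rceil> - 1 < b i\<close>.
  The second one maps into the unit interval that ends at \<open>xval (Suc i)\<close>, where all
  points are positive since that number is at least 1.\<close>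

lemma xval_lazy_range:
  assumes "0 < x" "x \<le> xval i"
  shows "x \<le> xval i - 1 \<Longrightarrow> 0 < b i * x \<and> b i * x \<le> xval (Suc i)"
    and "\<not> x \<le> xval i - 1 \<Longrightarrow> 0 < b i * x - of_int \<lceil>b i * x - xval (Suc i)\<rceil> \<and>
        b i * x - of_int \<lceil>b i * x - xval (Suc i)\<rceil> \<le> xval (Suc i)"
proof -
  assume le: "x \<le> xval i - 1"
  have "b i * x \<le> b i * (xval i - 1)" using le gt0[of i] by (intro mult_left_mono) auto
  also have "\<dots> = b i * xval i - b i" by (simp add: right_diff_distrib)
  also have "\<dots> \<le> xval (Suc i)" using xval_rec[of i] by linarith
  finally show "0 < b i * x \<and> b i * x \<le> xval (Suc i)" using assms gt0[of i] by simp
next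
  show "0 < b i * x - of_int \<lceil>b i * x - xval (Suc i)\<rceil> \<and>
        b i * x - of_int \<lceil>b i * x - xval (Suc i)\<rceil> \<le> xval (Suc i)"
    using xval_ge1[of "Suc i"] by linarith
qed

end

section \<open>The fibred spaces\<close>

text \<open>Measurability is read off the sections, where complements and countable unions are taken
  fibre by fibre.\<close>

lemma fibred_sets_iff:
  assumes A: "\<And>i. i < p \<Longrightarrow> A i \<in> sets borel"
  shows "E \<in> fibred_sets p A \<longleftrightarrow> E \<subseteq> fibred_space p A \<and> (\<forall>i<p. Pair i -` E \<in> sets borel)"
proof -
  have rs: "S \<in> sets (restrict_space borel (A i)) \<longleftrightarrow> S \<subseteq> A i \<and> S \<in> sets borel" if "i < p" for i S
    using A[OF that] by (intro sets_restrict_space_iff) simp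
  show ?thesis
  proof
    assume "E \<in> fibred_sets p A"
    then obtain B where B: "E = (\<Union>i<p. {i} \<times> B i)" "\<forall>i<p. B i \<in> sets (restrict_space borel (A i))"
      unfolding fibred_sets_def by blast
    have BA: "B i \<subseteq> A i" "B i \<in> sets borel" if "i < p" for i
      using B(2) rs[OF that] that by blast+
    have "Pair i -` E = B i" if "i < p" for i using that unfolding B(1) by auto
    then have "\<forall>i<p. Pair i -` E \<in> sets borel" using BA(2) by simp
    moreover have "E \<subseteq> fibred_space p A"
      unfolding fibred_space_def B(1) by (intro UN_mono Sigma_mono) (auto dest: BA(1))
    ultimately show "E \<subseteq> fibred_space p A \<and> (\<forall>i<p. Pair i -` E \<in> sets borel)" by blast
  next
    assume E: "E \<subseteq> fibred_space p A \<and> (\<forall>i<p. Pair i -` E \<in> sets borel)"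
    have "E = (\<Union>i<p. {i} \<times> (Pair i -` E))" using E unfolding fibred_space_def by auto
    moreover have "\<forall>i<p. Pair i -` E \<in> sets (restrict_space borel (A i))"
    proof (intro allI impI)
      fix i assume i: "i < p"
      have "Pair i -` E \<subseteq> A i" using E unfolding fibred_space_def by auto
      then show "Pair i -` E \<in> sets (restrict_space borel (A i))" using E i rs[OF i] by blast
    qed
    ultimately show "E \<in> fibred_sets p A"
      unfolding fibred_sets_def mem_Collect_eq by (intro exI[of _ "\<lambda>i. Pair i -` E"] conjI)
  qed
qed

lemma sigma_algebra_fibred:
  assumes A: "\<And>i. i < p \<Longrightarrow> A i \<in> sets borel"
  shows "sigma_algebra (fibred_space p A) (fibred_sets p A)"
  unfolding sigma_algebra_iff2
proof (intro conjI ballI allI impI)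
  have iff: "E \<in> fibred_sets p A \<longleftrightarrow> E \<subseteq> fibred_space p A \<and> (\<forall>i<p. Pair i -` E \<in> sets borel)" for E
    by (rule fibred_sets_iff[OF A])
  show "fibred_sets p A \<subseteq> Pow (fibred_space p A)" using iff by blast
  show "{} \<in> fibred_sets p A" unfolding iff by simp
  fix E assume E: "E \<in> fibred_sets p A"
  have "Pair i -` (fibred_space p A - E) = A i - Pair i -` E" if "i < p" for i
    using that by (auto simp: fibred_space_def)
  then show "fibred_space p A - E \<in> fibred_sets p A" using E A unfolding iff by auto
next
  have iff: "E \<in> fibred_sets p A \<longleftrightarrow> E \<subseteq> fibred_space p A \<and> (\<forall>i<p. Pair i -` E \<in> sets borel)" for E
    by (rule fibred_sets_iff[OF A])
  fix F :: "nat \<Rightarrow> (nat \<times> real) set" assume F: "range F \<subseteq> fibred_sets p A"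
  then have F': "F n \<subseteq> fibred_space p A \<and> (\<forall>i<p. Pair i -` F n \<in> sets borel)" for n
    using iff by blast
  have "Pair i -` (\<Union>n. F n) = (\<Union>n. Pair i -` F n)" for i by auto
  then show "(\<Union>n. F n) \<in> fibred_sets p A" unfolding iff using F' by auto
qed

lemma emeasure_lborel_Diff_full:
  fixes S :: "real set"
  assumes "S \<in> sets borel" "S \<subseteq> {0..<1}" "measure lborel S = 1"
  shows "emeasure lborel ({0..<1} - S) = 0"
proof -
  have "emeasure lborel S = 1"
    using emeasure_lborel_Int_Ico[of S 0 1] assms by (simp add: Int_absorb2)
  then show ?thesis using assms by (subst emeasure_Diff) auto
qed

section \<open>From lists of base entries to the fibred system\<close>

locale beta_base =
  fixes \<beta> :: "real list"
  assumes nonempty: "length \<beta> \<ge> 1" and entries: "\<And>i. i < length \<beta> \<Longrightarrow> \<beta> ! i > 1"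
begin

abbreviation p :: nat where "p \<equiv> length \<beta>"

lemma mod_p_less [simp]: "n mod p < p"
  by (rule mod_less_divisor) (use nonempty in linarith)

lemma base_nonempty [simp]: "\<beta> \<noteq> []"
  using nonempty by auto

definition bs :: "nat \<Rightarrow> real" where "bs n = base_at \<beta> (int n)"

lemma bs_eq: "bs n = \<beta> ! (n mod p)"
  by (simp add: bs_def base_at_def zmod_int[symmetric])

sublocale beta_system bs p
proof
  show "p \<ge> 1" by (rule nonempty)
  show "bs (n + p) = bs n" for n by (simp add: bs_eq)
  show "bs n > 1" for n unfolding bs_eq by (rule entries) simp
qed

lemma base_at_shift: "base_at (base_shift \<beta> (int i)) (int n) = bs (i + n)"
proof -
  have "base_at (base_shift \<beta> (int i)) (int n) = bs (i + n mod p)"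
    unfolding base_at_def[of "base_shift \<beta> (int i)"] by (simp add: base_shift_def zmod_int[symmetric] bs_def)
  then show ?thesis by (simp add: bs_eq mod_add_right_eq)
qed

lemma x_shift_eq: "x_shift \<beta> i = xval i"
  unfolding x_base_def xval_def base_at_shift base_prod_eq_prod lessThan_Suc_atMost ..

lemma lazy_space_eq: "lazy_space \<beta> = fibred_space p (\<lambda>i. {0<..xval i})"
  by (simp add: lazy_space_def x_shift_eq)

lemma mem_lazy_space: "(i, x) \<in> lazy_space \<beta> \<longleftrightarrow> i < p \<and> 0 < x \<and> x \<le> xval i"
  by (auto simp: lazy_space_eq fibred_space_def)

lemma lazy_sets_iff:
  "E \<in> lazy_sets \<beta> \<longleftrightarrow> E \<subseteq> lazy_space \<beta> \<and> (\<forall>i<p. Pair i -` E \<in> sets borel)"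
  unfolding lazy_sets_def lazy_space_def by (rule fibred_sets_iff) simp

lemma greedy_sets_iff:
  "E \<in> greedy_sets \<beta> \<longleftrightarrow> E \<subseteq> greedy_space \<beta> \<and> (\<forall>i<p. Pair i -` E \<in> sets borel)"
  unfolding greedy_sets_def greedy_space_def by (rule fibred_sets_iff) simp

lemma mem_greedy_space: "(i, x) \<in> greedy_space \<beta> \<longleftrightarrow> i < p \<and> 0 \<le> x \<and> x < xval i"
  by (auto simp: greedy_space_def x_shift_eq fibred_space_def)

lemma sigma_lazy: "sigma_algebra (lazy_space \<beta>) (lazy_sets \<beta>)"
  unfolding lazy_sets_def lazy_space_def by (rule sigma_algebra_fibred) simp

lemma sigma_greedy: "sigma_algebra (greedy_space \<beta>) (greedy_sets \<beta>)"
  unfolding greedy_sets_def greedy_space_def by (rule sigma_algebra_fibred) simp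

lemma sets_lazy_sigma [simp]: "sets (sigma (lazy_space \<beta>) (lazy_sets \<beta>)) = lazy_sets \<beta>"
  using sigma_algebra.sigma_sets_eq[OF sigma_lazy] lazy_sets_iff by (subst sets_measure_of) auto

lemma space_lazy_sigma [simp]: "space (sigma (lazy_space \<beta>) (lazy_sets \<beta>)) = lazy_space \<beta>"
  using lazy_sets_iff by (intro space_measure_of) auto

lemma sets_averaged [simp]: "sets (averaged_measure \<beta> m) = greedy_sets \<beta>"
  unfolding averaged_measure_def
  using sigma_algebra.sigma_sets_eq[OF sigma_greedy] greedy_sets_iff by (subst sets_measure_of) auto

lemma space_averaged [simp]: "space (averaged_measure \<beta> m) = greedy_space \<beta>"
  unfolding averaged_measure_def using greedy_sets_iff by (intro space_measure_of) auto

text \<open>The hypothesis on \<open>m\<close> fits both uses, \<open>lborel\<close> on the whole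
  line and fibre measures that live on [0, 1) only.\<close>

lemma emeasure_averaged:
  assumes m: "\<And>i A. i < p \<Longrightarrow> A \<in> sets borel \<Longrightarrow> A \<inter> {0..<1} \<in> sets (m i)"
    and E: "E \<in> greedy_sets \<beta>"
  shows "emeasure (averaged_measure \<beta> m) E
    = ennreal (1 / real p) * (\<Sum>i<p. emeasure (m i) (Pair i -` E \<inter> {0..<1}))"
  unfolding averaged_measure_def
proof (rule emeasure_measure_of_sigma[OF sigma_greedy])
  let ?f = "\<lambda>E. ennreal (1 / real p) * (\<Sum>i<p. emeasure (m i) (Pair i -` E \<inter> {0..<1}))"
  show "positive (greedy_sets \<beta>) ?f" by (simp add: positive_def)
  show "countably_additive (greedy_sets \<beta>) ?f" unfolding countably_additive_def
  proof (intro allI impI)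
    fix F :: "nat \<Rightarrow> (nat \<times> real) set"
    assume F: "range F \<subseteq> greedy_sets \<beta>" "disjoint_family F"
    have "(\<Sum>n. emeasure (m i) (Pair i -` F n \<inter> {0..<1})) = emeasure (m i) (Pair i -` (\<Union>n. F n) \<inter> {0..<1})"
      if i: "i < p" for i
    proof -
      have "(\<Sum>n. emeasure (m i) (Pair i -` F n \<inter> {0..<1})) = emeasure (m i) (\<Union>n. Pair i -` F n \<inter> {0..<1})"
      proof (rule suminf_emeasure)
        have "Pair i -` F n \<in> sets borel" for n using F(1) greedy_sets_iff i by blast
        then show "range (\<lambda>n. Pair i -` F n \<inter> {0..<1}) \<subseteq> sets (m i)" using m[OF i] by blast
        show "disjoint_family (\<lambda>n. Pair i -` F n \<inter> {0..<1})"
          using F(2) unfolding disjoint_family_on_def by blast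
      qed
      moreover have "(\<Union>n. Pair i -` F n \<inter> {0..<1}) = Pair i -` (\<Union>n. F n) \<inter> {0..<1}" by auto
      ultimately show ?thesis by simp
    qed
    then show "(\<Sum>n. ?f (F n)) = ?f (\<Union>n. F n)"
      by (simp add: suminf_sum[OF summableI])
  qed
qed (rule E)

text \<open>The fibre of B in the reflected coordinate, cut down to the part that carries the
  measures and continued periodically to all indices.\<close>

definition slice :: "(nat \<times> real) set \<Rightarrow> nat \<Rightarrow> real set" where
  "slice B i = {z \<in> {0..<1}. (i mod p, xval i - z) \<in> B}"

lemma slice_subset: "slice B i \<subseteq> {0..<1}"
  by (auto simp: slice_def)

lemma slice_borel:
  assumes "B \<in> lazy_sets \<beta>"
  shows "slice B i \<in> sets borel"
proof -
  have "Pair (i mod p) -` B \<in> sets borel" using assms lazy_sets_iff mod_p_less by blast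
  then have "(\<lambda>z. xval i - z) -` (Pair (i mod p) -` B) \<in> sets borel"
    using measurable_sets[of "\<lambda>z. xval i - z" borel borel "Pair (i mod p) -` B"] by simp
  moreover have "slice B i = (\<lambda>z. xval i - z) -` (Pair (i mod p) -` B) \<inter> {0..<1}"
    by (auto simp: slice_def)
  ultimately show ?thesis by simp
qed

lemma xval_cong: "j mod p = i mod p \<Longrightarrow> xval j = xval i"
  by (metis xval_mod)

lemma slice_mod: "slice B (i mod p) = slice B i"
  by (simp add: slice_def xval_mod)

lemma phi_mem_lazy_space:
  assumes "0 \<le> z" "z < 1"
  shows "(i mod p, xval i - z) \<in> lazy_space \<beta>"
  unfolding mem_lazy_space using assms xval_ge1[of i] p_pos by (simp add: xval_mod)

lemma measurable_phi: "phi_map \<beta> \<in> measurable (averaged_measure \<beta> m) (sigma (lazy_space \<beta>) (lazy_sets \<beta>))"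
proof (rule measurableI)
  fix x assume "x \<in> space (averaged_measure \<beta> m)"
  then show "phi_map \<beta> x \<in> space (sigma (lazy_space \<beta>) (lazy_sets \<beta>))"
    by (cases x) (simp add: phi_map_def x_shift_eq mem_greedy_space mem_lazy_space)
next
  fix B assume "B \<in> sets (sigma (lazy_space \<beta>) (lazy_sets \<beta>))"
  then have B: "B \<in> lazy_sets \<beta>" by simp
  have "Pair i -` (phi_map \<beta> -` B \<inter> greedy_space \<beta>) \<in> sets borel" if i: "i < p" for i
  proof -
    have "Pair i -` B \<in> sets borel" using B lazy_sets_iff i by blast
    then have "(\<lambda>z. xval i - z) -` (Pair i -` B) \<in> sets borel"
      using measurable_sets[of "\<lambda>z. xval i - z" borel borel "Pair i -` B"] by simp
    moreover have "Pair i -` (phi_map \<beta> -` B \<inter> greedy_space \<beta>) = (\<lambda>z. xval i - z) -` (Pair i -` B) \<inter> {0..<xval i}"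
      using i by (auto simp: phi_map_def x_shift_eq mem_greedy_space)
    ultimately show ?thesis by simp
  qed
  then show "phi_map \<beta> -` B \<inter> space (averaged_measure \<beta> m) \<in> sets (averaged_measure \<beta> m)"
    by (simp add: greedy_sets_iff)
qed

lemma sets_push [simp]: "sets (push_phi \<beta> M) = lazy_sets \<beta>"
  by (simp add: push_phi_def)

lemma space_push [simp]: "space (push_phi \<beta> M) = lazy_space \<beta>"
  by (simp add: push_phi_def)

lemma emeasure_push_averaged:
  assumes m: "\<And>i A. i < p \<Longrightarrow> A \<in> sets borel \<Longrightarrow> A \<inter> {0..<1} \<in> sets (m i)"
    and B: "B \<in> lazy_sets \<beta>"
  shows "emeasure (push_phi \<beta> (averaged_measure \<beta> m)) B
    = ennreal (1 / real p) * (\<Sum>i<p. emeasure (m i) (slice B i))"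
proof -
  let ?E = "phi_map \<beta> -` B \<inter> greedy_space \<beta>"
  have "emeasure (push_phi \<beta> (averaged_measure \<beta> m)) B = emeasure (averaged_measure \<beta> m) ?E"
    unfolding push_phi_def using B by (subst emeasure_distr[OF measurable_phi]) simp_all
  also have "?E \<in> greedy_sets \<beta>"
    using measurable_sets[OF measurable_phi, of B undefined] B by simp
  then have "emeasure (averaged_measure \<beta> m) ?E
      = ennreal (1 / real p) * (\<Sum>i<p. emeasure (m i) (Pair i -` ?E \<inter> {0..<1}))"
    using m by (intro emeasure_averaged)
  also have "(\<Sum>i<p. emeasure (m i) (Pair i -` ?E \<inter> {0..<1})) = (\<Sum>i<p. emeasure (m i) (slice B i))"
  proof (intro sum.cong refl arg_cong2[where f = emeasure])
    fix i assume "i \<in> {..<p}"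
    then show "Pair i -` ?E \<inter> {0..<1} = slice B i"
      using xval_ge1[of i] by (auto simp: phi_map_def x_shift_eq mem_greedy_space slice_def)
  qed
  finally show ?thesis .
qed

lemma averaged_sum_eq_0:
  fixes f :: "nat \<Rightarrow> ennreal"
  shows "ennreal (1 / real p) * (\<Sum>i<p. f i) = 0 \<longleftrightarrow> (\<forall>i<p. f i = 0)"
  using p_pos by (auto simp: sum_eq_0_iff)

lemma averaged_sum_const:
  fixes f :: "nat \<Rightarrow> ennreal"
  assumes "\<And>i. i < p \<Longrightarrow> f i = 1"
  shows "ennreal (1 / real p) * (\<Sum>i<p. f i) = 1"
proof -
  have "(\<Sum>i<p. f i) = ennreal (real p)" using assms by (simp add: ennreal_of_nat_eq_real_of_nat)
  then show ?thesis using p_pos by (simp add: ennreal_mult[symmetric])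
qed

lemma emeasure_push_lambda:
  assumes "B \<in> lazy_sets \<beta>"
  shows "emeasure (push_phi \<beta> (lambda_p \<beta>)) B = ennreal (1 / real p) * (\<Sum>i<p. emeasure lborel (slice B i))"
  unfolding lambda_p_def by (rule emeasure_push_averaged[OF _ assms]) simp

lemma lazy_map_eq:
  "lazy_map \<beta> (i, x) = (Suc i mod p,
    if x \<le> xval i - 1 then bs i * x else bs i * x - of_int \<lceil>bs i * x - xval (Suc i)\<rceil>)"
  using x_shift_eq[of "Suc i"] by (simp add: lazy_map_def x_shift_eq bs_def)

text \<open>For z < 1 the point lies above \<open>xval i - 1\<close>, so only the second branch of
  the lazy map occurs.\<close>

lemma lazy_map_phi:
  assumes z: "0 \<le> z" "z < 1"
  shows "lazy_map \<beta> (i mod p, xval i - z) = (Suc i mod p, xval (Suc i) - T_map (bs i) z)"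
proof -
  have "xval (Suc (i mod p)) = xval (Suc i)" by (rule xval_cong) (simp add: mod_Suc_eq)
  then show ?thesis
    unfolding lazy_map_eq using xval_lazy_step[OF z, of i] z by (simp add: xval_mod b_mod mod_Suc_eq)
qed

lemma lazy_map_in_space: "x \<in> lazy_space \<beta> \<Longrightarrow> lazy_map \<beta> x \<in> lazy_space \<beta>"
proof (cases x)
  case (Pair i y)
  assume "x \<in> lazy_space \<beta>"
  then have y: "0 < y" "y \<le> xval i" using Pair by (auto simp: mem_lazy_space)
  have "xval (Suc i mod p) = xval (Suc i)" by (rule xval_mod)
  then show ?thesis unfolding Pair lazy_map_eq mem_lazy_space
    using xval_lazy_range[OF y] p_pos by auto
qed

lemma measurable_lazy_map:
  assumes M: "sets M = lazy_sets \<beta>"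
  shows "lazy_map \<beta> \<in> measurable M M"
proof -
  have sp: "space M = lazy_space \<beta>"
    using sets_eq_imp_space_eq[of M "sigma (lazy_space \<beta>) (lazy_sets \<beta>)"] M by simp
  show ?thesis
  proof (rule measurableI)
    show "lazy_map \<beta> x \<in> space M" if "x \<in> space M" for x
      using that lazy_map_in_space by (simp add: sp)
    fix E assume "E \<in> sets M"
    then have E: "E \<in> lazy_sets \<beta>" by (simp add: M)
    have "Pair i -` (lazy_map \<beta> -` E \<inter> lazy_space \<beta>) \<in> sets borel" if i: "i < p" for i
    proof -
      define g where "g x = (if x \<le> xval i - 1 then bs i * x
        else bs i * x - of_int \<lceil>bs i * x - xval (Suc i)\<rceil>)" for x
      have F: "Pair (Suc i mod p) -` E \<in> sets borel" using E lazy_sets_iff mod_p_less by blast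
      have g: "g \<in> borel_measurable borel" unfolding g_def by measurable
      have "Pair i -` (lazy_map \<beta> -` E \<inter> lazy_space \<beta>) = (g -` (Pair (Suc i mod p) -` E)) \<inter> {0<..xval i}"
        using i by (auto simp: lazy_map_eq g_def mem_lazy_space)
      then show ?thesis using measurable_sets[OF g F] by simp
    qed
    then show "lazy_map \<beta> -` E \<inter> space M \<in> sets M" unfolding M sp lazy_sets_iff by simp
  qed
qed

text \<open>The conjugation on the level of sets: the slices of a strictly invariant set form a
  \<open>fibre_invariant\<close> family.\<close>

lemma slice_vimage:
  "slice (lazy_map \<beta> -` B \<inter> lazy_space \<beta>) i = {z \<in> {0..<1}. T_map (bs i) z \<in> slice B (Suc i)}"
  using phi_mem_lazy_space[of _ i] T_map_bounds by (auto simp: slice_def lazy_map_phi)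

lemma slice_compl: "slice (lazy_space \<beta> - B) i = {0..<1} - slice B i"
  using phi_mem_lazy_space[of _ i] by (auto simp: slice_def)

lemma slice_space: "slice (lazy_space \<beta>) i = {0..<1}"
  using phi_mem_lazy_space[of _ i] by (auto simp: slice_def)

lemma lazy_invariant_trivial:
  assumes B: "B \<in> lazy_sets \<beta>" and inv: "lazy_map \<beta> -` B \<inter> lazy_space \<beta> = B"
  shows "(\<forall>i. emeasure lborel (slice B i) = 0) \<or> (\<forall>i. emeasure lborel ({0..<1} - slice B i) = 0)"
proof -
  have E: "fibre_invariant (slice B)"
    unfolding fibre_invariant_def using slice_borel[OF B] slice_vimage[of B] unfolding inv by blast
  have per: "slice B (i + p) = slice B i" for i using slice_mod[of B "i + p"] slice_mod[of B i] by simp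
  have fin: "emeasure lborel (slice B i) = ennreal (measure lborel (slice B i))" for i
    using emeasure_lborel_Int_Ico[OF slice_borel[OF B], of i 0 1] slice_subset[of B i] by (simp add: Int_absorb2)
  from fibre_invariant_trivial[OF E per] show ?thesis
  proof
    assume "\<forall>i. measure lborel (slice B i) = 0"
    then show ?thesis unfolding fin by simp
  next
    assume "\<forall>i. measure lborel (slice B i) = 1"
    then show ?thesis using emeasure_lborel_Diff_full[OF slice_borel[OF B] slice_subset] by blast
  qed
qed

lemma push_lambda_trivial:
  assumes B: "B \<in> lazy_sets \<beta>" and inv: "lazy_map \<beta> -` B \<inter> lazy_space \<beta> = B"
  shows "emeasure (push_phi \<beta> (lambda_p \<beta>)) B = 0 \<or> emeasure (push_phi \<beta> (lambda_p \<beta>)) (lazy_space \<beta> - B) = 0"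
proof -
  have "lazy_space \<beta> - B \<in> lazy_sets \<beta>"
    using sets.compl_sets[of B "sigma (lazy_space \<beta>) (lazy_sets \<beta>)"] B by simp
  then show ?thesis
    using lazy_invariant_trivial[OF B inv] emeasure_push_lambda[OF B] emeasure_push_lambda[of "lazy_space \<beta> - B"]
    by (auto simp: averaged_sum_eq_0 slice_compl)
qed

text \<open>The innermost factor has index i - p, congruent to i, so the composition runs through
  the fibres i, ..., i + p - 1. The induction is over suffixes of the index list, since their maps
  are applied first.\<close>

lemma T_return_eq: "T_return \<beta> i = beta_orbit bs i p"
proof
  fix x
  have "foldr (\<lambda>k. T_map (base_at \<beta> (int i - int k))) [p + 1 - n..<p + 1] x = beta_orbit bs i n x"
    if "n \<le> p" for n
    using that
  proof (induction n)
    case (Suc n)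
    have "p + 1 - Suc n < p + 1" "Suc (p + 1 - Suc n) = p + 1 - n" using Suc.prems by auto
    then have up: "[p + 1 - Suc n..<p + 1] = (p + 1 - Suc n) # [p + 1 - n..<p + 1]"
      by (metis upt_conv_Cons)
    have "base_at \<beta> (int i - int (p + 1 - Suc n)) = bs (i + n)"
    proof -
      have "(int i - int (p + 1 - Suc n)) mod int p = (int (i + n) - int p) mod int p"
        using Suc.prems by (simp add: of_nat_diff algebra_simps)
      then show ?thesis by (simp add: bs_def base_at_def)
    qed
    then show ?case unfolding up using Suc by simp
  qed simp
  from this[of p] show "T_return \<beta> i x = beta_orbit bs i p x" by (simp add: T_return_def)
qed

end

section \<open>The lazy transformation and its invariant measure\<close>

locale beta_acim = beta_base +
  fixes \<nu> :: "nat \<Rightarrow> real measure" and a C :: real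
  assumes fam: "invariant_fibre_family \<nu> a C"
begin

lemma constants: "0 < a" "0 \<le> C"
  using fam by (auto simp: invariant_fibre_family_def)

lemma sets_nu [simp]: "sets (\<nu> i) = sets borel"
  using fam by (auto simp: invariant_fibre_family_def)

lemma space_nu [simp]: "space (\<nu> i) = UNIV"
  using sets_eq_imp_space_eq[OF sets_nu, of i] by simp

lemma nu_UNIV: "emeasure (\<nu> i) UNIV = 1"
  using fam by (auto simp: invariant_fibre_family_def)

lemma nu_mod: "\<nu> (i mod p) = \<nu> i"
  using fam by (auto simp: invariant_fibre_family_def)

lemma nu_bounds:
  assumes "A \<in> sets borel"
  shows "ennreal a * emeasure lborel (A \<inter> {0..<1}) \<le> emeasure (\<nu> i) A"
    "emeasure (\<nu> i) A \<le> ennreal C * emeasure lborel (A \<inter> {0..<1})"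
  using fam assms by (auto simp: invariant_fibre_family_def)

lemma nu_T_map: "A \<in> sets borel \<Longrightarrow> emeasure (\<nu> i) (T_map (bs i) -` A) = emeasure (\<nu> (Suc i)) A"
  using fam by (auto simp: invariant_fibre_family_def)

lemma nu_eq_0_iff:
  assumes A: "A \<in> sets borel"
  shows "emeasure (\<nu> i) A = 0 \<longleftrightarrow> emeasure lborel (A \<inter> {0..<1}) = 0"
proof
  assume "emeasure (\<nu> i) A = 0"
  then have "ennreal a * emeasure lborel (A \<inter> {0..<1}) = 0" using nu_bounds(1)[OF A, of i] by simp
  then show "emeasure lborel (A \<inter> {0..<1}) = 0" using constants by simp
next
  assume "emeasure lborel (A \<inter> {0..<1}) = 0"
  then show "emeasure (\<nu> i) A = 0" using nu_bounds(2)[OF A, of i] by simp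
qed

lemma nu_Int:
  assumes A: "A \<in> sets borel"
  shows "emeasure (\<nu> i) (A \<inter> {0..<1}) = emeasure (\<nu> i) A"
proof -
  have "emeasure (\<nu> i) (A - {0..<1}) = 0"
    using A by (subst nu_eq_0_iff) (auto simp: Int_commute)
  moreover have "emeasure (\<nu> i) (A \<inter> {0..<1}) + emeasure (\<nu> i) (A - {0..<1}) = emeasure (\<nu> i) A"
    using A by (subst plus_emeasure) (auto intro!: arg_cong[where f = "emeasure (\<nu> i)"])
  ultimately show ?thesis by simp
qed

lemma nu_orbit:
  assumes "A \<in> sets borel"
  shows "emeasure (\<nu> i) (beta_orbit bs i n -` A) = emeasure (\<nu> (i + n)) A"
  using assms
proof (induction n arbitrary: A)
  case 0
  have "beta_orbit bs i 0 -` A = A" by auto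
  then show ?case by simp
next
  case (Suc n)
  have "T_map (bs (i + n)) -` A \<in> sets borel"
    using measurable_sets[OF measurable_T_map Suc.prems] by simp
  from Suc.IH[OF this] have "emeasure (\<nu> i) (beta_orbit bs i n -` (T_map (bs (i + n)) -` A)) = emeasure (\<nu> (i + n)) (T_map (bs (i + n)) -` A)" .
  also have "\<dots> = emeasure (\<nu> (i + Suc n)) A" using nu_T_map[OF Suc.prems, of "i + n"] by simp
  also have "beta_orbit bs i n -` (T_map (bs (i + n)) -` A) = beta_orbit bs i (Suc n) -` A" by auto
  finally show ?case .
qed

section \<open>Identification of the fibre measures\<close>

definition nu_unit :: "nat \<Rightarrow> real measure" where
  "nu_unit i = restrict_space (\<nu> i) {0..<1}"

lemma sets_restrict_unit: "A \<in> sets (restrict_space borel {0..<1::real}) \<longleftrightarrow> A \<subseteq> {0..<1} \<and> A \<in> sets borel"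
  by (rule sets_restrict_space_iff) simp

lemma sets_nu_unit: "sets (nu_unit i) = sets (restrict_space borel {0..<1})"
  unfolding nu_unit_def by (rule sets_restrict_space_cong) simp

lemma space_nu_unit: "space (nu_unit i) = {0..<1}"
  by (simp add: nu_unit_def space_restrict_space)

lemma emeasure_nu_unit:
  assumes "A \<subseteq> {0..<1}"
  shows "emeasure (nu_unit i) A = emeasure (\<nu> i) A"
  unfolding nu_unit_def by (rule emeasure_restrict_space) (use assms in auto)

lemma emeasure_lborel_unit:
  assumes "A \<subseteq> {0..<1}"
  shows "emeasure (restrict_space lborel {0..<1}) A = emeasure lborel (A :: real set)"
  by (rule emeasure_restrict_space) (use assms in auto)

lemma nu_unit_acim:
  shows "prob_space (nu_unit i)"
    and "absolutely_continuous (restrict_space lborel {0..<1}) (nu_unit i)"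
    and "invariant_under (nu_unit i) (T_return \<beta> i)"
proof -
  show "prob_space (nu_unit i)"
    using nu_Int[of UNIV i] nu_UNIV[of i] by (intro prob_spaceI) (simp add: space_nu_unit emeasure_nu_unit)
  show "absolutely_continuous (restrict_space lborel {0..<1}) (nu_unit i)"
    unfolding absolutely_continuous_def
  proof
    fix A assume A: "A \<in> null_sets (restrict_space lborel {0..<1::real})"
    then have "A \<in> sets (restrict_space lborel {0..<1})" by (rule null_setsD2)
    then have A': "A \<subseteq> {0..<1}" "A \<in> sets borel" by (simp_all add: sets_restrict_space_iff)
    have "emeasure lborel A = 0" using null_setsD1[OF A] emeasure_lborel_unit[OF A'(1)] by simp
    then have "emeasure (\<nu> i) A = 0" using nu_eq_0_iff[OF A'(2)] A'(1) by (simp add: Int_absorb2)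
    then show "A \<in> null_sets (nu_unit i)"
      using A' by (intro null_setsI) (simp_all add: emeasure_nu_unit sets_nu_unit sets_restrict_unit)
  qed
  show "invariant_under (nu_unit i) (T_return \<beta> i)"
    unfolding invariant_under_def T_return_eq
  proof (intro conjI ballI)
    have pre: "beta_orbit bs i p -` A \<inter> {0..<1} \<in> sets borel" if "A \<in> sets borel" for A
      using measurable_sets[OF measurable_beta_orbit that] by simp
    show "beta_orbit bs i p \<in> measurable (nu_unit i) (nu_unit i)"
    proof (rule measurableI)
      show "beta_orbit bs i p x \<in> space (nu_unit i)" if "x \<in> space (nu_unit i)" for x
        using that beta_orbit_bounds[of x bs i p] by (simp add: space_nu_unit)
      show "beta_orbit bs i p -` A \<inter> space (nu_unit i) \<in> sets (nu_unit i)" if "A \<in> sets (nu_unit i)" for A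
        using that pre[of A] by (auto simp: space_nu_unit sets_nu_unit sets_restrict_unit)
    qed
    fix B assume "B \<in> sets (nu_unit i)"
    then have B: "B \<subseteq> {0..<1}" "B \<in> sets borel" by (simp_all add: sets_nu_unit sets_restrict_unit)
    have "emeasure (nu_unit i) (beta_orbit bs i p -` B \<inter> {0..<1}) = emeasure (\<nu> i) (beta_orbit bs i p -` B)"
      using measurable_sets[OF measurable_beta_orbit B(2)] by (subst emeasure_nu_unit) (auto simp: nu_Int)
    also have "\<dots> = emeasure (\<nu> (i + p)) B" by (rule nu_orbit[OF B(2)])
    also have "\<nu> (i + p) = \<nu> i" using nu_mod[of "i + p"] nu_mod[of i] by simp
    finally show "emeasure (nu_unit i) (beta_orbit bs i p -` B \<inter> space (nu_unit i)) = emeasure (nu_unit i) B"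
      using B by (simp add: space_nu_unit emeasure_nu_unit)
  qed
qed

text \<open>Uniqueness comes from triviality of the sets invariant under the return map, with
  Lebesgue measure on [0, 1) as reference.\<close>

lemma mu_fibre_eq: "mu_fibre \<beta> i = nu_unit i"
  unfolding mu_fibre_def
proof (rule the_equality)
  show "sets (nu_unit i) = sets (restrict_space borel {0..<1}) \<and> prob_space (nu_unit i) \<and>
      absolutely_continuous (restrict_space lborel {0..<1}) (nu_unit i) \<and>
      invariant_under (nu_unit i) (T_return \<beta> i)"
    using nu_unit_acim sets_nu_unit by blast
  fix M assume M: "sets M = sets (restrict_space borel {0..<1}) \<and> prob_space M \<and>
      absolutely_continuous (restrict_space lborel {0..<1}) M \<and> invariant_under M (T_return \<beta> i)"
  have setsR: "sets (restrict_space lborel {0..<1::real}) = sets (restrict_space borel {0..<1})"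
    by (rule sets_restrict_space_cong) simp
  show "M = nu_unit i"
  proof (rule trivial_invariant_sets_imp_unique)
    show "sets (restrict_space lborel {0..<1}) = sets M" using M setsR by simp
    show "sets M = sets (nu_unit i)" using M sets_nu_unit by simp
    fix B assume B: "B \<in> sets (restrict_space lborel {0..<1::real})"
      "T_return \<beta> i -` B \<inter> space (restrict_space lborel {0..<1}) = B"
    have B': "B \<subseteq> {0..<1}" "B \<in> sets borel" using B(1) unfolding setsR sets_restrict_unit by auto
    have "T_return \<beta> i -` B \<inter> {0..<1} = B" using B(2) by (simp add: space_restrict_space)
    then have "{z \<in> {0..<1}. beta_orbit bs i p z \<in> B} = B" unfolding T_return_eq by blast
    from return_invariant_trivial[OF B'(2,1) this]
    show "emeasure (restrict_space lborel {0..<1}) B = 0 \<or>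
      emeasure (restrict_space lborel {0..<1}) (space (restrict_space lborel {0..<1}) - B) = 0"
    proof
      assume 0: "measure lborel B = 0"
      have "emeasure lborel B = ennreal (measure lborel B)"
        using emeasure_lborel_Int_Ico[OF B'(2), of 0 1] B'(1) by (simp add: Int_absorb2)
      then show ?thesis using 0 emeasure_lborel_unit[OF B'(1)] by simp
    next
      assume "measure lborel B = 1"
      then show ?thesis using emeasure_lborel_Diff_full[OF B'(2,1)] emeasure_lborel_unit[of "{0..<1} - B"]
        by (simp add: space_restrict_space)
    qed
  qed (use M nu_unit_acim in auto)
qed

section \<open>The measure on the lazy space\<close>

abbreviation N :: "(nat \<times> real) measure" where "N \<equiv> push_phi \<beta> (mu_greedy \<beta>)"
abbreviation L :: "(nat \<times> real) measure" where "L \<equiv> push_phi \<beta> (lambda_p \<beta>)"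

lemma emeasure_N:
  assumes B: "B \<in> lazy_sets \<beta>"
  shows "emeasure N B = ennreal (1 / real p) * (\<Sum>i<p. emeasure (\<nu> i) (slice B i))"
proof -
  have "emeasure N B = ennreal (1 / real p) * (\<Sum>i<p. emeasure (mu_fibre \<beta> i) (slice B i))"
    unfolding mu_greedy_def
    by (rule emeasure_push_averaged[OF _ B]) (simp add: mu_fibre_eq sets_nu_unit sets_restrict_unit)
  then show ?thesis by (simp add: mu_fibre_eq emeasure_nu_unit[OF slice_subset])
qed

lemma N_eq_0_iff:
  assumes B: "B \<in> lazy_sets \<beta>"
  shows "emeasure N B = 0 \<longleftrightarrow> emeasure L B = 0"
  unfolding emeasure_N[OF B] emeasure_push_lambda[OF B] averaged_sum_eq_0
  using nu_eq_0_iff[OF slice_borel[OF B]] slice_subset by (simp add: Int_absorb2)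

lemma null_sets_N: "null_sets N = null_sets L"
  using N_eq_0_iff by (auto simp: null_sets_def)

lemma equivalent_N_L: "equivalent_measures N L"
  by (simp add: equivalent_measures_def absolutely_continuous_def null_sets_N)

lemma prob_space_N: "prob_space N"
proof (rule prob_spaceI)
  have "lazy_space \<beta> \<in> lazy_sets \<beta>"
    using sets.top[of "sigma (lazy_space \<beta>) (lazy_sets \<beta>)"] by simp
  then show "emeasure N (space N) = 1"
    unfolding space_push using nu_Int[of UNIV] nu_UNIV
    by (simp only: emeasure_N slice_space) (intro averaged_sum_const, simp)
qed

text \<open>The preimage of B on fibre i has the mass of B on fibre \<open>Suc i\<close>; the
  average over a cycle is unchanged because the family closes up, \<open>F p = F 0\<close>.\<close>

lemma invariant_N: "invariant_under N (lazy_map \<beta>)"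
  unfolding invariant_under_def
proof (intro conjI ballI)
  show T: "lazy_map \<beta> \<in> measurable N N" by (rule measurable_lazy_map) simp
  fix B assume "B \<in> sets N"
  then have B: "B \<in> lazy_sets \<beta>" by simp
  let ?B = "lazy_map \<beta> -` B \<inter> lazy_space \<beta>"
  have B': "?B \<in> lazy_sets \<beta>" using measurable_sets[OF T, of B] B by simp
  define F where "F i = emeasure (\<nu> i) (slice B i)" for i
  have step: "emeasure (\<nu> i) (slice ?B i) = F (Suc i)" for i
  proof -
    have "slice ?B i = (T_map (bs i) -` slice B (Suc i)) \<inter> {0..<1}" unfolding slice_vimage by auto
    then show ?thesis
      using measurable_sets[OF measurable_T_map slice_borel[OF B], of "bs i" "Suc i"]
      by (simp add: nu_Int nu_T_map slice_borel[OF B] F_def)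
  qed
  have "F p = F 0" using slice_mod[of B p] nu_mod[of p] by (simp add: F_def)
  then have "(\<Sum>i<p. F (Suc i)) = (\<Sum>i<p. F i)"
  proof -
    obtain q where q: "p = Suc q" using p_pos by (cases p) auto
    have "(\<Sum>i<Suc q. F (Suc i)) = (\<Sum>i<q. F (Suc i)) + F (Suc q)" by simp
    also have "F (Suc q) = F 0" using \<open>F p = F 0\<close> q by simp
    also have "(\<Sum>i<q. F (Suc i)) + F 0 = (\<Sum>i<Suc q. F i)"
      by (simp add: sum.lessThan_Suc_shift add.commute del: sum.lessThan_Suc)
    finally show ?thesis unfolding q .
  qed
  then show "emeasure N (lazy_map \<beta> -` B \<inter> space N) = emeasure N B"
    using emeasure_N[OF B'] emeasure_N[OF B] by (simp add: step F_def[symmetric])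
qed

lemma lazy_acim_N: "lazy_acim \<beta> N"
  using prob_space_N invariant_N equivalent_N_L
  by (simp add: lazy_acim_def equivalent_measures_def)

lemma lazy_acim_unique:
  assumes M: "lazy_acim \<beta> M"
  shows "M = N"
proof (rule trivial_invariant_sets_imp_unique)
  show "sets L = sets M" using M by (simp add: lazy_acim_def)
  show "emeasure L B = 0 \<or> emeasure L (space L - B) = 0"
    if "B \<in> sets L" "lazy_map \<beta> -` B \<inter> space L = B" for B
    using push_lambda_trivial[of B] that by simp
qed (use M lazy_acim_N in \<open>auto simp: lazy_acim_def\<close>)

lemma ergodic_N: "ergodic N (lazy_map \<beta>)"
  unfolding ergodic_def
proof (intro ballI impI)
  interpret prob_space N by (rule prob_space_N)
  fix B assume B: "B \<in> sets N" "lazy_map \<beta> -` B \<inter> space N = B"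
  have compl: "space N - B \<in> sets N" using sets.compl_sets[OF B(1)] .
  have "emeasure N B = 0 \<or> emeasure N (space N - B) = 0"
    using push_lambda_trivial[of B] B compl N_eq_0_iff[of B] N_eq_0_iff[of "space N - B"] by simp
  then show "emeasure N B = 0 \<or> emeasure N B = 1"
  proof
    assume "emeasure N (space N - B) = 0"
    then have "prob (space N - B) = 0" by (simp add: measure_def)
    then have "prob B = 1" using prob_compl[OF B(1)] by simp
    then show ?thesis by (simp add: emeasure_eq_measure)
  qed simp
qed

section \<open>Names under the lazy map and the entropy\<close>

lemma lazy_map_funpow_phi:
  assumes "0 \<le> z" "z < 1"
  shows "(lazy_map \<beta> ^^ k) (i mod p, xval i - z) = ((i + k) mod p, xval (i + k) - beta_orbit bs i k z)"
proof (induction k)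
  case (Suc k)
  then show ?case using lazy_map_phi[OF beta_orbit_bounds[OF assms], of "i + k" bs i k] by simp
qed simp

text \<open>The fibre index is recorded with the digit; \<open>name_approximation\<close> reads it
  off the first letter to know which fibre is to be approximated.\<close>

definition lazy_digit :: "nat \<times> real \<Rightarrow> nat \<times> int" where
  "lazy_digit = (\<lambda>(i, x). (i, \<lfloor>bs i * (xval i - x)\<rfloor>))"

definition enc :: "nat \<Rightarrow> int list \<Rightarrow> (nat \<times> int) list" where
  "enc i w = zip (map (\<lambda>k. (i + k) mod p) [0..<length w]) w"

lemma map_snd_enc [simp]: "map snd (enc i w) = w"
  by (simp add: enc_def)

lemma fst_hd_enc: "w \<noteq> [] \<Longrightarrow> fst (hd (enc i w)) = i mod p"
  by (cases w) (simp_all add: enc_def upt_conv_Cons del: upt_Suc)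

lemma orbit_name_phi:
  assumes "0 \<le> z" "z < 1"
  shows "orbit_name (lazy_map \<beta>) lazy_digit n (i mod p, xval i - z) = enc i (digits bs i n z)"
proof (rule nth_equalityI)
  fix k assume "k < length (orbit_name (lazy_map \<beta>) lazy_digit n (i mod p, xval i - z))"
  then have k: "k < n" by simp
  then show "orbit_name (lazy_map \<beta>) lazy_digit n (i mod p, xval i - z) ! k = enc i (digits bs i n z) ! k"
    by (simp add: orbit_name_nth enc_def digits_nth lazy_map_funpow_phi[OF assms] lazy_digit_def xval_mod b_mod)
qed (simp add: enc_def)

lemma simple_function_lazy_digit: "simple_function N lazy_digit"
  unfolding simple_function_def
proof (intro conjI ballI)
  have "lazy_digit ` space N \<subseteq> (\<Union>i<p. {i} \<times> {0..\<lfloor>bs i * xval i\<rfloor>})"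
  proof
    fix y assume "y \<in> lazy_digit ` space N"
    then obtain i x where y: "y = (i, \<lfloor>bs i * (xval i - x)\<rfloor>)" and x: "i < p" "0 < x" "x \<le> xval i"
      by (auto simp: lazy_digit_def mem_lazy_space)
    have "0 \<le> bs i * (xval i - x)" using gt0[of i] x by simp
    moreover have "bs i * (xval i - x) \<le> bs i * xval i" using gt0[of i] x by simp
    ultimately show "y \<in> (\<Union>i<p. {i} \<times> {0..\<lfloor>bs i * xval i\<rfloor>})"
      using y x by (auto intro: floor_mono)
  qed
  then show "finite (lazy_digit ` space N)" by (rule finite_subset) auto
  fix y
  have "Pair i -` (lazy_digit -` {y} \<inter> lazy_space \<beta>) \<in> sets borel" if "i < p" for i
  proof -
    have "Pair i -` (lazy_digit -` {y} \<inter> lazy_space \<beta>)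
        = {x. \<lfloor>bs i * (xval i - x)\<rfloor> = snd y} \<inter> (if i = fst y then {0<..xval i} else {})"
      using that by (auto simp: lazy_digit_def mem_lazy_space)
    moreover have "{x. \<lfloor>bs i * (xval i - x)\<rfloor> = snd y} \<in> sets borel" by measurable
    ultimately show ?thesis by simp
  qed
  then show "lazy_digit -` {y} \<inter> space N \<in> sets N" by (simp add: lazy_sets_iff)
qed

lemma sets_orbit_name: "{x \<in> space N. orbit_name (lazy_map \<beta>) lazy_digit n x \<in> S} \<in> sets N"
proof -
  have "{x \<in> space N. orbit_name (lazy_map \<beta>) lazy_digit n x \<in> S}
      = orbit_name (lazy_map \<beta>) lazy_digit n -` S \<inter> space N" by auto
  then show ?thesis
    using simple_functionD(2)[OF simple_function_orbit_name[OF invariant_underD(1)[OF invariant_N]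
        simple_function_lazy_digit]] by metis
qed

lemma slice_orbit_name:
  "slice {x \<in> space N. orbit_name (lazy_map \<beta>) lazy_digit n x \<in> S} i
    = {z \<in> {0..<1}. enc i (digits bs i n z) \<in> S}"
  using phi_mem_lazy_space[of _ i] by (auto simp: slice_def orbit_name_phi)

lemma measure_N_le:
  assumes B: "B \<in> sets N" and le: "\<And>i. measure lborel (slice B i) \<le> r"
  shows "measure N B \<le> C * r"
proof -
  have B': "B \<in> lazy_sets \<beta>" using B by simp
  have r: "0 \<le> r" using le[of 0] measure_nonneg order_trans by blast
  have "emeasure (\<nu> i) (slice B i) \<le> ennreal (C * r)" for i
  proof -
    have "emeasure (\<nu> i) (slice B i) \<le> ennreal C * emeasure lborel (slice B i \<inter> {0..<1})"
      by (rule nu_bounds(2)[OF slice_borel[OF B']])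
    also have "emeasure lborel (slice B i \<inter> {0..<1}) = ennreal (measure lborel (slice B i))"
      unfolding emeasure_lborel_Int_Ico[OF slice_borel[OF B']] using slice_subset[of B i] by (simp add: Int_absorb2)
    also have "ennreal C * \<dots> \<le> ennreal C * ennreal r" using le by (intro mult_left_mono ennreal_leI) auto
    also have "\<dots> = ennreal (C * r)" using constants by (simp add: ennreal_mult')
    finally show ?thesis .
  qed
  then have "emeasure N B \<le> ennreal (1 / real p) * (\<Sum>i<p. ennreal (C * r))"
    unfolding emeasure_N[OF B'] by (intro mult_left_mono sum_mono) auto
  also have "\<dots> = ennreal (1 / real p * (real p * (C * r)))"
    using constants r by (subst sum_ennreal) (simp_all add: ennreal_mult'[symmetric])
  also have "1 / real p * (real p * (C * r)) = C * r" by simp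
  finally show ?thesis using constants r unfolding measure_def by (intro enn2real_leI) auto
qed

text \<open>The part with z \<ge> 1 has empty slices and hence measure 0, so its names are left out
  of the count.\<close>

lemma AE_N_unit: "AE x in N. fst x < p \<and> xval (fst x) - snd x < 1 \<and> snd x \<le> xval (fst x)"
proof -
  let ?Z = "{x \<in> space N. \<not> (xval (fst x) - snd x < 1)}"
  have "Pair i -` ?Z = {0<..xval i - 1}" if "i < p" for i
    using that by (auto simp: mem_lazy_space)
  then have Z: "?Z \<in> lazy_sets \<beta>" by (simp add: lazy_sets_iff)
  have "slice ?Z i = {}" for i by (auto simp: slice_def xval_mod)
  then have "?Z \<in> null_sets N" using Z by (intro null_setsI) (simp_all add: emeasure_N)
  then have "AE x in N. x \<notin> ?Z" by (rule AE_not_in)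
  then show ?thesis
    by (rule AE_mp, intro AE_I2) (auto simp: mem_lazy_space)
qed

text \<open>A name is fixed by its starting fibre and its digits, which puts the factor p on top of
  \<open>card_digits\<close>; the period product is the constant of
  \<open>base_prod_growth\<close>.\<close>

lemma names_W:
  defines "W \<equiv> \<lambda>n. \<Union>i<p. enc i ` digits bs i n ` {0..<1}"
  shows "finite (W n)"
    and "AE x in N. orbit_name (lazy_map \<beta>) lazy_digit n x \<in> W n"
    and "real (card (W n)) \<le> real p * base_prod bs 0 p * (real n + 1) * exp (real n * base_rate)"
proof -
  have fin: "finite (digits bs i n ` {0..<1})" for i using card_digits[of 1 i n] by simp
  then show "finite (W n)" unfolding W_def by auto
  show "AE x in N. orbit_name (lazy_map \<beta>) lazy_digit n x \<in> W n"
    using AE_N_unit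
  proof eventually_elim
    case (elim x)
    define z where "z = xval (fst x) - snd x"
    have z: "0 \<le> z" "z < 1" using elim by (auto simp: z_def)
    have "x = (fst x mod p, xval (fst x) - z)" using elim by (simp add: z_def prod_eq_iff)
    then have "orbit_name (lazy_map \<beta>) lazy_digit n x = enc (fst x) (digits bs (fst x) n z)"
      using orbit_name_phi[OF z, of n "fst x"] by metis
    moreover have "enc (fst x) (digits bs (fst x) n z) \<in> enc (fst x) ` digits bs (fst x) n ` {0..<1}"
      using z by (intro imageI) simp
    ultimately show ?case unfolding W_def using elim by (intro UN_I[of "fst x"]) simp_all
  qed
  let ?P = "base_prod bs 0 p" and ?e = "exp (real n * base_rate)"
  have "card (W n) \<le> (\<Sum>i<p. card (enc i ` digits bs i n ` {0..<1}))"
    unfolding W_def by (rule card_UN_le) simp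
  also have "\<dots> \<le> (\<Sum>i<p. card (digits bs i n ` {0..<1}))"
    by (intro sum_mono card_image_le fin)
  finally have "real (card (W n)) \<le> (\<Sum>i<p. real (card (digits bs i n ` {0..<1})))"
    by (metis of_nat_le_iff of_nat_sum)
  also have "\<dots> \<le> (\<Sum>i<p. (real n + 1) * (?P * ?e))"
  proof (rule sum_mono)
    fix i
    have "real (card (digits bs i n ` {0..<1})) \<le> real n * base_prod bs i n + 1"
      using card_digits[of 1 i n] by simp
    also have "\<dots> \<le> (real n + 1) * base_prod bs i n" using base_prod_ge1[of i n] by (simp add: distrib_right)
    also have "\<dots> \<le> (real n + 1) * (?P * ?e)" by (intro mult_left_mono base_prod_growth(1)) auto
    finally show "real (card (digits bs i n ` {0..<1})) \<le> (real n + 1) * (?P * ?e)" .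
  qed
  also have "\<dots> = real p * ?P * (real n + 1) * ?e" by simp
  finally show "real (card (W n)) \<le> real p * ?P * (real n + 1) * ?e" .
qed

text \<open>The factor 2 arises from centring an interval at an arbitrary point of the
  cylinder.\<close>

lemma measure_cylinder_le:
  "measure lborel {z \<in> {0..<1}. digits bs i n z = w} \<le> 2 / base_prod bs i n"
proof (cases "{z \<in> {0..<1}. digits bs i n z = w} = {}")
  case True
  have "0 \<le> 2 / base_prod bs i n" using base_prod_pos[of i n] by simp
  then show ?thesis unfolding True by simp
next
  case False
  then obtain y where y: "0 \<le> y" "y < 1" "digits bs i n y = w" by auto
  let ?r = "1 / base_prod bs i n"
  have r: "0 \<le> ?r" using base_prod_pos[of i n] by simp
  have "{z \<in> {0..<1}. digits bs i n z = w} \<subseteq> {y - ?r..y + ?r}"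
    using digits_eq_dist[of i n _ y] y by fastforce
  moreover have "{z \<in> {0..<1}. digits bs i n z = w} = {z. digits bs i n z = w} \<inter> {0..<1}" by auto
  ultimately have "measure lborel {z \<in> {0..<1}. digits bs i n z = w} \<le> measure lborel {y - ?r..y + ?r}"
    using sets_digits_eq[of bs i n w]
    by (intro measure_mono_fmeasurable) (auto simp: fmeasurable_def emeasure_lborel_Icc_eq)
  also have "\<dots> = 2 * ?r" using r by simp
  finally show ?thesis by simp
qed

lemma prob_name_le:
  "measure N {x \<in> space N. orbit_name (lazy_map \<beta>) lazy_digit n x = w}
    \<le> (C * (2 * base_prod bs 0 p)) * exp (- real n * base_rate)"
proof -
  let ?B = "{x \<in> space N. orbit_name (lazy_map \<beta>) lazy_digit n x \<in> {w}}"
  have "measure lborel (slice ?B i) \<le> 2 * base_prod bs 0 p * exp (- real n * base_rate)" for i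
  proof -
    \<comment> \<open>On every fibre the digits are the second components of the name.\<close>
    have "slice ?B i \<subseteq> {z \<in> {0..<1}. digits bs i n z = map snd w}"
      unfolding slice_orbit_name using map_snd_enc by fastforce
    then have "measure lborel (slice ?B i) \<le> measure lborel {z \<in> {0..<1}. digits bs i n z = map snd w}"
    proof (rule measure_mono_fmeasurable)
      show "slice ?B i \<in> sets lborel" using slice_borel[of ?B i] sets_orbit_name[of n "{w}"] by (simp only: sets_push sets_lborel)
      have "{z \<in> {0..<1}. digits bs i n z = map snd w} = {z. digits bs i n z = map snd w} \<inter> {0..<1}" by auto
      then show "{z \<in> {0..<1}. digits bs i n z = map snd w} \<in> fmeasurable lborel"
        using fmeasurable_Int_Ico[OF sets_digits_eq] by metis
    qed
    also have "\<dots> \<le> 2 / base_prod bs i n" by (rule measure_cylinder_le)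
    also have "\<dots> \<le> 2 * base_prod bs 0 p * exp (- real n * base_rate)"
    proof -
      have "1 \<le> base_prod bs 0 p * base_prod bs i n / exp (real n * base_rate)"
        using base_prod_growth(2)[of n i] by simp
      then have "1 \<le> base_prod bs 0 p * exp (- real n * base_rate) * base_prod bs i n"
        by (simp add: exp_minus field_simps)
      then show ?thesis using base_prod_pos[of i n] by (simp add: pos_divide_le_eq)
    qed
    finally show ?thesis .
  qed
  from measure_N_le[OF sets_orbit_name this] show ?thesis by (simp add: mult.assoc)
qed

lemma name_approximation:
  assumes A: "A \<in> sets N" and e: "0 < \<epsilon>"
  shows "\<exists>m S. measure N {x \<in> space N. (x \<in> A) \<noteq> (orbit_name (lazy_map \<beta>) lazy_digit m x \<in> S)} < \<epsilon>"
proof -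
  have A': "A \<in> lazy_sets \<beta>" using A by simp
  \<comment> \<open>\<open>C + 1\<close> instead of \<open>C\<close> gives a nonzero denominator and
    a strict inequality at the end.\<close>
  define \<epsilon>' where "\<epsilon>' = \<epsilon> / (C + 1)"
  have e': "0 < \<epsilon>'" using e constants by (simp add: \<epsilon>'_def)
  have "\<forall>i. \<exists>m S. measure lborel {z \<in> {0..<1}. (z \<in> slice A i) \<noteq> (digits bs i m z \<in> S)} < \<epsilon>'"
    using cyl_approximable_borel[OF slice_borel[OF A']] e' unfolding cyl_approximable_def by blast
  then obtain mm SS where mS:
    "\<And>i. measure lborel {z \<in> {0..<1}. (z \<in> slice A i) \<noteq> (digits bs i (mm i) z \<in> SS i)} < \<epsilon>'"
    unfolding choice_iff by blast
  \<comment> \<open>\<open>Suc\<close> keeps the names nonempty, so that a first letter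
    exists.\<close>
  define m where "m = Suc (\<Sum>i<p. mm i)"
  have mle: "mm i \<le> m" if "i < p" for i
    using member_le_sum[of i "{..<p}" mm] that unfolding m_def by simp
  \<comment> \<open>The first letter tells the fibre; the test belonging to that fibre is then
    applied to the prefix of its own length.\<close>
  define S where "S = {w. take (mm (fst (hd w))) (map snd w) \<in> SS (fst (hd w))}"
  let ?B = "{x \<in> space N. (x \<in> A) \<noteq> (orbit_name (lazy_map \<beta>) lazy_digit m x \<in> S)}"
  have BN: "?B \<in> sets N"
  proof -
    let ?Q = "{x \<in> space N. orbit_name (lazy_map \<beta>) lazy_digit m x \<in> S}"
    have "?B = (A - ?Q) \<union> (?Q - A)" using sets.sets_into_space[OF A] by auto
    moreover have "(A - ?Q) \<union> (?Q - A) \<in> sets N"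
      by (intro sets.Un sets.Diff A sets_orbit_name)
    ultimately show ?thesis by (simp only:)
  qed
  have enc: "enc i (digits bs i m z) \<in> S \<longleftrightarrow> digits bs (i mod p) (mm (i mod p)) z \<in> SS (i mod p)"
    if "i < p" for i z
  proof -
    have "digits bs i m z \<noteq> []" by (simp add: m_def)
    then show ?thesis
      using that digits_take[OF mle[OF that], of bs i z] by (simp add: S_def fst_hd_enc)
  qed
  have "measure lborel (slice ?B i) \<le> \<epsilon>'" for i
  proof -
    let ?i = "i mod p"
    have i: "?i < p" "?i mod p = ?i" by simp_all
    have "slice ?B ?i = {z \<in> {0..<1}. (z \<in> slice A ?i) \<noteq> (digits bs ?i (mm ?i) z \<in> SS ?i)}"
    proof (rule set_eqI)
      fix z
      have "z \<in> slice ?B ?i \<longleftrightarrow> z \<in> {0..<1} \<and> ((z \<in> slice A ?i) \<noteq> (enc ?i (digits bs ?i m z) \<in> S))"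
        using phi_mem_lazy_space[of z ?i] orbit_name_phi[of z m ?i] by (auto simp: slice_def)
      then show "z \<in> slice ?B ?i \<longleftrightarrow> z \<in> {z \<in> {0..<1}. (z \<in> slice A ?i) \<noteq> (digits bs ?i (mm ?i) z \<in> SS ?i)}"
        unfolding enc[OF i(1)] i(2) by simp
    qed
    then have "measure lborel (slice ?B ?i) \<le> \<epsilon>'" by (simp only: less_imp_le[OF mS])
    then show ?thesis by (simp only: slice_mod)
  qed
  from measure_N_le[OF BN this] have "measure N ?B \<le> C * \<epsilon>'" .
  also have "\<dots> < (C + 1) * \<epsilon>'" using e' by simp
  also have "\<dots> = \<epsilon>" using constants by (simp add: \<epsilon>'_def)
  finally show ?thesis by blast
qed

lemma entropy_N: "measure_theoretic_entropy N (lazy_map \<beta>) = ereal base_rate"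
proof -
  interpret prob_space N by (rule prob_space_N)
  show ?thesis
    by (rule measure_theoretic_entropy_generator[OF invariant_N simple_function_lazy_digit
        names_W(1) names_W(2) names_W(3) prob_name_le name_approximation])
qed

end

theorem theorem31:
  fixes p :: nat and \<beta> :: "real list"
  assumes "p \<ge> 1"
    and "length \<beta> = p"
    and "\<forall>i<p. \<beta> ! i > 1"
  shows "lazy_acim \<beta> (push_phi \<beta> (mu_greedy \<beta>))
    \<and> (\<forall>M. lazy_acim \<beta> M \<longrightarrow> M = push_phi \<beta> (mu_greedy \<beta>))
    \<and> equivalent_measures (push_phi \<beta> (mu_greedy \<beta>)) (push_phi \<beta> (lambda_p \<beta>))
    \<and> ergodic (push_phi \<beta> (mu_greedy \<beta>)) (lazy_map \<beta>)
    \<and> measure_theoretic_entropy (push_phi \<beta> (mu_greedy \<beta>)) (lazy_map \<beta>)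
        = ereal (1 / real p * ln (\<Prod>i<p. \<beta> ! i))"
proof -
  interpret B: beta_base \<beta> by unfold_locales (use assms in auto)
  obtain \<nu> a C where "B.invariant_fibre_family \<nu> a C" using B.ex_invariant_fibre_family by blast
  then interpret A: beta_acim \<beta> \<nu> a C by unfold_locales
  have "base_prod B.bs 0 (length \<beta>) = (\<Prod>i<length \<beta>. \<beta> ! i)"
    unfolding B.base_prod_eq_prod by (intro prod.cong) (auto simp: B.bs_eq)
  then have rate: "B.base_rate = 1 / real p * ln (\<Prod>i<p. \<beta> ! i)"
    unfolding B.base_rate_def using assms(2) by simp
  show ?thesis
    unfolding rate[symmetric]
    by (intro conjI allI impI A.lazy_acim_N A.lazy_acim_unique A.equivalent_N_L A.ergodic_N A.entropy_N)
qed

end
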